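(* Let $\alpha,\beta\in\mathbb{C}$ be nonzero with $|\alpha|^2+|\beta|^2=1$, and let $\mathcal{M}\subseteq H^2_{\alpha,\beta}$ be a nonzero closed $S_{\alpha,\beta}$-invariant subspace. Then there exists an inner function $\theta$ such that either $\mathcal{M}=z^2\theta H^2(\mathbb{D})$ or $\dim\big(\mathcal{M}\ominus z^2\theta H^2(\mathbb{D})\big)=1$. Moreover, $\theta$ is unique up to a scalar multiple of unit modulus.
   Context: $H^2(\mathbb{D})$ is the Hardy space of the open unit disc $\mathbb{D}$. Let $H^2_{\alpha,\beta}=\overline{\mathrm{span}}\{\alpha+\beta z,\ z^n: n\ge 2\}$, a closed subspace of $H^2(\mathbb{D})$. Let $P_{H^2_{\alpha,\beta}}$ be the orthogonal projection of $H^2(\mathbb{D})$ onto $H^2_{\alpha,\beta}$, $M_z$ multiplication by $z$ on $H^2(\mathbb{D})$, and $S_{\alpha,\beta}=P_{H^2_{\alpha,\beta}}M_z|_{H^2_{\alpha,\beta}}$. A subspace $\mathcal{M}$ is $S_{\alpha,\beta}$-invariant if $S_{\alpha,\beta}\mathcal{M}\subseteq\mathcal{M}$. For closed subspaces $\mathcal{N}\subseteq\mathcal{M}$, $\mathcal{M}\ominus\mathcal{N}$ is the orthogonal complement of $\mathcal{N}$ in $\mathcal{M}$.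
   Formalization: The alternative dim(M ⊖ z²θH²)=1 is admitted only when M is not of the form z²φH² with φ inner; otherwise uniqueness of θ fails: for M = z²H², both θ = 1 (equality) and θ = z (dimension one) qualify. *)

theory Defs
  imports "HOL-Complex_Analysis.Complex_Analysis" "HOL-Library.Function_Algebras"
begin

text \<open>
  Complex-linear notions (subspace, span, dimension) for functions \<open>complex \<Rightarrow> complex\<close> are those of the
  library locale \<open>vector_space\<close>, for pointwise addition and the scaling \<open>cscale\<close>. The library's
  \<open>dim\<close> of an infinite-dimensional space is 0, so \<open>dim = 1\<close> does mean one-dimensional.
\<close>

definition cscale :: "complex \<Rightarrow> (complex \<Rightarrow> complex) \<Rightarrow> complex \<Rightarrow> complex" where
  "cscale c f = (\<lambda>z. c * f z)"

global_interpretation cfun: vector_space cscale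
  by standard (auto simp: cscale_def fun_eq_iff algebra_simps)

abbreviation unit_disc :: "complex set" where
  "unit_disc \<equiv> ball 0 1"

definition on_disc :: "(complex \<Rightarrow> complex) \<Rightarrow> complex \<Rightarrow> complex" where
  "on_disc f = (\<lambda>z. if z \<in> unit_disc then f z else 0)"

definition taylor_coeff :: "(complex \<Rightarrow> complex) \<Rightarrow> nat \<Rightarrow> complex" where
  "taylor_coeff f n = (deriv ^^ n) f 0 / fact n"

text \<open>
  The Hardy space consists of the holomorphic functions on the disc with square-summable Taylor
  coefficients. As functions are total here, its elements are extended by 0 outside the disc, so that
  equality of elements is equality on the disc.
\<close>

definition H2 :: "(complex \<Rightarrow> complex) set" where
  "H2 = {f. f holomorphic_on unit_disc \<and> summable (\<lambda>n. (cmod (taylor_coeff f n))\<^sup>2)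
            \<and> (\<forall>z. z \<notin> unit_disc \<longrightarrow> f z = 0)}"

definition h2_inner :: "(complex \<Rightarrow> complex) \<Rightarrow> (complex \<Rightarrow> complex) \<Rightarrow> complex" where
  "h2_inner f g = (\<Sum>\<^sub>\<infinity>n. taylor_coeff f n * cnj (taylor_coeff g n))"

definition h2_norm :: "(complex \<Rightarrow> complex) \<Rightarrow> real" where
  "h2_norm f = sqrt (\<Sum>\<^sub>\<infinity>n. (cmod (taylor_coeff f n))\<^sup>2)"

text \<open>The value 0 off \<open>H2\<close> only serves the locale \<open>Metric_space\<close>, whose symmetry axiom is not
  relativised to the carrier.\<close>

definition h2_dist :: "(complex \<Rightarrow> complex) \<Rightarrow> (complex \<Rightarrow> complex) \<Rightarrow> real" where
  "h2_dist f g = (if f \<in> H2 \<and> g \<in> H2 then h2_norm (f - g) else 0)"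

lemma taylor_coeff_diff:
  assumes "f \<in> H2" "g \<in> H2"
  shows "taylor_coeff (f - g) n = taylor_coeff f n - taylor_coeff g n"
proof -
  have "(deriv ^^ n) (\<lambda>w. f w - g w) 0 = (deriv ^^ n) f 0 - (deriv ^^ n) g 0"
    by (rule higher_deriv_diff[where S = "unit_disc"]) (use assms in \<open>auto simp: H2_def\<close>)
  then show ?thesis
    by (simp add: taylor_coeff_def fun_diff_def diff_divide_distrib)
qed

lemma taylor_coeff_add:
  assumes "f \<in> H2" "g \<in> H2"
  shows "taylor_coeff (f + g) n = taylor_coeff f n + taylor_coeff g n"
proof -
  have "(deriv ^^ n) (\<lambda>w. f w + g w) 0 = (deriv ^^ n) f 0 + (deriv ^^ n) g 0"
    by (rule higher_deriv_add[where S = "unit_disc"]) (use assms in \<open>auto simp: H2_def\<close>)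
  then show ?thesis
    by (simp add: taylor_coeff_def plus_fun_def add_divide_distrib)
qed

lemma taylor_coeff_cscale:
  assumes "f \<in> H2"
  shows "taylor_coeff (cscale c f) n = c * taylor_coeff f n"
proof -
  have "(deriv ^^ n) (\<lambda>w. c * f w) 0 = c * (deriv ^^ n) f 0"
    by (rule higher_deriv_cmult[where A = "unit_disc"]) (use assms in \<open>auto simp: H2_def\<close>)
  then show ?thesis
    by (simp add: taylor_coeff_def cscale_def)
qed

lemma H2_eqI:
  assumes "f \<in> H2" "g \<in> H2" "\<And>n. taylor_coeff f n = taylor_coeff g n"
  shows "f = g"
proof
  fix z
  show "f z = g z"
  proof (cases "z \<in> unit_disc")
    case True
    have *: "(\<lambda>n. taylor_coeff h n * (z - 0) ^ n) sums h z" if "h \<in> H2" for h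
      unfolding taylor_coeff_def by (rule holomorphic_power_series) (use that True in \<open>auto simp: H2_def\<close>)
    show ?thesis
      using *[OF assms(1)] *[OF assms(2)] unfolding assms(3) by (rule sums_unique2)
  qed (use assms in \<open>auto simp: H2_def\<close>)
qed

lemma square_summable_add:
  fixes a b :: "nat \<Rightarrow> complex"
  assumes a: "summable (\<lambda>n. (cmod (a n))\<^sup>2)" and b: "summable (\<lambda>n. (cmod (b n))\<^sup>2)"
  shows "summable (\<lambda>n. (cmod (a n + b n))\<^sup>2)"
    and "sqrt (\<Sum>n. (cmod (a n + b n))\<^sup>2) \<le> sqrt (\<Sum>n. (cmod (a n))\<^sup>2) + sqrt (\<Sum>n. (cmod (b n))\<^sup>2)"
proof -
  define C where "C = sqrt (\<Sum>n. (cmod (a n))\<^sup>2) + sqrt (\<Sum>n. (cmod (b n))\<^sup>2)"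
  have C0: "C \<ge> 0"
    unfolding C_def by (intro add_nonneg_nonneg real_sqrt_ge_zero suminf_nonneg a b) auto
  have bd: "(\<Sum>n<N. (cmod (a n + b n))\<^sup>2) \<le> C\<^sup>2" for N
  proof -
    have "sqrt (\<Sum>n<N. (cmod (a n + b n))\<^sup>2) \<le> L2_set (\<lambda>n. cmod (a n) + cmod (b n)) {..<N}"
      unfolding L2_set_def by (intro real_sqrt_le_mono sum_mono power_mono norm_triangle_ineq) auto
    also have "\<dots> \<le> L2_set (\<lambda>n. cmod (a n)) {..<N} + L2_set (\<lambda>n. cmod (b n)) {..<N}"
      by (rule L2_set_triangle_ineq)
    also have "\<dots> \<le> C"
      unfolding L2_set_def C_def
      by (intro add_mono real_sqrt_le_mono sum_le_suminf a b) auto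
    finally show ?thesis
      by (rule sqrt_le_D)
  qed
  show s: "summable (\<lambda>n. (cmod (a n + b n))\<^sup>2)"
    by (rule summableI_nonneg_bounded[OF _ bd]) auto
  have "(\<Sum>n. (cmod (a n + b n))\<^sup>2) \<le> C\<^sup>2"
    by (rule suminf_le_const[OF s bd])
  then show "sqrt (\<Sum>n. (cmod (a n + b n))\<^sup>2) \<le> sqrt (\<Sum>n. (cmod (a n))\<^sup>2) + sqrt (\<Sum>n. (cmod (b n))\<^sup>2)"
    using C0 real_le_lsqrt unfolding C_def by blast
qed

lemma H2_add: "f \<in> H2 \<Longrightarrow> g \<in> H2 \<Longrightarrow> f + g \<in> H2"
  using taylor_coeff_add[of f g] square_summable_add(1)[of "taylor_coeff f" "taylor_coeff g"]
  by (auto simp: H2_def plus_fun_def intro!: holomorphic_intros)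

lemma H2_cscale: "f \<in> H2 \<Longrightarrow> cscale c f \<in> H2"
  using taylor_coeff_cscale[of f c]
  by (auto simp: H2_def norm_mult power_mult_distrib intro!: summable_mult)
     (auto simp: cscale_def intro!: holomorphic_intros)

lemma zero_in_H2: "0 \<in> H2"
proof -
  have "(deriv ^^ n) (\<lambda>z::complex. 0::complex) = (\<lambda>z. 0)" for n
    by (induction n) auto
  then show ?thesis
    by (auto simp: H2_def taylor_coeff_def zero_fun_def)
qed

lemma subspace_H2: "cfun.subspace H2"
  by (auto simp: cfun.subspace_def H2_add H2_cscale zero_in_H2)

lemma H2_diff: "f \<in> H2 \<Longrightarrow> g \<in> H2 \<Longrightarrow> f - g \<in> H2"
  using cfun.subspace_diff subspace_H2 by blast

lemma h2_norm_eq_suminf: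
  assumes "f \<in> H2"
  shows "h2_norm f = sqrt (\<Sum>n. (cmod (taylor_coeff f n))\<^sup>2)"
proof -
  have "((\<lambda>n. (cmod (taylor_coeff f n))\<^sup>2) has_sum (\<Sum>n. (cmod (taylor_coeff f n))\<^sup>2)) UNIV"
    using assms by (intro sums_nonneg_imp_has_sum) (auto simp: H2_def summable_sums)
  then show ?thesis
    by (simp add: h2_norm_def infsumI)
qed

global_interpretation h2: Metric_space H2 h2_dist
proof
  fix f g h :: "complex \<Rightarrow> complex"
  show "0 \<le> h2_dist f g"
    by (auto simp: h2_dist_def h2_norm_def intro!: infsum_nonneg)
  show "h2_dist f g = h2_dist g f"
    by (auto simp: h2_dist_def h2_norm_def taylor_coeff_diff norm_minus_commute)
  show "h2_dist f g = 0 \<longleftrightarrow> f = g" if fg: "f \<in> H2" "g \<in> H2"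
  proof
    assume "h2_dist f g = 0"
    then have "(\<Sum>n. (cmod (taylor_coeff (f - g) n))\<^sup>2) = 0"
      using fg by (simp add: h2_dist_def h2_norm_eq_suminf H2_diff)
    moreover have "summable (\<lambda>n. (cmod (taylor_coeff (f - g) n))\<^sup>2)"
      using H2_diff[OF fg] by (simp add: H2_def)
    ultimately have "\<forall>n. (cmod (taylor_coeff (f - g) n))\<^sup>2 = 0"
      by (subst (asm) suminf_eq_zero_iff) auto
    then show "f = g"
      using fg by (intro H2_eqI) (auto simp: taylor_coeff_diff)
  next
    assume "f = g"
    then show "h2_dist f g = 0"
      using taylor_coeff_diff[OF fg] by (simp add: h2_dist_def h2_norm_def)
  qed
  show "h2_dist f h \<le> h2_dist f g + h2_dist g h" if fgh: "f \<in> H2" "g \<in> H2" "h \<in> H2"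
  proof -
    have "summable (\<lambda>n. (cmod (taylor_coeff (f - g) n))\<^sup>2)" "summable (\<lambda>n. (cmod (taylor_coeff (g - h) n))\<^sup>2)"
      using fgh H2_diff by (auto simp: H2_def)
    from square_summable_add(2)[OF this] show ?thesis
      using fgh by (simp add: h2_dist_def h2_norm_eq_suminf H2_diff taylor_coeff_diff)
  qed
qed

definition H2ab :: "complex \<Rightarrow> complex \<Rightarrow> (complex \<Rightarrow> complex) set" where
  "H2ab \<alpha> \<beta> = h2.mtopology closure_of
     cfun.span ({on_disc (\<lambda>z. \<alpha> + \<beta> * z)} \<union> {on_disc (\<lambda>z. z ^ n) | n. n \<ge> 2})"

text \<open>Orthogonal projection onto a closed subspace \<open>K\<close> of \<open>H2\<close>.\<close>

definition h2_proj :: "(complex \<Rightarrow> complex) set \<Rightarrow> (complex \<Rightarrow> complex) \<Rightarrow> complex \<Rightarrow> complex" where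
  "h2_proj K f = (THE g. g \<in> K \<and> (\<forall>h\<in>K. h2_inner (f - g) h = 0))"

definition Mz :: "(complex \<Rightarrow> complex) \<Rightarrow> complex \<Rightarrow> complex" where
  "Mz f = (\<lambda>z. z * f z)"

definition Sab :: "complex \<Rightarrow> complex \<Rightarrow> (complex \<Rightarrow> complex) \<Rightarrow> complex \<Rightarrow> complex" where
  "Sab \<alpha> \<beta> f = h2_proj (H2ab \<alpha> \<beta>) (Mz f)"

definition h2_ominus :: "(complex \<Rightarrow> complex) set \<Rightarrow> (complex \<Rightarrow> complex) set \<Rightarrow> (complex \<Rightarrow> complex) set"
    (infixl "\<ominus>\<^sub>H" 65) where
  "M \<ominus>\<^sub>H N = {f \<in> M. \<forall>g\<in>N. h2_inner f g = 0}"

text \<open>Inner functions: bounded holomorphic functions on the disc whose radial limits exist and are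
  unimodular at almost every boundary point. Values outside the disc are irrelevant.\<close>

definition inner_function :: "(complex \<Rightarrow> complex) \<Rightarrow> bool" where
  "inner_function \<theta> \<longleftrightarrow>
     \<theta> holomorphic_on unit_disc \<and> bounded (\<theta> ` unit_disc) \<and>
     (AE t in lebesgue_on {0..2*pi}.
        \<exists>l. ((\<lambda>r. \<theta> (of_real r * cis t)) \<longlongrightarrow> l) (at_left (1::real)) \<and> cmod l = 1)"

definition z2_theta_H2 :: "(complex \<Rightarrow> complex) \<Rightarrow> (complex \<Rightarrow> complex) set" where
  "z2_theta_H2 \<theta> = {\<lambda>z. z\<^sup>2 * \<theta> z * f z | f. f \<in> H2}"

text \<open>
  \<open>inner_rep M \<theta>\<close>: either \<open>M = z\<^sup>2\<theta>H2\<close>, or \<open>M\<close> exceeds its subspace \<open>z\<^sup>2\<theta>H2\<close> by one dimension. The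
  second case is only for \<open>M\<close> that are not of the first form: if \<open>M = z\<^sup>2\<phi>H2\<close>, then
  \<open>\<theta> = \<phi>b\<close> would qualify for every Moebius factor \<open>b(z) = (z - a) / (1 - cnj a * z)\<close> with \<open>a\<close> in the
  disc, and \<open>\<theta>\<close> would not be unique.
\<close>

definition inner_rep :: "(complex \<Rightarrow> complex) set \<Rightarrow> (complex \<Rightarrow> complex) \<Rightarrow> bool" where
  "inner_rep M \<theta> \<longleftrightarrow> inner_function \<theta> \<and>
     (M = z2_theta_H2 \<theta> \<or>
      (\<nexists>\<phi>. inner_function \<phi> \<and> M = z2_theta_H2 \<phi>) \<and>
      z2_theta_H2 \<theta> \<subseteq> M \<and> cfun.dim (M \<ominus>\<^sub>H z2_theta_H2 \<theta>) = 1)"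

end

theory Submission
  imports Defs
begin

text \<open>
  On functions vanishing at 0 the compressed shift \<open>S\<close> of \<open>H2ab \<alpha> \<beta>\<close> is plain multiplication by \<open>z\<close>.
  The elements of \<open>M\<close> that vanish at 0 therefore form a closed shift-invariant subspace \<open>N\<close> of \<open>H2\<close>
  of codimension at most one in \<open>M\<close>. It is nonzero, for otherwise \<open>M\<close> would be spanned by an
  eigenvector of \<open>S\<close>, which would have a pole at \<open>\<alpha> * cnj \<beta>\<close>, a point of the disc (\<open>no_eigenvector\<close>).
  By Beurling's theorem \<open>N = \<psi> H2\<close>, and since elements of \<open>H2ab \<alpha> \<beta>\<close> that vanish at 0 vanish there
  twice, \<open>\<psi> = z\<^sup>2 \<theta>\<close> (\<open>vanishing_part_eq_z2_theta\<close>). If \<open>M = N\<close> this is the first alternative of the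
  theorem; if not, \<open>M \<ominus> N\<close> is a line, which is the second one (\<open>dim_excess\<close>). Conversely every
  \<open>\<phi>\<close> that represents \<open>M\<close> satisfies \<open>z\<^sup>2 \<phi> H2 = N\<close> (\<open>inner_rep_range\<close>), and an inner function is
  determined by its range up to a unimodular factor (\<open>wandering_unique\<close>).

  Most of the work is Beurling's theorem for inner functions defined by radial limits. It is
  split at the notion of a wandering vector: a unit vector \<open>\<psi>\<close> of \<open>H2\<close> that is orthogonal to
  \<open>z\<^sup>n \<psi>\<close> for all \<open>n \<ge> 1\<close>. Such a \<open>\<psi>\<close> multiplies \<open>H2\<close> isometrically into itself, because the first
  \<open>k\<close> coefficients of \<open>\<psi> h\<close> depend only on the first \<open>k\<close> coefficients of \<open>h\<close>. A nonzero closed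
  shift-invariant subspace contains a wandering vector, found as an element of least norm among
  those with a prescribed leading coefficient. Applying this a second time, to the part of the
  subspace orthogonal to \<open>\<psi> H2\<close>, would give another wandering vector \<open>g\<close> with \<open>g H2\<close> orthogonal to
  \<open>\<psi> H2\<close>; but \<open>g \<psi>\<close> lies in both. So \<open>\<psi> H2\<close> is everything (\<open>Beurling\<close>).

  It remains to see that the wandering vectors are the inner functions. An inner function is
  wandering since norms in \<open>H2\<close> are limits of means over circles (\<open>inner_imp_wandering\<close>).
  Conversely, a wandering vector \<open>\<psi>\<close> is bounded by 1, as all its powers have norm 1. Its radial
  limits exist almost everywhere by Fatou's theorem (\<open>radial_limit_exists\<close>); they have modulus at
  most 1, and their mean square modulus is 1, so their modulus is 1 almost everywhere. Fatou's
  theorem is deduced from an \<open>L\<^sup>2\<close> bound for the radial maximal function, proved by the \<open>T T*\<close>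
  method: for a measurable choice \<open>\<rho>(t)\<close> of radii let \<open>T g(t)\<close> be the Poisson integral of \<open>g\<close> at
  \<open>\<rho>(t) cis t\<close>. The semigroup law for Poisson kernels identifies the kernel of \<open>T T*\<close> as that for
  the radius \<open>\<rho>(t) \<rho>(t')\<close>, which is at most 8 times the sum of the kernels of \<open>T\<close> and \<open>T*\<close>. Hence the
  square of the norm of \<open>T\<close> is at most 16 times that norm, whatever \<open>\<rho>\<close> is.
\<close>

section \<open>Taylor coefficients and the inner product\<close>

abbreviation "tc \<equiv> taylor_coeff"

lemma H2_holomorphic: "f \<in> H2 \<Longrightarrow> f holomorphic_on unit_disc"
  by (simp add: H2_def)

lemma H2_outside: "f \<in> H2 \<Longrightarrow> \<not> cmod z < 1 \<Longrightarrow> f z = 0"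
  by (simp add: H2_def)

lemma taylor_sums:
  assumes "f holomorphic_on unit_disc" "cmod z < 1"
  shows "(\<lambda>n. tc f n * z ^ n) sums f z"
  using holomorphic_power_series[OF assms(1), of z] assms(2) by (simp add: taylor_coeff_def)

lemma taylor_coeff_eq_fps: "tc f n = fps_nth (fps_expansion f 0) n"
  by (simp add: taylor_coeff_def fps_expansion_def)

lemma taylor_coeff_unique:
  assumes "\<And>z. cmod z < 1 \<Longrightarrow> (\<lambda>n. c n * z ^ n) sums f z"
  shows "tc f n = c n"
proof -
  have "f has_fps_expansion Abs_fps c"
    by (rule has_fps_expansionI)
       (use assms in \<open>auto simp: eventually_nhds intro!: exI[of _ unit_disc]\<close>)
  then show ?thesis
    by (simp add: taylor_coeff_eq_fps fps_expansion_eqI)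
qed

lemma taylor_coeff_cong:
  assumes "\<And>z. cmod z < 1 \<Longrightarrow> f z = g z"
  shows "tc f n = tc g n"
proof -
  have "(deriv ^^ n) f 0 = (deriv ^^ n) g 0"
    by (rule higher_deriv_cong_ev) (use assms in \<open>auto simp: eventually_nhds intro!: exI[of _ unit_disc]\<close>)
  then show ?thesis by (simp add: taylor_coeff_def)
qed

lemma taylor_coeff_on_disc [simp]: "tc (on_disc f) n = tc f n"
  by (rule taylor_coeff_cong) (simp add: on_disc_def)

lemma taylor_coeff_mult:
  assumes "f holomorphic_on unit_disc" "g holomorphic_on unit_disc"
  shows "tc (\<lambda>z. f z * g z) n = (\<Sum>i\<le>n. tc f i * tc g (n - i))"
proof -
  have "(\<lambda>z. f z * g z) has_fps_expansion fps_expansion f 0 * fps_expansion g 0"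
    by (intro has_fps_expansion_mult has_fps_expansion_fps_expansion[of unit_disc] assms) auto
  then have "fps_expansion (\<lambda>z. f z * g z) 0 = fps_expansion f 0 * fps_expansion g 0"
    by (rule fps_expansion_eqI)
  then show ?thesis
    by (simp add: taylor_coeff_eq_fps fps_mult_nth atMost_atLeast0)
qed

lemma taylor_coeff_monom: "tc (\<lambda>z. z ^ k) n = (if n = k then 1 else 0)"
proof -
  have "(\<lambda>z::complex. z ^ k) has_fps_expansion fps_X ^ k"
    by (intro has_fps_expansion_power has_fps_expansion_fps_X)
  then have "fps_expansion (\<lambda>z::complex. z ^ k) 0 = fps_X ^ k"
    by (rule fps_expansion_eqI)
  then show ?thesis
    by (simp add: taylor_coeff_eq_fps fps_X_power_nth)
qed

lemma powser_summable:
  fixes c :: "nat \<Rightarrow> complex"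
  assumes "summable (\<lambda>n. (cmod (c n))\<^sup>2)" "cmod z < 1"
  shows "summable (\<lambda>n. c n * z ^ n)"
proof -
  have "(\<lambda>n. (cmod (c n))\<^sup>2) \<longlonglongrightarrow> 0"
    by (rule summable_LIMSEQ_zero[OF assms(1)])
  then have "(\<lambda>n. sqrt ((cmod (c n))\<^sup>2)) \<longlonglongrightarrow> sqrt 0"
    by (rule tendsto_real_sqrt)
  then have "c \<longlonglongrightarrow> 0"
    by (simp add: tendsto_norm_zero_iff)
  then have "Bseq c" using convergentI convergent_imp_Bseq by blast
  then obtain B where B: "\<And>n. cmod (c n) \<le> B" unfolding Bseq_def by blast
  have "summable (\<lambda>n. B * cmod z ^ n)"
    by (intro summable_mult summable_geometric) (use assms in auto)
  then show ?thesis
    by (rule summable_comparison_test'[where N = 0]) (auto simp: norm_mult norm_power intro!: mult_right_mono B)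
qed

definition h2_of :: "(nat \<Rightarrow> complex) \<Rightarrow> complex \<Rightarrow> complex" where
  "h2_of c = on_disc (\<lambda>z. \<Sum>n. c n * z ^ n)"

lemma h2_of:
  assumes "summable (\<lambda>n. (cmod (c n))\<^sup>2)"
  shows h2_of_in_H2: "h2_of c \<in> H2" and taylor_coeff_h2_of: "tc (h2_of c) n = c n"
proof -
  have s: "(\<lambda>n. c n * (z - 0) ^ n) sums h2_of c z" if "z \<in> unit_disc" for z
    using powser_summable[OF assms, of z] that by (simp add: h2_of_def on_disc_def summable_sums)
  then have h: "h2_of c holomorphic_on unit_disc"
    by (rule power_series_holomorphic)
  have t: "tc (h2_of c) n = c n" for n
    by (rule taylor_coeff_unique) (use s in auto)
  show "tc (h2_of c) n = c n" by (rule t)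
  show "h2_of c \<in> H2"
    using h assms by (auto simp: H2_def t) (simp add: h2_of_def on_disc_def)
qed

lemma H2_summable: "f \<in> H2 \<Longrightarrow> summable (\<lambda>n. (cmod (tc f n))\<^sup>2)"
  by (simp add: H2_def)

lemma h2_norm_nonneg [simp]: "h2_norm f \<ge> 0"
  by (simp add: h2_norm_def infsum_nonneg)

lemma h2_norm_sq_sums:
  assumes "f \<in> H2"
  shows "(\<lambda>n. (cmod (tc f n))\<^sup>2) sums (h2_norm f)\<^sup>2"
proof -
  have "(h2_norm f)\<^sup>2 = (\<Sum>n. (cmod (tc f n))\<^sup>2)"
    using H2_summable[OF assms] by (simp add: h2_norm_eq_suminf[OF assms] suminf_nonneg)
  then show ?thesis using H2_summable[OF assms] by (simp add: summable_sums)
qed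

text \<open>Membership in \<open>H2\<close> and a norm bound are obtained together from finitely many coefficients at
  a time.\<close>

lemma H2_boundedI:
  assumes "f holomorphic_on unit_disc" "\<And>z. \<not> cmod z < 1 \<Longrightarrow> f z = 0"
    and bd: "\<And>N. (\<Sum>n<N. (cmod (tc f n))\<^sup>2) \<le> B\<^sup>2" "B \<ge> 0"
  shows "f \<in> H2" "h2_norm f \<le> B"
proof -
  have "summable (\<lambda>n. (cmod (tc f n))\<^sup>2)"
    by (rule summableI_nonneg_bounded[OF _ bd(1)]) auto
  then show f: "f \<in> H2" using assms by (auto simp: H2_def)
  have "(h2_norm f)\<^sup>2 \<le> B\<^sup>2"
    using suminf_le_const[OF H2_summable[OF f] bd(1)] h2_norm_sq_sums[OF f] by (simp add: sums_iff)
  then show "h2_norm f \<le> B" using bd(2) by (rule power2_le_imp_le)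
qed

lemma h2_norm_partial:
  assumes "f \<in> H2" shows "(\<Sum>n<N. (cmod (tc f n))\<^sup>2) \<le> (h2_norm f)\<^sup>2"
  using sum_le_suminf[OF H2_summable[OF assms], of "{..<N}"] h2_norm_sq_sums[OF assms] by (simp add: sums_iff)

lemma taylor_coeff_le_norm:
  assumes "f \<in> H2" shows "cmod (tc f n) \<le> h2_norm f"
proof (rule power2_le_imp_le)
  show "(cmod (tc f n))\<^sup>2 \<le> (h2_norm f)\<^sup>2"
    using sum_le_suminf[OF H2_summable[OF assms], of "{n}"] h2_norm_sq_sums[OF assms] by (simp add: sums_iff)
qed simp

lemma h2_inner_sums:
  assumes "f \<in> H2" "g \<in> H2"
  shows "(\<lambda>n. tc f n * cnj (tc g n)) sums h2_inner f g"
proof -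
  have "summable (\<lambda>n. ((cmod (tc f n))\<^sup>2 + (cmod (tc g n))\<^sup>2) / 2)"
    by (intro summable_divide summable_add H2_summable assms)
  moreover have "norm (cmod (tc f n * cnj (tc g n))) \<le> ((cmod (tc f n))\<^sup>2 + (cmod (tc g n))\<^sup>2) / 2" for n
    using sum_squares_bound[of "cmod (tc f n)" "cmod (tc g n)"] by (simp add: norm_mult)
  ultimately have s: "summable (\<lambda>n. cmod (tc f n * cnj (tc g n)))"
    by (rule summable_comparison_test'[where N = 0])
  have "((\<lambda>n. tc f n * cnj (tc g n)) has_sum (\<Sum>n. tc f n * cnj (tc g n))) UNIV"
    by (rule norm_summable_imp_has_sum[OF s summable_sums[OF summable_norm_cancel[OF s]]])
  then have "((\<lambda>n. tc f n * cnj (tc g n)) has_sum h2_inner f g) UNIV"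
    unfolding h2_inner_def by (metis infsumI)
  then show ?thesis
    by (rule has_sum_imp_sums)
qed

lemma h2_inner_add_left:
  assumes "f \<in> H2" "g \<in> H2" "h \<in> H2"
  shows "h2_inner (f + g) h = h2_inner f h + h2_inner g h"
  using sums_add[OF h2_inner_sums[OF assms(1,3)] h2_inner_sums[OF assms(2,3)]]
    h2_inner_sums[OF H2_add[OF assms(1,2)] assms(3)]
  by (simp add: taylor_coeff_add assms algebra_simps sums_iff)

lemma h2_inner_cscale_left:
  assumes "f \<in> H2" "g \<in> H2"
  shows "h2_inner (cscale c f) g = c * h2_inner f g"
  using sums_mult[OF h2_inner_sums[OF assms], of c] h2_inner_sums[OF H2_cscale[OF assms(1)] assms(2)]
  by (simp add: taylor_coeff_cscale assms algebra_simps sums_iff)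

lemma h2_inner_commute:
  assumes "f \<in> H2" "g \<in> H2"
  shows "h2_inner f g = cnj (h2_inner g f)"
  using h2_inner_sums[OF assms] h2_inner_sums[OF assms(2,1)]
    sums_cnj[of "\<lambda>n. tc g n * cnj (tc f n)" "h2_inner g f"]
  by (simp add: sums_iff mult.commute)

lemma h2_inner_diff_left:
  assumes "f \<in> H2" "g \<in> H2" "h \<in> H2"
  shows "h2_inner (f - g) h = h2_inner f h - h2_inner g h"
  using h2_inner_add_left[of "f - g" g h] assms by (simp add: H2_diff)

lemma h2_inner_add_right:
  assumes "f \<in> H2" "g \<in> H2" "h \<in> H2"
  shows "h2_inner h (f + g) = h2_inner h f + h2_inner h g"
  using assms by (simp add: h2_inner_commute[of h] H2_add h2_inner_add_left)

lemma h2_inner_diff_right: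
  assumes "f \<in> H2" "g \<in> H2" "h \<in> H2"
  shows "h2_inner h (f - g) = h2_inner h f - h2_inner h g"
  using assms by (simp add: h2_inner_commute[of h] H2_diff h2_inner_diff_left)

lemma h2_inner_cscale_right:
  assumes "f \<in> H2" "g \<in> H2"
  shows "h2_inner f (cscale c g) = cnj c * h2_inner f g"
  using assms by (simp add: h2_inner_commute[of f] H2_cscale h2_inner_cscale_left)

lemma h2_inner_zero [simp]: "f \<in> H2 \<Longrightarrow> h2_inner 0 f = 0" "f \<in> H2 \<Longrightarrow> h2_inner f 0 = 0"
  using h2_inner_diff_left[of f f f] h2_inner_diff_right[of f f f] by auto

lemma h2_inner_self:
  assumes "f \<in> H2"
  shows "h2_inner f f = of_real ((h2_norm f)\<^sup>2)"
proof (rule sums_unique2)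
  show "(\<lambda>n. tc f n * cnj (tc f n)) sums h2_inner f f"
    by (rule h2_inner_sums[OF assms assms])
  show "(\<lambda>n. tc f n * cnj (tc f n)) sums of_real ((h2_norm f)\<^sup>2)"
    unfolding complex_norm_square[symmetric] by (rule sums_of_real[OF h2_norm_sq_sums[OF assms]])
qed

lemma h2_norm_eq_0_iff: "f \<in> H2 \<Longrightarrow> h2_norm f = 0 \<longleftrightarrow> f = 0"
  using h2.zero[of f 0] by (simp add: h2_dist_def zero_in_H2)

lemma h2_norm_zero [simp]: "h2_norm 0 = 0"
  using h2_norm_eq_0_iff[OF zero_in_H2] by simp

lemma h2_inner_self_eq_0_iff: "f \<in> H2 \<Longrightarrow> h2_inner f f = 0 \<longleftrightarrow> f = 0"
  by (simp add: h2_inner_self h2_norm_eq_0_iff)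

lemma h2_norm_cscale: assumes "f \<in> H2" shows "h2_norm (cscale c f) = cmod c * h2_norm f"
proof -
  have "(h2_norm (cscale c f))\<^sup>2 = (cmod c * h2_norm f)\<^sup>2"
    using sums_mult[OF h2_norm_sq_sums[OF assms], of "(cmod c)\<^sup>2"] h2_norm_sq_sums[OF H2_cscale[OF assms]]
    by (simp add: taylor_coeff_cscale assms norm_mult power_mult_distrib sums_iff)
  then show ?thesis by (simp add: power2_eq_iff_nonneg)
qed

lemma h2_norm_minus_commute: "f \<in> H2 \<Longrightarrow> g \<in> H2 \<Longrightarrow> h2_norm (f - g) = h2_norm (g - f)"
  using h2.commute[of f g] by (simp add: h2_dist_def)

lemma h2_norm_triangle:
  assumes "f \<in> H2" "g \<in> H2" shows "h2_norm (f + g) \<le> h2_norm f + h2_norm g"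
proof -
  have m: "- g \<in> H2" using cfun.subspace_neg[OF subspace_H2 assms(2)] .
  have "h2_dist f (- g) \<le> h2_dist f 0 + h2_dist 0 (- g)"
    by (rule h2.triangle) (use assms m zero_in_H2 in auto)
  then show ?thesis
    using assms m by (simp add: h2_dist_def zero_in_H2)
qed

lemma h2_norm_diff_sq:
  assumes "f \<in> H2" "g \<in> H2"
  shows "(h2_norm (f - g))\<^sup>2 = (h2_norm f)\<^sup>2 + (h2_norm g)\<^sup>2 - 2 * Re (h2_inner f g)"
proof -
  have "complex_of_real ((h2_norm (f - g))\<^sup>2) = h2_inner f f + h2_inner g g - (h2_inner f g + cnj (h2_inner f g))"
    using assms h2_inner_commute[of g f]
    by (simp add: h2_inner_self[symmetric] H2_diff h2_inner_diff_left h2_inner_diff_right del: of_real_power)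
  also have "\<dots> = of_real ((h2_norm f)\<^sup>2 + (h2_norm g)\<^sup>2 - 2 * Re (h2_inner f g))"
    using assms by (simp add: h2_inner_self complex_add_cnj)
  finally show ?thesis by (simp only: of_real_eq_iff)
qed

lemma h2_norm_add_sq:
  assumes "f \<in> H2" "g \<in> H2"
  shows "(h2_norm (f + g))\<^sup>2 = (h2_norm f)\<^sup>2 + (h2_norm g)\<^sup>2 + 2 * Re (h2_inner f g)"
proof -
  have m: "cscale (-1) g \<in> H2" "f + g = f - cscale (-1) g"
    using H2_cscale[OF assms(2)] by (blast, simp)
  show ?thesis
    unfolding m(2) h2_norm_diff_sq[OF assms(1) m(1)] h2_norm_cscale[OF assms(2)] h2_inner_cscale_right[OF assms] by simp
qed

lemma h2_Cauchy_Schwarz: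
  assumes "f \<in> H2" "g \<in> H2"
  shows "cmod (h2_inner f g) \<le> h2_norm f * h2_norm g"
proof (rule LIMSEQ_le_const2)
  show "(\<lambda>N. cmod (\<Sum>n<N. tc f n * cnj (tc g n))) \<longlonglongrightarrow> cmod (h2_inner f g)"
    using h2_inner_sums[OF assms] by (intro tendsto_norm) (simp add: sums_def)
  have "cmod (\<Sum>n<N. tc f n * cnj (tc g n)) \<le> h2_norm f * h2_norm g" for N
  proof -
    have "cmod (\<Sum>n<N. tc f n * cnj (tc g n)) \<le> (\<Sum>n<N. \<bar>cmod (tc f n)\<bar> * \<bar>cmod (tc g n)\<bar>)"
      by (rule sum_norm_le) (simp add: norm_mult)
    also have "\<dots> \<le> L2_set (\<lambda>n. cmod (tc f n)) {..<N} * L2_set (\<lambda>n. cmod (tc g n)) {..<N}"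
      by (rule L2_set_mult_ineq)
    also have "\<dots> \<le> h2_norm f * h2_norm g"
      unfolding L2_set_def
      by (intro mult_mono real_le_lsqrt h2_norm_partial assms) (auto intro!: sum_nonneg)
    finally show ?thesis .
  qed
  then show "\<exists>N. \<forall>n\<ge>N. cmod (\<Sum>n<n. tc f n * cnj (tc g n)) \<le> h2_norm f * h2_norm g" by blast
qed

section \<open>Completeness and closed subspaces\<close>

text \<open>A Cauchy sequence converges coefficientwise, and Fatou's lemma for sums, in the form of bounds
  on finitely many coefficients, makes the convergence one in norm.\<close>

lemma h2_complete:
  assumes \<sigma>: "\<And>n. \<sigma> n \<in> H2"
    and C: "\<And>e. e > 0 \<Longrightarrow> \<exists>N. \<forall>m\<ge>N. \<forall>n\<ge>N. h2_norm (\<sigma> m - \<sigma> n) \<le> e"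
  obtains f where "f \<in> H2" "(\<lambda>n. h2_norm (\<sigma> n - f)) \<longlonglongrightarrow> 0"
proof -
  have coeff: "tc (\<sigma> m - \<sigma> n) k = tc (\<sigma> m) k - tc (\<sigma> n) k" for m n k
    by (simp add: taylor_coeff_diff \<sigma>)
  have "Cauchy (\<lambda>n. tc (\<sigma> n) k)" for k
  proof (rule CauchyI)
    fix e :: real assume "e > 0"
    then obtain N where N: "\<forall>m\<ge>N. \<forall>n\<ge>N. h2_norm (\<sigma> m - \<sigma> n) \<le> e / 2" using C[of "e/2"] by auto
    have "cmod (tc (\<sigma> m) k - tc (\<sigma> n) k) < e" if "m \<ge> N" "n \<ge> N" for m n
      using taylor_coeff_le_norm[OF H2_diff[OF \<sigma> \<sigma>], of m n k] N that \<open>e > 0\<close> by (force simp: coeff)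
    then show "\<exists>M. \<forall>m\<ge>M. \<forall>n\<ge>M. cmod (tc (\<sigma> m) k - tc (\<sigma> n) k) < e" by blast
  qed
  then have "\<forall>k. \<exists>a. (\<lambda>n. tc (\<sigma> n) k) \<longlonglongrightarrow> a"
    by (simp add: Cauchy_convergent_iff convergent_def)
  then obtain a where a: "\<And>k. (\<lambda>n. tc (\<sigma> n) k) \<longlonglongrightarrow> a k" by metis
  have bd: "(\<Sum>k<K. (cmod (tc (\<sigma> n) k - a k))\<^sup>2) \<le> e\<^sup>2"
    if N: "\<forall>m\<ge>N. \<forall>n\<ge>N. h2_norm (\<sigma> m - \<sigma> n) \<le> e" and n: "n \<ge> N" for N n e K
  proof (rule LIMSEQ_le_const2)
    show "(\<lambda>m. (\<Sum>k<K. (cmod (tc (\<sigma> n) k - tc (\<sigma> m) k))\<^sup>2)) \<longlonglongrightarrow> (\<Sum>k<K. (cmod (tc (\<sigma> n) k - a k))\<^sup>2)"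
      by (intro tendsto_intros a)
    have "(\<Sum>k<K. (cmod (tc (\<sigma> n) k - tc (\<sigma> m) k))\<^sup>2) \<le> e\<^sup>2" if "m \<ge> N" for m
    proof -
      have "(\<Sum>k<K. (cmod (tc (\<sigma> n) k - tc (\<sigma> m) k))\<^sup>2) \<le> (h2_norm (\<sigma> n - \<sigma> m))\<^sup>2"
        using h2_norm_partial[OF H2_diff[OF \<sigma> \<sigma>], where N = K] by (simp add: coeff)
      also have "\<dots> \<le> e\<^sup>2" using N n that by (intro power_mono) auto
      finally show ?thesis .
    qed
    then show "\<exists>M. \<forall>m\<ge>M. (\<Sum>k<K. (cmod (tc (\<sigma> n) k - tc (\<sigma> m) k))\<^sup>2) \<le> e\<^sup>2" by blast
  qed
  obtain N1 where N1: "\<forall>m\<ge>N1. \<forall>n\<ge>N1. h2_norm (\<sigma> m - \<sigma> n) \<le> 1" using C[of 1] by auto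
  have "summable (\<lambda>k. (cmod (a k - tc (\<sigma> N1) k))\<^sup>2)"
    by (rule summableI_nonneg_bounded[where x = "1\<^sup>2"])
       (use bd[OF N1 order_refl] in \<open>auto simp: norm_minus_commute\<close>)
  from square_summable_add(1)[OF this H2_summable[OF \<sigma>[of N1]]]
  have a2: "summable (\<lambda>k. (cmod (a k))\<^sup>2)" by simp
  define f where "f = h2_of a"
  have f: "f \<in> H2" "\<And>k. tc f k = a k"
    using h2_of[OF a2] by (auto simp: f_def)
  have "(\<lambda>n. h2_norm (\<sigma> n - f)) \<longlonglongrightarrow> 0"
  proof (rule LIMSEQ_I)
    fix e :: real assume "e > 0"
    then obtain N where N: "\<forall>m\<ge>N. \<forall>n\<ge>N. h2_norm (\<sigma> m - \<sigma> n) \<le> e / 2" using C[of "e/2"] by auto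
    have "h2_norm (\<sigma> n - f) \<le> e / 2" if "n \<ge> N" for n
      by (rule H2_boundedI(2))
         (use bd[OF N that] \<open>e > 0\<close> H2_diff[OF \<sigma> f(1), of n] in \<open>auto simp: taylor_coeff_diff \<sigma> f H2_holomorphic H2_outside\<close>)
    then show "\<exists>no. \<forall>n\<ge>no. norm (h2_norm (\<sigma> n - f) - 0) < e" using \<open>e > 0\<close> by force
  qed
  with f that show thesis by blast
qed

lemma h2_closedI:
  assumes "V \<subseteq> H2"
    and "\<And>\<sigma> f. (\<And>n. \<sigma> n \<in> V) \<Longrightarrow> f \<in> H2 \<Longrightarrow> (\<lambda>n. h2_norm (\<sigma> n - f)) \<longlonglongrightarrow> 0 \<Longrightarrow> f \<in> V"
  shows "closedin h2.mtopology V"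
  unfolding h2.metric_closedin_iff_sequentially_closed
proof (intro conjI allI impI)
  show "V \<subseteq> H2" by fact
  fix \<sigma> f assume *: "range \<sigma> \<subseteq> V \<and> limitin h2.mtopology \<sigma> f sequentially"
  then have V: "\<And>n. \<sigma> n \<in> V" and f: "f \<in> H2" and "(\<lambda>n. h2_dist (\<sigma> n) f) \<longlonglongrightarrow> 0"
    by (auto simp: h2.limitin_metric_dist_null)
  moreover have "h2_dist (\<sigma> n) f = h2_norm (\<sigma> n - f)" for n
    using V f assms(1) by (auto simp: h2_dist_def)
  ultimately show "f \<in> V" using assms(2)[of \<sigma> f] by simp
qed

lemma h2_closedD:
  assumes "closedin h2.mtopology V" "\<And>n. \<sigma> n \<in> V" "f \<in> H2" "(\<lambda>n. h2_norm (\<sigma> n - f)) \<longlonglongrightarrow> 0"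
  shows "f \<in> V"
proof -
  have V: "V \<subseteq> H2" using closedin_subset[OF assms(1)] by simp
  then have "h2_dist (\<sigma> n) f = h2_norm (\<sigma> n - f)" for n
    using assms(2,3) by (auto simp: h2_dist_def)
  then have "limitin h2.mtopology \<sigma> f sequentially"
    using V assms(2-4) by (auto simp: h2.limitin_metric_dist_null intro!: always_eventually)
  with assms(1,2) show ?thesis
    unfolding h2.metric_closedin_iff_sequentially_closed by blast
qed

lemma tendsto_h2_inner:
  assumes "\<And>n. \<sigma> n \<in> H2" "f \<in> H2" "g \<in> H2" "(\<lambda>n. h2_norm (\<sigma> n - f)) \<longlonglongrightarrow> 0"
  shows "(\<lambda>n. h2_inner (\<sigma> n) g) \<longlonglongrightarrow> h2_inner f g"
proof (rule LIM_zero_cancel, rule Lim_null_comparison)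
  show "eventually (\<lambda>n. norm (h2_inner (\<sigma> n) g - h2_inner f g) \<le> h2_norm (\<sigma> n - f) * h2_norm g) sequentially"
    using h2_Cauchy_Schwarz[OF H2_diff[OF assms(1,2)] assms(3)] assms
    by (simp add: h2_inner_diff_left)
  show "(\<lambda>n. h2_norm (\<sigma> n - f) * h2_norm g) \<longlonglongrightarrow> 0"
    using tendsto_mult_left_zero[OF assms(4)] .
qed

lemma tendsto_taylor_coeff:
  assumes "\<And>n. \<sigma> n \<in> H2" "f \<in> H2" "(\<lambda>n. h2_norm (\<sigma> n - f)) \<longlonglongrightarrow> 0"
  shows "(\<lambda>n. tc (\<sigma> n) k) \<longlonglongrightarrow> tc f k"
proof (rule LIM_zero_cancel, rule Lim_null_comparison)
  show "eventually (\<lambda>n. norm (tc (\<sigma> n) k - tc f k) \<le> h2_norm (\<sigma> n - f)) sequentially"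
    using taylor_coeff_le_norm[OF H2_diff[OF assms(1,2)]] assms by (simp add: taylor_coeff_diff)
qed (rule assms)

lemma tendsto_h2_norm:
  assumes "\<And>n. \<sigma> n \<in> H2" "f \<in> H2" "(\<lambda>n. h2_norm (\<sigma> n - f)) \<longlonglongrightarrow> 0"
  shows "(\<lambda>n. h2_norm (\<sigma> n)) \<longlonglongrightarrow> h2_norm f"
proof (rule LIM_zero_cancel, rule Lim_null_comparison)
  have "\<bar>h2_norm (\<sigma> n) - h2_norm f\<bar> \<le> h2_norm (\<sigma> n - f)" for n
    using h2_norm_triangle[of "\<sigma> n - f" f] h2_norm_triangle[of "f - \<sigma> n" "\<sigma> n"] assms
    by (simp add: H2_diff h2_norm_minus_commute)
  then show "eventually (\<lambda>n. norm (h2_norm (\<sigma> n) - h2_norm f) \<le> h2_norm (\<sigma> n - f)) sequentially"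
    by simp
qed (rule assms)

section \<open>The shift and orthonormal sequences\<close>

text \<open>Elements of \<open>H2\<close> are added and multiplied as functions; these rules would reduce such
  expressions to pointwise ones.\<close>

declare plus_fun_apply [simp del] times_fun_apply [simp del] zero_fun_apply [simp del]

definition zpow :: "nat \<Rightarrow> complex \<Rightarrow> complex" where
  "zpow n = on_disc (\<lambda>z. z ^ n)"

lemma taylor_coeff_zpow [simp]: "tc (zpow n) k = (if k = n then 1 else 0)"
  by (simp add: zpow_def taylor_coeff_monom)

lemma zpow_holomorphic: "zpow n holomorphic_on unit_disc"
  by (rule holomorphic_transform[of "\<lambda>z. z ^ n"]) (auto simp: zpow_def on_disc_def intro!: holomorphic_intros)

lemma zpow_in_H2 [simp]: "zpow n \<in> H2"
proof -
  have "summable (\<lambda>k. (cmod (tc (zpow n) k))\<^sup>2)"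
    by (rule summable_finite[of "{n}"]) auto
  then show ?thesis
    using zpow_holomorphic by (auto simp: H2_def) (simp add: zpow_def on_disc_def)
qed

lemma zpow_mult_zpow: "zpow m * zpow n = zpow (m + n)"
  by (auto simp: zpow_def on_disc_def fun_eq_iff power_add times_fun_apply)

lemma zpow_mult_eq: "f \<in> H2 \<Longrightarrow> zpow n * f = (\<lambda>z. z ^ n * f z)"
  by (auto simp: zpow_def on_disc_def fun_eq_iff H2_outside times_fun_apply)

lemma zpow_0_mult [simp]: "f \<in> H2 \<Longrightarrow> zpow 0 * f = f"
  by (simp add: zpow_mult_eq)

lemma cscale_mult_left: "cscale c f * g = cscale c (f * g)" "f * cscale c g = cscale c (f * g)"
  by (auto simp: cscale_def fun_eq_iff times_fun_apply)

lemma taylor_coeff_times: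
  assumes "f \<in> H2" "g \<in> H2"
  shows "tc (f * g) n = (\<Sum>i\<le>n. tc f i * tc g (n - i))"
  using taylor_coeff_mult[OF H2_holomorphic[OF assms(1)] H2_holomorphic[OF assms(2)]] by (simp add: times_fun_def)

lemma taylor_coeff_shift:
  assumes "f \<in> H2"
  shows "tc (zpow n * f) k = (if k < n then 0 else tc f (k - n))"
proof -
  have "tc (zpow n * f) k = (\<Sum>i\<le>k. if i = n then tc f (k - n) else 0)"
    unfolding taylor_coeff_times[OF zpow_in_H2 assms] by (intro sum.cong) auto
  then show ?thesis by (simp add: sum.delta)
qed

lemma shift_in_H2 [simp]:
  assumes "f \<in> H2" shows "zpow n * f \<in> H2"
proof -
  have "summable (\<lambda>k. (cmod (tc (zpow n * f) (k + n)))\<^sup>2)"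
    using H2_summable[OF assms] by (simp add: taylor_coeff_shift assms)
  then have "summable (\<lambda>k. (cmod (tc (zpow n * f) k))\<^sup>2)"
    by (subst (asm) summable_iff_shift)
  moreover have "(zpow n * f) holomorphic_on unit_disc"
    using holomorphic_on_mult[OF zpow_holomorphic H2_holomorphic[OF assms]] by (simp add: times_fun_def)
  ultimately show ?thesis by (simp add: H2_def zpow_def on_disc_def times_fun_apply)
qed

lemma h2_inner_shift:
  assumes "f \<in> H2" "g \<in> H2"
  shows "h2_inner (zpow n * f) (zpow n * g) = h2_inner f g"
proof (rule sums_unique2)
  let ?a = "\<lambda>k. tc (zpow n * f) k * cnj (tc (zpow n * g) k)"
  show "?a sums h2_inner (zpow n * f) (zpow n * g)"
    by (rule h2_inner_sums) (simp_all add: assms)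
  have "(\<lambda>k. ?a (k + n)) sums (h2_inner f g - (\<Sum>k<n. ?a k))"
    using h2_inner_sums[OF assms] by (simp add: taylor_coeff_shift assms)
  then show "?a sums h2_inner f g"
    by (subst (asm) sums_iff_shift) simp
qed

lemma h2_norm_shift: "f \<in> H2 \<Longrightarrow> h2_norm (zpow n * f) = h2_norm f"
  using h2_inner_shift[of f f n] h2_norm_nonneg
  by (simp add: h2_inner_self power2_eq_iff_nonneg del: of_real_power)

definition ortho_sum :: "(nat \<Rightarrow> complex \<Rightarrow> complex) \<Rightarrow> (nat \<Rightarrow> complex) \<Rightarrow> nat \<Rightarrow> complex \<Rightarrow> complex" where
  "ortho_sum e c N = (\<Sum>n<N. cscale (c n) (e n))"

definition orthonormal :: "(nat \<Rightarrow> complex \<Rightarrow> complex) \<Rightarrow> bool" where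
  "orthonormal e \<longleftrightarrow> (\<forall>n. e n \<in> H2) \<and> (\<forall>m n. h2_inner (e m) (e n) = (if m = n then 1 else 0))"

lemma ortho_sum_Suc: "ortho_sum e c (Suc N) = ortho_sum e c N + cscale (c N) (e N)"
  by (simp add: ortho_sum_def)

lemma ortho_sum_0 [simp]: "ortho_sum e c 0 = 0"
  by (simp add: ortho_sum_def)

lemma ortho_sum_in_subspace:
  assumes "cfun.subspace V" "\<And>n. e n \<in> V"
  shows "ortho_sum e c N \<in> V"
  unfolding ortho_sum_def by (intro cfun.subspace_sum cfun.subspace_scale assms)

lemma ortho_sum_in_H2: "(\<And>n. e n \<in> H2) \<Longrightarrow> ortho_sum e c N \<in> H2"
  by (rule ortho_sum_in_subspace[OF subspace_H2])

lemma h2_inner_ortho_sum: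
  assumes "orthonormal e"
  shows "h2_inner (ortho_sum e c N) (e m) = (if m < N then c m else 0)"
proof (induction N)
  case (Suc N)
  then show ?case
    using assms by (auto simp: ortho_sum_Suc orthonormal_def h2_inner_add_left h2_inner_cscale_left
        H2_cscale ortho_sum_in_H2 less_Suc_eq)
qed (use assms in \<open>simp add: orthonormal_def\<close>)

lemma h2_norm_ortho_sum:
  assumes "orthonormal e"
  shows "(h2_norm (ortho_sum e c N))\<^sup>2 = (\<Sum>n<N. (cmod (c n))\<^sup>2)"
proof (induction N)
  case (Suc N)
  have e: "e n \<in> H2" "h2_norm (e n) = 1" for n
  proof -
    show "e n \<in> H2" using assms by (simp add: orthonormal_def)
    then show "h2_norm (e n) = 1"
      using assms h2_inner_self[of "e n"] h2_norm_nonneg[of "e n"]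
      by (simp add: orthonormal_def power2_eq_1_iff del: of_real_power)
  qed
  show ?case
    using Suc by (simp add: ortho_sum_Suc h2_norm_add_sq e H2_cscale ortho_sum_in_H2 h2_norm_cscale
        h2_inner_cscale_right h2_inner_ortho_sum[OF assms])
qed simp

lemma h2_inner_ortho_sum_right:
  assumes "f \<in> H2" "\<And>n. e n \<in> H2"
  shows "h2_inner f (ortho_sum e c N) = (\<Sum>n<N. cnj (c n) * h2_inner f (e n))"
  by (induction N) (simp_all add: ortho_sum_Suc h2_inner_add_right h2_inner_cscale_right H2_cscale ortho_sum_in_H2 assms)

lemma Bessel_identity:
  assumes e: "orthonormal e" and f: "f \<in> H2"
  shows "(h2_norm (f - ortho_sum e (\<lambda>n. h2_inner f (e n)) N))\<^sup>2 =
    (h2_norm f)\<^sup>2 - (\<Sum>n<N. (cmod (h2_inner f (e n)))\<^sup>2)"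
proof -
  have eH: "e n \<in> H2" for n using e by (simp add: orthonormal_def)
  have "Re (\<Sum>n<N. cnj (h2_inner f (e n)) * h2_inner f (e n)) = (\<Sum>n<N. (cmod (h2_inner f (e n)))\<^sup>2)"
    unfolding Re_sum by (intro sum.cong) (auto simp: cmod_power2 simp flip: power2_eq_square)
  then show ?thesis
    by (simp add: h2_norm_diff_sq f eH ortho_sum_in_H2 h2_inner_ortho_sum_right h2_norm_ortho_sum[OF e])
qed

lemma orthonormal_zpow: "orthonormal zpow"
  unfolding orthonormal_def
proof (intro conjI allI)
  fix m n
  have "(\<lambda>k. tc (zpow m) k * cnj (tc (zpow n) k)) sums (\<Sum>k\<in>{m}. tc (zpow m) k * cnj (tc (zpow n) k))"
    by (rule sums_finite) auto
  then show "h2_inner (zpow m) (zpow n) = (if m = n then 1 else 0)"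
    using h2_inner_sums[of "zpow m" "zpow n"] by (auto simp: sums_iff)
qed simp

lemma h2_norm_zpow: "h2_norm (zpow n) = 1"
  using orthonormal_zpow h2_inner_self[of "zpow n"] h2_norm_nonneg[of "zpow n"]
  by (simp add: orthonormal_def power2_eq_1_iff del: of_real_power)

lemma h2_inner_zpow:
  assumes "f \<in> H2" shows "h2_inner f (zpow n) = tc f n"
proof -
  have "(\<lambda>k. tc f k * cnj (tc (zpow n) k)) sums (\<Sum>k\<in>{n}. tc f k * cnj (tc (zpow n) k))"
    by (rule sums_finite) auto
  then show ?thesis
    using h2_inner_sums[of f "zpow n"] assms by (auto simp: sums_iff)
qed

text \<open>Polynomials are dense: the Taylor polynomials are the orthogonal projections onto the span of
  the first monomials, and Bessel's identity measures the remainder.\<close>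

lemma taylor_sum_tendsto:
  assumes "f \<in> H2"
  shows "(\<lambda>N. h2_norm (f - ortho_sum zpow (tc f) N)) \<longlonglongrightarrow> 0"
proof -
  have eq: "(h2_norm (f - ortho_sum zpow (tc f) N))\<^sup>2 = (h2_norm f)\<^sup>2 - (\<Sum>n<N. (cmod (tc f n))\<^sup>2)" for N
    using Bessel_identity[OF orthonormal_zpow assms] by (simp add: h2_inner_zpow assms)
  have "(\<lambda>N. (h2_norm f)\<^sup>2 - (\<Sum>n<N. (cmod (tc f n))\<^sup>2)) \<longlonglongrightarrow> (h2_norm f)\<^sup>2 - (h2_norm f)\<^sup>2"
    using h2_norm_sq_sums[OF assms] unfolding sums_def by (intro tendsto_intros)
  then have "(\<lambda>N. sqrt ((h2_norm (f - ortho_sum zpow (tc f) N))\<^sup>2)) \<longlonglongrightarrow> sqrt 0"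
    unfolding eq by (intro tendsto_real_sqrt) simp
  then show ?thesis by simp
qed

lemma taylor_coeff_ortho_sum_zpow: "tc (ortho_sum zpow c N) k = (if k < N then c k else 0)"
  using h2_inner_ortho_sum[OF orthonormal_zpow] by (simp add: h2_inner_zpow ortho_sum_in_H2)

section \<open>Wandering vectors as isometric multipliers\<close>

text \<open>A unit vector spanning the wandering subspace \<open>V \<ominus> z V\<close> of the shift-invariant subspace \<open>V\<close>
  that it generates.\<close>

definition wandering :: "(complex \<Rightarrow> complex) \<Rightarrow> bool" where
  "wandering \<psi> \<longleftrightarrow> \<psi> \<in> H2 \<and> h2_norm \<psi> = 1 \<and> (\<forall>n\<ge>1. h2_inner (zpow n * \<psi>) \<psi> = 0)"

lemma wandering_orthonormal:
  assumes "wandering \<psi>"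
  shows "orthonormal (\<lambda>n. zpow n * \<psi>)"
proof -
  have \<psi>: "\<psi> \<in> H2" "h2_norm \<psi> = 1" "\<And>n. n \<ge> 1 \<Longrightarrow> h2_inner (zpow n * \<psi>) \<psi> = 0"
    using assms by (auto simp: wandering_def)
  have *: "h2_inner (zpow (n + k) * \<psi>) (zpow n * \<psi>) = (if k = 0 then 1 else 0)" for n k
  proof -
    have "h2_inner (zpow (n + k) * \<psi>) (zpow n * \<psi>) = h2_inner (zpow k * \<psi>) \<psi>"
      using h2_inner_shift[of "zpow k * \<psi>" \<psi> n] \<psi>(1) by (simp add: zpow_mult_zpow mult.assoc[symmetric])
    then show ?thesis using \<psi> by (auto simp: h2_inner_self)
  qed
  have "h2_inner (zpow m * \<psi>) (zpow n * \<psi>) = (if m = n then 1 else 0)" for m n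
  proof (cases "n \<le> m")
    case True
    then show ?thesis using *[of n "m - n"] by auto
  next
    case False
    then show ?thesis
      using *[of m "n - m"] h2_inner_commute[of "zpow m * \<psi>" "zpow n * \<psi>"] \<psi>(1) by auto
  qed
  then show ?thesis using \<psi> by (simp add: orthonormal_def)
qed

lemma mult_ortho_sum: "\<psi> * ortho_sum zpow c N = ortho_sum (\<lambda>n. zpow n * \<psi>) c N"
  by (simp add: ortho_sum_def sum_distrib_left cscale_mult_left mult.commute)

text \<open>The first \<open>N\<close> coefficients of \<open>\<psi> h\<close> are those of \<open>\<psi> p\<close> for the Taylor polynomial \<open>p\<close> of \<open>h\<close>, and
  \<open>\<psi> p\<close> has the norm of \<open>p\<close> since the \<open>z\<^sup>n \<psi>\<close> are orthonormal. No boundary values are involved.\<close>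

lemma wandering_mult_bounded:
  assumes "wandering \<psi>" and h: "h \<in> H2"
  shows "\<psi> * h \<in> H2" "h2_norm (\<psi> * h) \<le> h2_norm h"
proof -
  have \<psi>: "\<psi> \<in> H2" using assms(1) by (simp add: wandering_def)
  have "(\<Sum>n<N. (cmod (tc (\<psi> * h) n))\<^sup>2) \<le> (h2_norm h)\<^sup>2" for N
  proof -
    define p where "p = ortho_sum zpow (tc h) N"
    have p: "p \<in> H2" by (simp add: p_def ortho_sum_in_H2)
    have pp: "\<psi> * p = ortho_sum (\<lambda>n. zpow n * \<psi>) (tc h) N"
      by (simp add: p_def mult_ortho_sum)
    have "tc (\<psi> * h) n = tc (\<psi> * p) n" if "n < N" for n
      unfolding taylor_coeff_times[OF \<psi> h] taylor_coeff_times[OF \<psi> p]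
      by (intro sum.cong) (use that in \<open>auto simp: p_def taylor_coeff_ortho_sum_zpow\<close>)
    then have "(\<Sum>n<N. (cmod (tc (\<psi> * h) n))\<^sup>2) = (\<Sum>n<N. (cmod (tc (\<psi> * p) n))\<^sup>2)" by simp
    also have "\<dots> \<le> (h2_norm (\<psi> * p))\<^sup>2"
      by (rule h2_norm_partial) (simp add: pp ortho_sum_in_H2 \<psi>)
    also have "\<dots> = (\<Sum>n<N. (cmod (tc h n))\<^sup>2)"
      unfolding pp by (rule h2_norm_ortho_sum[OF wandering_orthonormal[OF assms(1)]])
    also have "\<dots> \<le> (h2_norm h)\<^sup>2" by (rule h2_norm_partial[OF h])
    finally show ?thesis .
  qed
  moreover have "(\<psi> * h) holomorphic_on unit_disc"
    using holomorphic_on_mult[OF H2_holomorphic[OF \<psi>] H2_holomorphic[OF h]] by (simp add: times_fun_def)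
  moreover have "(\<psi> * h) z = 0" if "\<not> cmod z < 1" for z
    using H2_outside[OF h that] by (simp add: times_fun_apply)
  ultimately show "\<psi> * h \<in> H2" "h2_norm (\<psi> * h) \<le> h2_norm h"
    using H2_boundedI[of "\<psi> * h" "h2_norm h"] by auto
qed

lemma wandering_mult_tendsto:
  assumes "wandering \<psi>" and h: "h \<in> H2"
  shows "(\<lambda>N. h2_norm (ortho_sum (\<lambda>n. zpow n * \<psi>) (tc h) N - \<psi> * h)) \<longlonglongrightarrow> 0"
proof (rule Lim_null_comparison[OF _ taylor_sum_tendsto[OF h]], rule always_eventually, rule allI)
  fix N
  let ?p = "ortho_sum zpow (tc h) N"
  have \<psi>: "\<psi> \<in> H2" using assms(1) by (simp add: wandering_def)
  have "h2_norm (ortho_sum (\<lambda>n. zpow n * \<psi>) (tc h) N - \<psi> * h) = h2_norm (\<psi> * (h - ?p))"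
    using wandering_mult_bounded(1)[OF assms]
    by (simp add: mult_ortho_sum[symmetric] right_diff_distrib)
       (simp add: mult_ortho_sum ortho_sum_in_H2 \<psi> h2_norm_minus_commute)
  also have "\<dots> \<le> h2_norm (h - ?p)"
    by (rule wandering_mult_bounded(2)[OF assms(1)]) (simp add: h H2_diff ortho_sum_in_H2)
  finally show "norm (h2_norm (ortho_sum (\<lambda>n. zpow n * \<psi>) (tc h) N - \<psi> * h)) \<le> h2_norm (h - ?p)" by simp
qed

lemma h2_norm_wandering_mult:
  assumes "wandering \<psi>" and h: "h \<in> H2"
  shows "h2_norm (\<psi> * h) = h2_norm h"
proof -
  have \<psi>: "\<psi> \<in> H2" using assms(1) by (simp add: wandering_def)
  have "(\<lambda>N. (h2_norm (ortho_sum (\<lambda>n. zpow n * \<psi>) (tc h) N))\<^sup>2) \<longlonglongrightarrow> (h2_norm (\<psi> * h))\<^sup>2"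
    by (intro tendsto_power tendsto_h2_norm wandering_mult_tendsto assms)
       (auto intro!: ortho_sum_in_H2 shift_in_H2 \<psi> wandering_mult_bounded assms)
  moreover have "(\<lambda>N. (h2_norm (ortho_sum (\<lambda>n. zpow n * \<psi>) (tc h) N))\<^sup>2) \<longlonglongrightarrow> (h2_norm h)\<^sup>2"
    unfolding h2_norm_ortho_sum[OF wandering_orthonormal[OF assms(1)]]
    using h2_norm_sq_sums[OF h] by (simp add: sums_def)
  ultimately have "(h2_norm (\<psi> * h))\<^sup>2 = (h2_norm h)\<^sup>2" by (rule LIMSEQ_unique)
  then show ?thesis by (simp add: power2_eq_iff_nonneg)
qed

text \<open>Polarization.\<close>

lemma h2_inner_wandering_mult:
  assumes \<psi>: "wandering \<psi>" and fg: "f \<in> H2" "g \<in> H2"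
  shows "h2_inner (\<psi> * f) (\<psi> * g) = h2_inner f g"
proof -
  note m = wandering_mult_bounded(1)[OF \<psi>] and n = h2_norm_wandering_mult[OF \<psi>]
  have Re: "Re (h2_inner (\<psi> * u) (\<psi> * v)) = Re (h2_inner u v)" if "u \<in> H2" "v \<in> H2" for u v
    using h2_norm_add_sq[OF m m, OF that] h2_norm_add_sq[OF that] n[OF H2_add[OF that]] n that
    by (simp add: distrib_left)
  have "Re (h2_inner (\<psi> * f) (\<psi> * cscale \<i> g)) = Re (h2_inner f (cscale \<i> g))"
    by (intro Re fg H2_cscale)
  then have "Im (h2_inner (\<psi> * f) (\<psi> * g)) = Im (h2_inner f g)"
    by (simp add: cscale_mult_left h2_inner_cscale_right m fg)
  with Re[OF fg] show ?thesis by (simp add: complex_eq_iff)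
qed

lemma wandering_mult_in_closed:
  assumes "wandering \<psi>" "h \<in> H2" "cfun.subspace V" "closedin h2.mtopology V" "\<And>n. zpow n * \<psi> \<in> V"
  shows "\<psi> * h \<in> V"
  by (rule h2_closedD[OF assms(4) _ _ wandering_mult_tendsto[OF assms(1,2)]])
     (use assms in \<open>auto intro!: ortho_sum_in_subspace wandering_mult_bounded\<close>)

section \<open>Orthogonal complements\<close>

definition ortho :: "(complex \<Rightarrow> complex) set \<Rightarrow> (complex \<Rightarrow> complex) set" where
  "ortho S = {f \<in> H2. \<forall>g\<in>S. h2_inner f g = 0}"

lemma subspace_ortho: "S \<subseteq> H2 \<Longrightarrow> cfun.subspace (ortho S)"
  by (auto simp: cfun.subspace_def ortho_def zero_in_H2 H2_add H2_cscale subset_iff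
      h2_inner_add_left h2_inner_cscale_left)

lemma closed_ortho:
  assumes "S \<subseteq> H2" shows "closedin h2.mtopology (ortho S)"
proof (rule h2_closedI)
  fix \<sigma> f assume \<sigma>: "\<And>n. \<sigma> n \<in> ortho S" and f: "f \<in> H2" "(\<lambda>n. h2_norm (\<sigma> n - f)) \<longlonglongrightarrow> 0"
  have "h2_inner f g = 0" if "g \<in> S" for g
  proof (rule LIMSEQ_unique)
    show "(\<lambda>n. h2_inner (\<sigma> n) g) \<longlonglongrightarrow> h2_inner f g"
      by (rule tendsto_h2_inner) (use \<sigma> f that assms in \<open>auto simp: ortho_def\<close>)
    show "(\<lambda>n. h2_inner (\<sigma> n) g) \<longlonglongrightarrow> 0"
      using \<sigma> that by (simp add: ortho_def)
  qed
  then show "f \<in> ortho S" using f by (simp add: ortho_def)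
qed (auto simp: ortho_def)

lemma ortho_wandering_range:
  assumes "wandering \<psi>" "f \<in> H2" "\<And>n. h2_inner f (zpow n * \<psi>) = 0" "h \<in> H2"
  shows "h2_inner f (\<psi> * h) = 0"
proof -
  have \<psi>: "\<psi> \<in> H2" using assms(1) by (simp add: wandering_def)
  have "h2_inner (zpow n * \<psi>) f = 0" for n
    using h2_inner_commute[of "zpow n * \<psi>" f] assms \<psi> by simp
  then have n: "zpow n * \<psi> \<in> ortho {f}" for n
    using \<psi> by (simp add: ortho_def)
  have "\<psi> * h \<in> ortho {f}"
    by (rule wandering_mult_in_closed[OF assms(1,4) subspace_ortho closed_ortho n]) (use assms in auto)
  then show ?thesis
    using h2_inner_commute[of f "\<psi> * h"] assms(2) by (simp add: ortho_def)
qed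

text \<open>The orthogonal projection onto \<open>\<psi> H2\<close>: its coefficients with respect to the \<open>z\<^sup>n \<psi>\<close> are square
  summable by Bessel's inequality, hence Taylor coefficients of some \<open>h\<close>.\<close>

lemma wandering_range_projection:
  assumes "wandering \<psi>" "f \<in> H2"
  obtains h where "h \<in> H2" "\<And>k. k \<in> H2 \<Longrightarrow> h2_inner (f - \<psi> * h) (\<psi> * k) = 0"
proof -
  have \<psi>: "\<psi> \<in> H2" using assms(1) by (simp add: wandering_def)
  note on = wandering_orthonormal[OF assms(1)]
  define c where "c n = h2_inner f (zpow n * \<psi>)" for n
  have "(\<Sum>n<N. (cmod (c n))\<^sup>2) \<le> (h2_norm f)\<^sup>2" for N
    using Bessel_identity[OF on assms(2), of N] zero_le_power2[of "h2_norm (f - ortho_sum (\<lambda>n. zpow n * \<psi>) c N)"]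
    unfolding c_def by linarith
  then have s: "summable (\<lambda>n. (cmod (c n))\<^sup>2)"
    by (intro summableI_nonneg_bounded) auto
  define h where "h = h2_of c"
  have h: "h \<in> H2" "\<And>n. tc h n = c n" using h2_of[OF s] by (auto simp: h_def)
  have m: "\<psi> * h \<in> H2" by (rule wandering_mult_bounded[OF assms(1) h(1)])
  have "h2_inner (f - \<psi> * h) (zpow n * \<psi>) = 0" for n
  proof -
    have "h2_inner (\<psi> * h) (zpow n * \<psi>) = h2_inner (\<psi> * h) (\<psi> * zpow n)" by (simp add: mult.commute)
    also have "\<dots> = c n" using h by (simp add: h2_inner_wandering_mult[OF assms(1)] h2_inner_zpow)
    finally show ?thesis using \<psi> m assms by (simp add: h2_inner_diff_left c_def)
  qed
  then have "h2_inner (f - \<psi> * h) (\<psi> * k) = 0" if "k \<in> H2" for k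
    using ortho_wandering_range[OF assms(1) H2_diff[OF assms(2) m] _ that] by blast
  with h that show thesis by blast
qed

section \<open>Beurling's theorem\<close>

text \<open>A sequence in \<open>C\<close> whose norms approach the infimum is Cauchy by the parallelogram law.\<close>

lemma minimal_norm_exists:
  assumes CH: "C \<subseteq> H2" and cl: "closedin h2.mtopology C" and ne: "C \<noteq> {}"
    and mid: "\<And>f g. f \<in> C \<Longrightarrow> g \<in> C \<Longrightarrow> cscale (1/2) (f + g) \<in> C"
  obtains g where "g \<in> C" "\<forall>f\<in>C. h2_norm g \<le> h2_norm f"
proof -
  define d where "d = (INF f\<in>C. (h2_norm f)\<^sup>2)"
  have bdd: "bdd_below ((\<lambda>f. (h2_norm f)\<^sup>2) ` C)" by (rule bdd_belowI[of _ 0]) auto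
  have dle: "d \<le> (h2_norm f)\<^sup>2" if "f \<in> C" for f
    unfolding d_def by (rule cINF_lower[OF bdd that])
  have "\<exists>f\<in>C. (h2_norm f)\<^sup>2 < d + 1 / Suc n" for n
    using cINF_less_iff[OF ne bdd, of "d + 1 / Suc n"] by (simp add: d_def)
  then obtain \<sigma> where \<sigma>: "\<And>n. \<sigma> n \<in> C" "\<And>n. (h2_norm (\<sigma> n))\<^sup>2 < d + 1 / Suc n" by metis
  have \<sigma>H: "\<sigma> n \<in> H2" for n using \<sigma>(1)[of n] CH by blast
  \<comment> \<open>The parallelogram law, with the midpoint's norm bounded below by \<open>d\<close>.\<close>
  have par: "(h2_norm (\<sigma> i - \<sigma> j))\<^sup>2 \<le> 2 / Suc i + 2 / Suc j" for i j
  proof -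
    have "d \<le> (h2_norm (\<sigma> i + \<sigma> j))\<^sup>2 / 4"
      using dle[OF mid[OF \<sigma>(1) \<sigma>(1)], of i j] \<sigma>H
      by (simp add: h2_norm_cscale H2_add power_mult_distrib power2_eq_square)
    then have "(h2_norm (\<sigma> i - \<sigma> j))\<^sup>2 \<le> 2 * (h2_norm (\<sigma> i))\<^sup>2 + 2 * (h2_norm (\<sigma> j))\<^sup>2 - 4 * d"
      using h2_norm_diff_sq[OF \<sigma>H \<sigma>H, of i j] h2_norm_add_sq[OF \<sigma>H \<sigma>H, of i j] by simp
    moreover have "2 / real (Suc k) = 2 * (1 / real (Suc k))" for k by simp
    ultimately show ?thesis using \<sigma>(2)[of i] \<sigma>(2)[of j] by linarith
  qed
  have "\<exists>N. \<forall>i\<ge>N. \<forall>j\<ge>N. h2_norm (\<sigma> i - \<sigma> j) \<le> e" if "e > 0" for e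
  proof -
    obtain N where N: "4 / e\<^sup>2 < real N" using reals_Archimedean2 by blast
    have "h2_norm (\<sigma> i - \<sigma> j) \<le> e" if ij: "i \<ge> N" "j \<ge> N" for i j
    proof (rule power2_le_imp_le)
      have b: "2 / real (Suc k) \<le> e\<^sup>2 / 2" if "k \<ge> N" for k
      proof -
        have "4 / e\<^sup>2 < real (Suc k)" using N that by linarith
        then show ?thesis using \<open>e > 0\<close> by (simp add: field_simps)
      qed
      show "(h2_norm (\<sigma> i - \<sigma> j))\<^sup>2 \<le> e\<^sup>2" using par[of i j] b[of i] b[of j] ij by linarith
    qed (use \<open>e > 0\<close> in simp)
    then show ?thesis by blast
  qed
  then obtain g where g: "g \<in> H2" "(\<lambda>n. h2_norm (\<sigma> n - g)) \<longlonglongrightarrow> 0"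
    by (rule h2_complete[of \<sigma>, OF \<sigma>H])
  have "g \<in> C" by (rule h2_closedD[OF cl \<sigma>(1) g])
  have "(h2_norm g)\<^sup>2 \<le> d + 0"
  proof (rule LIMSEQ_le)
    show "(\<lambda>n. (h2_norm (\<sigma> n))\<^sup>2) \<longlonglongrightarrow> (h2_norm g)\<^sup>2"
      by (intro tendsto_power tendsto_h2_norm \<sigma>H g)
    show "(\<lambda>n. d + 1 / real (Suc n)) \<longlonglongrightarrow> d + 0"
      by (intro tendsto_intros LIMSEQ_Suc[OF lim_inverse_n'])
  qed (use \<sigma>(2) less_imp_le in blast)
  then have "h2_norm g \<le> h2_norm f" if "f \<in> C" for f
    using dle[OF that] by (intro power2_le_imp_le[of "h2_norm g"]) (linarith, simp)
  with \<open>g \<in> C\<close> that show thesis by blast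
qed

text \<open>Otherwise moving \<open>g\<close> a little along \<open>v\<close>, namely subtracting its projection onto the line
  through \<open>v\<close>, would shorten it.\<close>

lemma minimal_norm_orthogonal:
  assumes g: "g \<in> H2" and v: "v \<in> H2" and min: "\<And>c. h2_norm g \<le> h2_norm (g - cscale c v)"
  shows "h2_inner g v = 0"
proof (rule ccontr)
  assume ne: "h2_inner g v \<noteq> 0"
  have "v \<noteq> 0" using ne g by auto
  then have pos: "(h2_norm v)\<^sup>2 > 0" using h2_norm_eq_0_iff[OF v] by simp
  define w where "w = h2_inner g v"
  define c where "c = w / of_real ((h2_norm v)\<^sup>2)"
  have "(h2_norm g)\<^sup>2 \<le> (h2_norm (g - cscale c v))\<^sup>2" by (intro power_mono min) simp
  also have "\<dots> = (h2_norm g)\<^sup>2 + (cmod c)\<^sup>2 * (h2_norm v)\<^sup>2 - 2 * Re (cnj c * w)"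
    using v g by (simp add: h2_norm_diff_sq H2_cscale h2_norm_cscale h2_inner_cscale_right power_mult_distrib w_def)
  also have "cnj c * w = of_real ((cmod w)\<^sup>2 / (h2_norm v)\<^sup>2)"
    using complex_norm_square[of w] by (simp add: c_def mult.commute)
  also have "(cmod c)\<^sup>2 * (h2_norm v)\<^sup>2 = (cmod w)\<^sup>2 / (h2_norm v)\<^sup>2"
  proof -
    have "cmod c = cmod w / (h2_norm v)\<^sup>2" by (simp add: c_def norm_divide del: of_real_power)
    then show ?thesis using pos by (simp add: power_divide power2_eq_square)
  qed
  finally have "(cmod w)\<^sup>2 / (h2_norm v)\<^sup>2 \<le> 0" by simp
  moreover have "(cmod w)\<^sup>2 / (h2_norm v)\<^sup>2 > 0" using ne pos by (simp add: w_def)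
  ultimately show False by linarith
qed

lemma shift_invariant_power:
  assumes "V \<subseteq> H2" "\<And>f. f \<in> V \<Longrightarrow> zpow 1 * f \<in> V" "f \<in> V"
  shows "zpow n * f \<in> V"
proof (induction n)
  case (Suc n)
  have "zpow (Suc n) * f = zpow 1 * (zpow n * f)"
    by (simp add: mult.assoc[symmetric] zpow_mult_zpow)
  then show ?case using assms(2)[OF Suc] by simp
qed (use assms in auto)

text \<open>Let \<open>m\<close> be the least order of vanishing at 0 in \<open>V\<close>. The shortest element of \<open>V\<close> with \<open>m\<close>-th
  Taylor coefficient 1 is orthogonal to every element of \<open>V\<close> that vanishes to higher order, and
  all of \<open>z V\<close> does.\<close>

lemma exists_wandering:
  assumes sub: "cfun.subspace V" and cl: "closedin h2.mtopology V" and ne: "V \<noteq> {0}"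
    and inv: "\<And>f. f \<in> V \<Longrightarrow> zpow 1 * f \<in> V"
  obtains \<psi> where "\<psi> \<in> V" "wandering \<psi>" "\<And>v. v \<in> V \<Longrightarrow> h2_inner (zpow 1 * v) \<psi> = 0"
proof -
  have VH: "V \<subseteq> H2" using closedin_subset[OF cl] by simp
  note inv' = shift_invariant_power[OF VH inv]
  obtain f0 where f0: "f0 \<in> V" "f0 \<noteq> 0" using ne cfun.subspace_0[OF sub] by blast
  then obtain m0 where "tc f0 m0 \<noteq> 0"
    using H2_eqI[of f0 0] VH zero_in_H2 by (metis subsetD h2_inner_zpow h2_inner_zero(1) zpow_in_H2)
  then have ex: "\<exists>m. \<exists>f\<in>V. tc f m \<noteq> 0" using f0 by blast
  define m where "m = (LEAST m. \<exists>f\<in>V. tc f m \<noteq> 0)"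
  obtain f1 where f1: "f1 \<in> V" "tc f1 m \<noteq> 0" using LeastI_ex[OF ex] unfolding m_def by blast
  have low: "tc f k = 0" if "f \<in> V" "k < m" for f k
    using not_less_Least[of k "\<lambda>m. \<exists>f\<in>V. tc f m \<noteq> 0"] that unfolding m_def by blast
  define C where "C = {f \<in> V. tc f m = 1}"
  have CH: "C \<subseteq> H2" using VH by (auto simp: C_def)
  have "cscale (1 / tc f1 m) f1 \<in> C"
    using f1 VH cfun.subspace_scale[OF sub] by (auto simp: C_def taylor_coeff_cscale)
  then have Cne: "C \<noteq> {}" by blast
  have Ccl: "closedin h2.mtopology C"
  proof (rule h2_closedI[OF CH])
    fix \<sigma> f assume \<sigma>: "\<And>n. \<sigma> n \<in> C" and f: "f \<in> H2" "(\<lambda>n. h2_norm (\<sigma> n - f)) \<longlonglongrightarrow> 0"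
    have \<sigma>V: "\<sigma> n \<in> V" and \<sigma>H: "\<sigma> n \<in> H2" for n using \<sigma>[of n] CH by (auto simp: C_def)
    have "(\<lambda>n. tc (\<sigma> n) m) \<longlonglongrightarrow> tc f m" by (rule tendsto_taylor_coeff[OF \<sigma>H f])
    moreover have "(\<lambda>n. tc (\<sigma> n) m) \<longlonglongrightarrow> 1" using \<sigma> by (simp add: C_def)
    ultimately have "tc f m = 1" by (rule LIMSEQ_unique)
    then show "f \<in> C" using h2_closedD[OF cl \<sigma>V f] by (simp add: C_def)
  qed
  have Cmid: "cscale (1/2) (f + g) \<in> C" if "f \<in> C" "g \<in> C" for f g
    using that CH by (auto simp: C_def taylor_coeff_cscale taylor_coeff_add H2_add subset_iff
        intro!: cfun.subspace_scale[OF sub] cfun.subspace_add[OF sub])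
  obtain g where gC: "g \<in> C" and gmin: "\<forall>f\<in>C. h2_norm g \<le> h2_norm f"
    by (rule minimal_norm_exists[OF CH Ccl Cne Cmid])
  have gV: "g \<in> V" and gm: "tc g m = 1" and g: "g \<in> H2" using gC CH by (auto simp: C_def)
  have orth: "h2_inner g v = 0" if v: "v \<in> V" "tc v m = 0" for v
  proof (rule minimal_norm_orthogonal[OF g])
    show vH: "v \<in> H2" using v VH by blast
    show "h2_norm g \<le> h2_norm (g - cscale c v)" for c
      using v gV gm g vH by (intro gmin[rule_format]) (auto simp: C_def taylor_coeff_diff taylor_coeff_cscale H2_cscale
          intro!: cfun.subspace_diff[OF sub] cfun.subspace_scale[OF sub])
  qed
  have orth': "h2_inner (zpow n * v) g = 0" if v: "v \<in> V" "n \<ge> 1" for v n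
  proof -
    have vH: "v \<in> H2" using v VH by blast
    have "tc (zpow n * v) m = 0"
      using v low[OF v(1)] by (auto simp: taylor_coeff_shift vH)
    then have "h2_inner g (zpow n * v) = 0" by (intro orth inv' v)
    then show ?thesis using h2_inner_commute[of "zpow n * v" g] g vH by simp
  qed
  have "g \<noteq> 0"
    using gm h2_inner_zpow[of g m] g by auto
  then have gn: "h2_norm g \<noteq> 0" using h2_norm_eq_0_iff g by blast
  define \<psi> where "\<psi> = cscale (of_real (1 / h2_norm g)) g"
  have "\<psi> \<in> V" using gV by (simp add: \<psi>_def cfun.subspace_scale[OF sub])
  moreover have "wandering \<psi>"
    unfolding wandering_def
  proof (intro conjI allI impI)
    show "\<psi> \<in> H2" using calculation VH by blast
    show "h2_norm \<psi> = 1"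
      unfolding \<psi>_def h2_norm_cscale[OF g] using gn by (simp add: norm_divide)
    fix n :: nat assume "n \<ge> 1"
    have "h2_inner (zpow n * g) g = 0" by (rule orth'[OF gV \<open>n \<ge> 1\<close>])
    then show "h2_inner (zpow n * \<psi>) \<psi> = 0"
      using g by (simp add: \<psi>_def cscale_mult_left h2_inner_cscale_left h2_inner_cscale_right H2_cscale)
  qed
  moreover have "h2_inner (zpow 1 * v) \<psi> = 0" if "v \<in> V" for v
    using orth'[OF that, of 1] that VH g unfolding \<psi>_def
    by (subst h2_inner_cscale_right) auto
  ultimately show thesis by (rule that)
qed

text \<open>The part \<open>K\<close> of \<open>V\<close> orthogonal to \<open>\<psi> H2\<close> is itself closed and shift-invariant: for \<open>f \<in> K\<close>, the
  product \<open>z f\<close> is orthogonal to \<open>\<psi>\<close> by the choice of \<open>\<psi>\<close>, and to \<open>z\<^sup>n \<psi>\<close> for \<open>n \<ge> 1\<close> because the shift is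
  isometric. A wandering vector \<open>g\<close> of \<open>K\<close> would give the element \<open>g \<psi>\<close> of norm 1 in
  \<open>K \<inter> \<psi> H2 = {0}\<close>.\<close>

theorem Beurling:
  assumes sub: "cfun.subspace V" and cl: "closedin h2.mtopology V" and ne: "V \<noteq> {0}"
    and inv: "\<And>f. f \<in> V \<Longrightarrow> zpow 1 * f \<in> V"
  obtains \<psi> where "wandering \<psi>" "V = {\<psi> * h | h. h \<in> H2}"
proof -
  have VH: "V \<subseteq> H2" using closedin_subset[OF cl] by simp
  obtain \<psi> where \<psi>V: "\<psi> \<in> V" and \<psi>: "wandering \<psi>"
    and \<psi>orth: "\<And>v. v \<in> V \<Longrightarrow> h2_inner (zpow 1 * v) \<psi> = 0"
    using exists_wandering[OF assms] by metis
  have \<psi>H: "\<psi> \<in> H2" using \<psi>V VH by blast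
  note mH = wandering_mult_bounded(1)[OF \<psi>]
  define R where "R = {\<psi> * h | h. h \<in> H2}"
  have RH: "R \<subseteq> H2" using mH by (auto simp: R_def)
  have RV: "R \<subseteq> V"
    unfolding R_def using wandering_mult_in_closed[OF \<psi> _ sub cl shift_invariant_power[OF VH inv \<psi>V]] by blast
  define K where "K = V \<inter> ortho R"
  have Ksub: "cfun.subspace K" unfolding K_def by (intro cfun.subspace_inter sub subspace_ortho RH)
  have Kcl: "closedin h2.mtopology K" unfolding K_def by (intro closedin_Int cl closed_ortho RH)
  have Kinv: "zpow 1 * f \<in> K" if "f \<in> K" for f
  proof -
    have f: "f \<in> V" "f \<in> H2" "\<And>h. h \<in> H2 \<Longrightarrow> h2_inner f (\<psi> * h) = 0"
      using that by (auto simp: K_def ortho_def R_def)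
    have "h2_inner (zpow 1 * f) (zpow n * \<psi>) = 0" for n
    proof (cases n)
      case 0
      then show ?thesis using \<psi>orth[OF f(1)] \<psi>H by simp
    next
      case (Suc k)
      have "zpow n * \<psi> = zpow 1 * (\<psi> * zpow k)"
        using zpow_mult_zpow[of 1 k] unfolding Suc by (metis mult.assoc mult.commute plus_1_eq_Suc)
      then show ?thesis using f(3)[of "zpow k"] by (simp add: h2_inner_shift f mH del: One_nat_def)
    qed
    then have "h2_inner (zpow 1 * f) (\<psi> * h) = 0" if "h \<in> H2" for h
      using ortho_wandering_range[OF \<psi> shift_in_H2[OF f(2)] _ that] by blast
    then show ?thesis using f inv[OF f(1)] by (auto simp: K_def ortho_def R_def)
  qed
  have "K = {0}"
  proof (rule ccontr)
    assume "K \<noteq> {0}"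
    then obtain g where gK: "g \<in> K" and g: "wandering g"
      using exists_wandering[OF Ksub Kcl _ Kinv] by metis
    have gH: "g \<in> H2" using g by (simp add: wandering_def)
    have KH: "K \<subseteq> H2" by (auto simp: K_def ortho_def)
    have "g * \<psi> \<in> K"
      by (rule wandering_mult_in_closed[OF g \<psi>H Ksub Kcl shift_invariant_power[OF KH Kinv gK]])
    moreover have "g * \<psi> \<in> R" unfolding R_def using gH by (auto simp: mult.commute)
    ultimately have "h2_inner (g * \<psi>) (g * \<psi>) = 0" by (simp add: K_def ortho_def)
    then have "h2_inner \<psi> \<psi> = 0" using h2_inner_wandering_mult[OF g \<psi>H \<psi>H] by simp
    then show False using \<psi> by (simp add: wandering_def h2_inner_self)
  qed
  have "V \<subseteq> R"
  proof
    fix f assume f: "f \<in> V"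
    then have fH: "f \<in> H2" using VH by blast
    obtain h where h: "h \<in> H2" "\<And>k. k \<in> H2 \<Longrightarrow> h2_inner (f - \<psi> * h) (\<psi> * k) = 0"
      using wandering_range_projection[OF \<psi> fH] by metis
    have "\<psi> * h \<in> R" using h by (auto simp: R_def)
    moreover have "f - \<psi> * h \<in> K"
      using h f RV \<open>\<psi> * h \<in> R\<close> fH by (auto simp: K_def ortho_def R_def H2_diff mH intro!: cfun.subspace_diff[OF sub])
    ultimately show "f \<in> R" using \<open>K = {0}\<close> by simp
  qed
  with RV have "V = R" by blast
  with \<psi> that show thesis by (simp add: R_def)
qed

section \<open>Fourier series on the circle\<close>

text \<open>Normalized arc length, parametrized by the angle.\<close>

definition circ :: "real measure" where
  "circ = density lborel (\<lambda>s. ennreal (indicator {0..2*pi} s / (2*pi)))"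

lemma sets_circ [simp, measurable_cong]: "sets circ = sets borel"
  by (simp add: circ_def)

lemma space_circ [simp]: "space circ = UNIV"
  by (simp add: circ_def)

lemma emeasure_circ_UNIV [simp]: "emeasure circ UNIV = 1"
proof -
  have "emeasure circ UNIV = (\<integral>\<^sup>+s. ennreal (1 / (2*pi)) * indicator {0..2*pi} s \<partial>lborel)"
    unfolding circ_def by (subst emeasure_density) (auto intro!: nn_integral_cong split: split_indicator)
  also have "\<dots> = ennreal (1 / (2*pi)) * emeasure lborel {0..2*pi}"
    by (rule nn_integral_cmult_indicator) simp
  finally show ?thesis
    by (simp add: ennreal_mult[symmetric])
qed

interpretation circ: finite_measure circ
  by standard simp

interpretation circ2: pair_sigma_finite circ circ ..

lemma measure_circ_UNIV [simp]: "measure circ UNIV = 1"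
  by (simp add: measure_def)

lemma AE_circ_iff: "(AE s in circ. P s) \<longleftrightarrow> (AE s in lborel. s \<in> {0..2*pi} \<longrightarrow> P s)"
  unfolding circ_def by (subst AE_density) (auto simp: indicator_def elim!: eventually_mono)

lemma circ_integrable_bounded:
  fixes f :: "real \<Rightarrow> 'a::{banach, second_countable_topology}"
  assumes "f \<in> borel_measurable borel" "\<And>s. norm (f s) \<le> B"
  shows "integrable circ f"
  using assms by (intro circ.integrable_const_bound[where B = B]) (auto simp: measurable_cong_sets[OF sets_circ refl])

lemma borel_cis [measurable]: "cis \<in> borel_measurable borel"
  by (intro borel_measurable_continuous_onI continuous_intros)

lemma integral_circ_cis:
  "(LINT s|circ. cis (of_int k * s)) = (if k = 0 then 1 else 0)"
proof (cases "k = 0")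
  case False
  have "(LINT s|circ. cis (of_int k * s)) =
    (LINT s|lborel. (1 / (2*pi)) *\<^sub>R (indicator {0..2*pi} s *\<^sub>R cis (of_int k * s)))"
    unfolding circ_def by (subst integral_density) (simp_all add: scaleR_conv_of_real del: integral_mult_right_zero integral_divide_zero)
  also have "\<dots> = (1 / (2*pi)) *\<^sub>R (LINT s|lborel. indicator {0..2*pi} s *\<^sub>R cis (of_int k * s))"
    by (rule integral_scaleR_right)
  also have "(LINT s|lborel. indicator {0..2*pi} s *\<^sub>R cis (of_int k * s)) =
    cis (of_int k * (2*pi)) / (\<i> * of_int k) - cis (of_int k * 0) / (\<i> * of_int k)"
  proof (rule integral_FTC_Icc)
    fix x :: real
    let ?e = "\<lambda>z. exp (\<i> * of_int k * z) / (\<i> * of_int k)"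
    have "(?e has_field_derivative exp (\<i> * of_int k * of_real x)) (at (of_real x))"
      using False by (auto intro!: derivative_eq_intros)
    from has_vector_derivative_real_field[OF this, of "{0..2*pi}"]
    show "((\<lambda>x. cis (of_int k * x) / (\<i> * of_int k)) has_vector_derivative cis (of_int k * x)) (at x within {0..2*pi})"
      by (simp add: cis_conv_exp mult.assoc)
  qed (auto intro!: continuous_intros)
  also have "cis (of_int k * (2*pi)) = 1"
    using cis_multiple_2pi[of "of_int k"] by (simp add: mult_ac)
  finally show ?thesis using False by simp
qed simp

lemma circ_sums_integral:
  fixes b :: "nat \<Rightarrow> complex" and k :: "real \<Rightarrow> complex"
  assumes b: "summable (\<lambda>n. cmod (b n))" and k [measurable]: "k \<in> borel_measurable borel" and K: "\<And>s. cmod (k s) \<le> K"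
    and f: "\<And>s. (\<lambda>n. b n * cis (real n * s)) sums f s"
  shows "(\<lambda>n. b n * (LINT s|circ. cis (real n * s) * k s)) sums (LINT s|circ. f s * k s)"
proof -
  have K0: "K \<ge> 0" using K[of 0] norm_ge_zero order_trans by blast
  have int: "integrable circ (\<lambda>s. b n * cis (real n * s) * k s)" for n
    by (rule circ_integrable_bounded[where B = "cmod (b n) * K"])
       (auto simp: norm_mult intro!: mult_left_mono K)
  have bd: "(LINT s|circ. norm (b n * cis (real n * s) * k s)) \<le> cmod (b n) * K" for n
  proof -
    have "(LINT s|circ. norm (b n * cis (real n * s) * k s)) \<le> (LINT s|circ. cmod (b n) * K)"
      by (intro integral_mono integrable_norm int) (auto simp: norm_mult intro!: mult_left_mono K)
    then show ?thesis by simp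
  qed
  have "(\<lambda>n. LINT s|circ. b n * cis (real n * s) * k s) sums (LINT s|circ. (\<Sum>n. b n * cis (real n * s) * k s))"
  proof (rule sums_integral[OF int])
    show "AE s in circ. summable (\<lambda>n. norm (b n * cis (real n * s) * k s))"
      by (intro AE_I2) (simp add: norm_mult summable_mult2[OF b])
    show "summable (\<lambda>n. LINT s|circ. norm (b n * cis (real n * s) * k s))"
      by (rule summable_comparison_test'[where N = 0, OF summable_mult2[OF b, of K]])
         (use bd in \<open>auto simp: abs_of_nonneg integral_nonneg\<close>)
  qed
  moreover have "(\<Sum>n. b n * cis (real n * s) * k s) = f s * k s" for s
    using sums_mult2[OF f, of s "k s"] by (simp add: sums_iff)
  moreover have "(LINT s|circ. b n * cis (real n * s) * k s) = b n * (LINT s|circ. cis (real n * s) * k s)" for n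
    by (simp add: mult.assoc)
  ultimately show ?thesis by simp
qed

text \<open>The common source of Parseval's identity and of Cauchy's formula below: the latter pairs \<open>F\<close>
  with a geometric series.\<close>

lemma circ_pairing:
  fixes b c :: "nat \<Rightarrow> complex"
  assumes b: "summable (\<lambda>n. cmod (b n))" and c: "summable (\<lambda>n. cmod (c n))"
    and f: "\<And>s. (\<lambda>n. b n * cis (real n * s)) sums f s"
    and g: "\<And>s. (\<lambda>n. c n * cis (real n * s)) sums g s"
    and gm [measurable]: "g \<in> borel_measurable borel"
  shows "(\<lambda>n. b n * cnj (c n)) sums (LINT s|circ. f s * cnj (g s))"
proof -
  have gb: "cmod (g s) \<le> (\<Sum>n. cmod (c n))" for s
  proof -
    have "summable (\<lambda>n. cmod (c n * cis (real n * s)))" using c by (simp add: norm_mult)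
    from summable_norm[OF this] show ?thesis using g[of s] by (simp add: norm_mult sums_iff)
  qed
  have cm: "(\<lambda>s. cnj (g s)) \<in> borel_measurable borel"
    using borel_measurable_continuous_onI[of cnj] continuous_on_cnj[OF continuous_on_id]
    by (intro measurable_compose[OF gm]) simp
  have "(LINT s|circ. cis (real m * s) * cnj (g s)) = cnj (c m)" for m
  proof -
    have "(\<lambda>n. c n * (LINT s|circ. cis (real n * s) * cis (- (real m * s)))) sums (LINT s|circ. g s * cis (- (real m * s)))"
      by (rule circ_sums_integral[where K = 1]) (use c g in auto)
    moreover have "(LINT s|circ. cis (real n * s) * cis (- (real m * s))) = (if n = m then 1 else 0)" for n
      using integral_circ_cis[of "int n - int m"] by (simp add: cis_mult algebra_simps)
    ultimately have "(\<lambda>n. if n = m then c n else 0) sums (LINT s|circ. g s * cis (- (real m * s)))"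
      by (simp add: if_distrib cong: if_cong)
    moreover have "(\<lambda>n. if n = m then c n else 0) sums c m" by (rule sums_single)
    ultimately have "(LINT s|circ. g s * cis (- (real m * s))) = c m" by (rule sums_unique2)
    then have "cnj (LINT s|circ. g s * cis (- (real m * s))) = cnj (c m)" by simp
    moreover have "cis (real m * s) * cnj (g s) = cnj (g s * cis (- (real m * s)))" for s
      by (simp add: cis_cnj)
    ultimately show ?thesis by (simp only: Bochner_Integration.integral_cnj)
  qed
  then show ?thesis
    using circ_sums_integral[OF b cm _ f, of "\<Sum>n. cmod (c n)"] gb by simp
qed

lemma taylor_sums_larger:
  assumes F: "F holomorphic_on ball 0 R" and R: "R > 1"
  shows "summable (\<lambda>n. cmod (tc F n))" and "\<And>z. cmod z < R \<Longrightarrow> (\<lambda>n. tc F n * z ^ n) sums F z"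
proof -
  show s: "(\<lambda>n. tc F n * z ^ n) sums F z" if "cmod z < R" for z
    using holomorphic_power_series[OF F, of z] that by (simp add: taylor_coeff_def)
  obtain w where w: "1 < w" "w < R" using dense[OF R] by blast
  have "summable (\<lambda>n. tc F n * of_real w ^ n)" using s[of "of_real w"] w by (auto simp: sums_iff)
  from powser_insidea[OF this, of 1] w show "summable (\<lambda>n. cmod (tc F n))" by simp
qed

lemma holomorphic_circle:
  assumes F: "F holomorphic_on ball 0 R" and R: "R > 1"
  shows "\<And>s. (\<lambda>n. tc F n * cis (real n * s)) sums F (cis s)"
    and "(\<lambda>s. F (cis s)) \<in> borel_measurable borel"
proof -
  show "(\<lambda>n. tc F n * cis (real n * s)) sums F (cis s)" for s
    using taylor_sums_larger(2)[OF assms, of "cis s"] R unfolding Complex.DeMoivre by simp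
  have "continuous_on UNIV (\<lambda>s. F (cis s))"
    by (rule continuous_on_compose2[OF holomorphic_on_imp_continuous_on[OF F]])
       (use R in \<open>auto intro!: continuous_intros\<close>)
  then show "(\<lambda>s. F (cis s)) \<in> borel_measurable borel"
    by (rule borel_measurable_continuous_onI)
qed

lemma circle_bounded:
  assumes F: "F holomorphic_on ball 0 R" and R: "R > 1"
  obtains B where "\<And>s. cmod (F (cis s)) \<le> B"
proof -
  have "cmod (F (cis s)) \<le> (\<Sum>n. cmod (tc F n))" for s
  proof -
    have "summable (\<lambda>n. cmod (tc F n * cis (real n * s)))"
      using taylor_sums_larger(1)[OF assms] by (simp add: norm_mult)
    from summable_norm[OF this] show ?thesis using holomorphic_circle(1)[OF assms, of s] by (simp add: norm_mult sums_iff)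
  qed
  then show thesis by (rule that)
qed

lemma circle_Parseval:
  assumes F: "F holomorphic_on ball 0 R" and R: "R > 1"
  shows "(\<lambda>n. (cmod (tc F n))\<^sup>2) sums (LINT s|circ. (cmod (F (cis s)))\<^sup>2)"
proof -
  have "(\<lambda>n. tc F n * cnj (tc F n)) sums (LINT s|circ. F (cis s) * cnj (F (cis s)))"
    by (intro circ_pairing holomorphic_circle[OF assms] taylor_sums_larger(1)[OF assms])
  then have "(\<lambda>n. complex_of_real ((cmod (tc F n))\<^sup>2)) sums of_real (LINT s|circ. (cmod (F (cis s)))\<^sup>2)"
    by (simp only: complex_norm_square[symmetric] integral_complex_of_real)
  then show ?thesis by (simp only: sums_of_real_iff)
qed

lemma circle_Cauchy:
  assumes F: "F holomorphic_on ball 0 R" and R: "R > 1" and z: "cmod z < 1"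
  shows "(LINT s|circ. F (cis s) * (1 / (1 - z * cis (- s)))) = F z"
proof (rule sums_unique2)
  let ?g = "\<lambda>s. 1 / (1 - cnj z * cis s)"
  have g: "(\<lambda>n. cnj z ^ n * cis (real n * s)) sums ?g s" for s
    using geometric_sums[of "cnj z * cis s"] z unfolding power_mult_distrib Complex.DeMoivre by (simp add: norm_mult)
  have ne: "1 - cnj z * cis s \<noteq> 0" for s
    using z by (metis complex_mod_cnj eq_iff_diff_eq_0 less_irrefl mult.right_neutral norm_cis norm_mult norm_one)
  have gm: "?g \<in> borel_measurable borel"
    by (intro borel_measurable_continuous_onI continuous_intros) (use ne in auto)
  have "(\<lambda>n. tc F n * cnj (cnj z ^ n)) sums (LINT s|circ. F (cis s) * cnj (?g s))"
    by (intro circ_pairing holomorphic_circle[OF F R] taylor_sums_larger(1)[OF F R] g gm)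
       (use z in \<open>simp add: norm_power\<close>)
  then show "(\<lambda>n. tc F n * z ^ n) sums (LINT s|circ. F (cis s) * (1 / (1 - z * cis (- s))))"
    by (simp add: cis_cnj)
  show "(\<lambda>n. tc F n * z ^ n) sums F z"
    using taylor_sums_larger(2)[OF F R, of z] z R by simp
qed

section \<open>The Poisson kernel\<close>

definition pois :: "real \<Rightarrow> real \<Rightarrow> real" where
  "pois r x = (1 - r\<^sup>2) / (1 - 2 * r * cos x + r\<^sup>2)"

lemma norm_one_minus_cis: "(cmod (1 - of_real r * cis x))\<^sup>2 = 1 - 2 * r * cos x + r\<^sup>2"
proof -
  have "(cmod (1 - of_real r * cis x))\<^sup>2 = (1 - r * cos x)\<^sup>2 + (r * sin x)\<^sup>2"
    by (simp add: cmod_power2)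
  also have "\<dots> = 1 - 2 * r * cos x + r\<^sup>2 * ((sin x)\<^sup>2 + (cos x)\<^sup>2)"
    by (simp only: power2_eq_square algebra_simps mult_1 mult_1_right)
  finally show ?thesis by simp
qed

lemma pois_alt: "pois r x = (1 - r\<^sup>2) / (cmod (1 - of_real r * cis x))\<^sup>2"
  by (simp add: pois_def norm_one_minus_cis)

lemma norm_one_minus_cis_ge:
  assumes "0 \<le> r" "r < 1" shows "1 - r \<le> cmod (1 - of_real r * cis x)"
  using norm_triangle_ineq2[of 1 "of_real r * cis x"] assms by (simp add: norm_mult)

lemma pois_minus: "pois r (- x) = pois r x"
  by (simp add: pois_def)

lemma pois_nonneg: "0 \<le> r \<Longrightarrow> r < 1 \<Longrightarrow> 0 \<le> pois r x"
  unfolding pois_alt by (intro divide_nonneg_nonneg) (auto simp: power_le_one)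

lemma pois_le: 
  assumes "0 \<le> r" "r \<le> r0" "r0 < 1" shows "pois r x \<le> 1 / (1 - r0)\<^sup>2"
  unfolding pois_alt
proof (rule frac_le)
  show "(1 - r0)\<^sup>2 \<le> (cmod (1 - of_real r * cis x))\<^sup>2"
    using norm_one_minus_cis_ge[of r x] assms by (intro power_mono) auto
qed (use assms in auto)

text \<open>The distance of \<open>r cis x\<close> from 1 is at most twice that of \<open>r s cis x\<close>, as these two
  points are \<open>r - r s\<close> apart and the latter is at least \<open>1 - r s\<close> away from 1. This costs a factor 4 in the denominators,
  and the numerators contribute a factor 2, as \<open>1 - r\<^sup>2 s\<^sup>2 \<le> 1 - r\<^sup>4\<close>.\<close>

lemma pois_compare:
  assumes "0 \<le> r" "r \<le> s" "s < 1" shows "pois (r * s) x \<le> 8 * pois r x"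
proof -
  let ?D = "\<lambda>r. cmod (1 - of_real r * cis x)"
  have rs: "r * s \<le> r" "0 \<le> r * s" using assms by (auto intro: mult_left_le)
  have lt: "r < 1" using assms by simp
  have "?D r \<le> ?D (r * s) + cmod (of_real (r - r * s) * cis x)"
    using norm_triangle_ineq4[of "1 - of_real (r * s) * cis x" "of_real (r - r * s) * cis x"]
    by (simp add: algebra_simps)
  also have "cmod (of_real (r - r * s) * cis x) = r - r * s"
    using rs by (simp add: norm_mult del: of_real_diff)
  also have "r - r * s \<le> ?D (r * s)"
    using norm_one_minus_cis_ge[of "r * s" x] rs lt by linarith
  finally have D: "?D r \<le> 2 * ?D (r * s)" by simp
  have p1: "?D r > 0" and p2: "?D (r * s) > 0"
    using norm_one_minus_cis_ge[of r x] norm_one_minus_cis_ge[of "r * s" x] rs lt assms by (linarith+)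
  have "r\<^sup>2 * r\<^sup>2 \<le> r\<^sup>2 * s\<^sup>2" using assms by (intro mult_left_mono power_mono) auto
  then have "1 - (r * s)\<^sup>2 \<le> (1 - r\<^sup>2) * (1 + r\<^sup>2)" by (simp add: power_mult_distrib algebra_simps)
  also have "\<dots> \<le> (1 - r\<^sup>2) * 2"
    using assms lt by (intro mult_left_mono) (auto simp: power_le_one)
  finally have N: "1 - (r * s)\<^sup>2 \<le> 2 * (1 - r\<^sup>2)" by simp
  have "pois (r * s) x \<le> (2 * (1 - r\<^sup>2)) / (?D (r * s))\<^sup>2"
    unfolding pois_alt using N by (intro divide_right_mono) auto
  also have "\<dots> \<le> (2 * (1 - r\<^sup>2)) / (?D r / 2)\<^sup>2"
    using D p1 p2 assms lt by (intro divide_left_mono power_mono mult_pos_pos) (auto simp: power_le_one)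
  also have "\<dots> = 8 * pois r x" by (simp add: pois_alt power_divide)
  finally show ?thesis .
qed

lemma pois_mult_le:
  assumes "0 \<le> r" "r < 1" "0 \<le> s" "s < 1"
  shows "pois (r * s) x \<le> 8 * (pois r x + pois s x)"
proof (cases "r \<le> s")
  case True
  with pois_compare[of r s x] pois_nonneg[of s x] assms show ?thesis by simp
next
  case False
  with pois_compare[of s r x] pois_nonneg[of r x] assms show ?thesis by (simp add: mult.commute)
qed

lemma pois_measurable [measurable]:
  assumes [measurable]: "f \<in> borel_measurable M" "g \<in> borel_measurable M"
  shows "(\<lambda>x. pois (f x) (g x)) \<in> borel_measurable M"
proof -
  have [measurable]: "(\<lambda>x. cos (g x)) \<in> borel_measurable M"
    using borel_measurable_continuous_onI[of "cos :: real \<Rightarrow> real"] by (intro measurable_compose[OF assms(2)]) (auto intro!: continuous_intros)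
  show ?thesis unfolding pois_def by measurable
qed

text \<open>Cauchy's formula at \<open>z = r cis t\<close>, applied to \<open>u \<mapsto> F u * (1 - r\<^sup>2) / (1 - cnj z * u)\<close> instead of \<open>F\<close>.
  This function agrees with \<open>F\<close> at \<open>z\<close>, and the additional factor turns the Cauchy kernel into the
  Poisson kernel on the circle.\<close>

lemma Poisson_formula:
  assumes F: "F holomorphic_on ball 0 R" and R: "R > 1" and r: "0 \<le> r" "r < 1"
  shows "(LINT s|circ. of_real (pois r (t - s)) * F (cis s)) = F (of_real r * cis t)"
proof -
  define z where "z = of_real r * cis t"
  have z: "cmod z = r" using r by (simp add: z_def norm_mult)
  define G where "G u = F u * (of_real (1 - r\<^sup>2) / (1 - cnj z * u))" for u
  \<comment> \<open>\<open>G\<close> has a pole at \<open>1 / cnj z\<close>, of modulus \<open>1 / r\<close>.\<close>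
  obtain R' where R': "1 < R'" "R' < R" "r * R' < 1"
  proof (cases "r = 0")
    case True
    then show ?thesis using dense[OF R] that by auto
  next
    case False
    then have "1 < min R (1 / r)" using r R by simp
    then obtain R' where "1 < R'" "R' < min R (1 / r)" using dense by blast
    then show ?thesis using r False by (intro that[of R']) (auto simp: field_simps)
  qed
  have ne: "1 - cnj z * u \<noteq> 0" if "cmod u < R'" for u
  proof
    assume "1 - cnj z * u = 0"
    then have "cmod (cnj z * u) = 1" by (metis eq_iff_diff_eq_0 norm_one)
    then have "r * cmod u = 1" by (simp add: norm_mult z)
    moreover have "r * cmod u \<le> r * R'" using that r by (intro mult_left_mono) auto
    ultimately show False using R' by simp
  qed
  have "G holomorphic_on ball 0 R'"
    unfolding G_def using R' ne by (intro holomorphic_intros holomorphic_on_subset[OF F]) auto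
  from circle_Cauchy[OF this R'(1), of z] have "(LINT s|circ. G (cis s) * (1 / (1 - z * cis (- s)))) = G z"
    using z r by simp
  moreover have "G z = F z"
  proof -
    have "cnj z * z = of_real (r\<^sup>2)" using complex_norm_square[of z] by (simp add: z mult.commute)
    moreover have "(1::real) - r\<^sup>2 \<noteq> 0" using r by (simp add: power2_eq_1_iff)
    then have "of_real (1 - r\<^sup>2) \<noteq> (0::complex)" by (simp only: of_real_eq_0_iff not_False_eq_True)
    ultimately show ?thesis by (simp add: G_def)
  qed
  moreover have "G (cis s) * (1 / (1 - z * cis (- s))) = of_real (pois r (t - s)) * F (cis s)" for s
  proof -
    have e: "1 - z * cis (- s) = 1 - of_real r * cis (t - s)"
      by (simp add: z_def cis_mult mult.assoc)
    have e': "1 - cnj z * cis s = cnj (1 - z * cis (- s))" by (simp add: cis_cnj)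
    have "(1 - cnj z * cis s) * (1 - z * cis (- s)) = of_real ((cmod (1 - of_real r * cis (t - s)))\<^sup>2)"
      unfolding e' complex_norm_square e[symmetric] by (simp add: mult.commute)
    then show ?thesis
      unfolding G_def pois_alt by (simp add: mult_ac)
  qed
  ultimately show ?thesis by (simp add: z_def)
qed

section \<open>The maximal inequality\<close>

text \<open>The Poisson integral of \<open>g\<close> with a radius depending on the angle. A bound that is uniform in \<open>\<rho>\<close>
  is a bound for the radial maximal function.\<close>

definition pois_avg :: "(real \<Rightarrow> real) \<Rightarrow> (real \<Rightarrow> ennreal) \<Rightarrow> real \<Rightarrow> ennreal" where
  "pois_avg \<rho> g t = (\<integral>\<^sup>+s. ennreal (pois (\<rho> t) (t - s)) * g s \<partial>circ)"

lemma pois_avg_measurable [measurable]: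
  assumes [measurable]: "\<rho> \<in> borel_measurable borel" "g \<in> borel_measurable borel"
  shows "pois_avg \<rho> g \<in> borel_measurable borel"
  unfolding pois_avg_def by measurable

text \<open>The function \<open>s \<mapsto> pois q (t' - s)\<close> is the real part of \<open>(1 + w) / (1 - w)\<close> at \<open>w = q cis (s - t')\<close>,
  so Poisson's formula can be applied to it.\<close>

lemma pois_semigroup:
  assumes r: "0 \<le> r" "r < 1" and q: "0 \<le> q" "q < 1"
  shows "(\<integral>\<^sup>+s. ennreal (pois r (t - s)) * ennreal (pois q (t' - s)) \<partial>circ) = ennreal (pois (r * q) (t - t'))"
proof -
  define F where "F z = (1 + of_real q * cis (- t') * z) / (1 - of_real q * cis (- t') * z)" for z
  \<comment> \<open>The pole of \<open>F\<close>, if there is one, has modulus \<open>1 / q\<close>.\<close>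
  define R where "R = (if q = 0 then 2 else 1 / q)"
  have R: "R > 1" using q by (simp add: R_def)
  have ne: "1 - of_real q * cis (- t') * z \<noteq> 0" if "cmod z < R" for z
  proof
    assume "1 - of_real q * cis (- t') * z = 0"
    then have "cmod (of_real q * cis (- t') * z) = 1" by (metis eq_iff_diff_eq_0 norm_one)
    then have "q * cmod z = 1" using q by (simp add: norm_mult)
    then show False using that q by (auto simp: R_def field_simps split: if_splits)
  qed
  have hol: "F holomorphic_on ball 0 R"
    unfolding F_def using ne by (intro holomorphic_intros) auto
  have ReF: "Re (F (of_real a * cis x)) = pois (a * q) (x - t')" if "0 \<le> a" "a \<le> 1" for a x
  proof -
    define w where "w = of_real (a * q) * cis (x - t')"
    have w: "of_real q * cis (- t') * (of_real a * cis x) = w"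
      by (simp add: w_def cis_mult mult_ac)
    have F: "F (of_real a * cis x) = (1 + w) / (1 - w)"
      unfolding F_def w ..
    have nw: "cmod w = a * q" using that q by (simp add: w_def norm_mult)
    have "Re ((1 + w) / (1 - w)) = (1 - (cmod w)\<^sup>2) / (cmod (1 - w))\<^sup>2"
      unfolding Re_divide cmod_power2 by (simp add: power2_eq_square algebra_simps)
    then show ?thesis unfolding F nw pois_alt by (simp add: w_def)
  qed
  have "(LINT s|circ. of_real (pois r (t - s)) * F (cis s)) = F (of_real r * cis t)"
    by (rule Poisson_formula[OF hol R r])
  moreover obtain B where B: "\<And>s. cmod (F (cis s)) \<le> B" using circle_bounded[OF hol R] by blast
  have int: "integrable circ (\<lambda>s. of_real (pois r (t - s)) * F (cis s))"
  proof (rule circ_integrable_bounded)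
    note [measurable] = holomorphic_circle(2)[OF hol R]
    show "(\<lambda>s. of_real (pois r (t - s)) * F (cis s)) \<in> borel_measurable borel" by measurable
    show "norm (of_real (pois r (t - s)) * F (cis s)) \<le> 1 / (1 - r)\<^sup>2 * B" for s
      using pois_le[of r r "t - s"] pois_nonneg[of r "t - s"] r B[of s]
      by (simp add: norm_mult del: times_divide_eq_left divide_simps) (intro mult_mono, auto)
  qed
  ultimately have "(LINT s|circ. Re (of_real (pois r (t - s)) * F (cis s))) = Re (F (of_real r * cis t))"
    by (subst integral_Re[OF int]) simp
  moreover have "Re (of_real (pois r (t - s)) * F (cis s)) = pois r (t - s) * pois q (t' - s)" for s
    using ReF[of 1 s] pois_minus[of q "t' - s"] by simp
  moreover have "Re (F (of_real r * cis t)) = pois (r * q) (t - t')" using ReF[of r t] r by simp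
  ultimately have eq: "(LINT s|circ. pois r (t - s) * pois q (t' - s)) = pois (r * q) (t - t')"
    by (simp only:)
  have "(\<integral>\<^sup>+s. ennreal (pois r (t - s)) * ennreal (pois q (t' - s)) \<partial>circ) =
      (\<integral>\<^sup>+s. ennreal (pois r (t - s) * pois q (t' - s)) \<partial>circ)"
    by (simp add: ennreal_mult pois_nonneg r q)
  also have "\<dots> = ennreal (LINT s|circ. pois r (t - s) * pois q (t' - s))"
  proof (rule nn_integral_eq_integral)
    show "integrable circ (\<lambda>s. pois r (t - s) * pois q (t' - s))"
    proof (rule circ_integrable_bounded)
      show "norm (pois r (t - s) * pois q (t' - s)) \<le> 1 / (1 - r)\<^sup>2 * (1 / (1 - q)\<^sup>2)" for s
        using pois_le[of r r "t - s"] pois_nonneg[of r "t - s"] pois_le[of q q "t' - s"] pois_nonneg[of q "t' - s"] r q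
        unfolding real_norm_def abs_mult by (intro mult_mono) auto
    qed measurable
  qed (auto intro!: AE_I2 mult_nonneg_nonneg pois_nonneg r q)
  finally show ?thesis unfolding eq .
qed

text \<open>On the left is the square norm of \<open>T* G\<close>, where \<open>T = pois_avg \<rho>\<close>. Expanding the square and
  integrating over \<open>s\<close> first leaves the kernel \<open>pois (\<rho> t * \<rho> t') (t - t')\<close> of \<open>T T*\<close>, which
  \<open>pois_mult_le\<close> bounds by the kernels of \<open>T\<close> and \<open>T*\<close>; both contribute the same integral.\<close>

lemma pois_avg_TT_star:
  assumes \<rho> [measurable]: "\<rho> \<in> borel_measurable borel" and b: "\<And>t. 0 \<le> \<rho> t" "\<And>t. \<rho> t < 1"
    and G [measurable]: "G \<in> borel_measurable borel"
  shows "(\<integral>\<^sup>+s. (\<integral>\<^sup>+t. G t * ennreal (pois (\<rho> t) (t - s)) \<partial>circ)\<^sup>2 \<partial>circ) \<le>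
    16 * (\<integral>\<^sup>+t. G t * pois_avg \<rho> G t \<partial>circ)"
proof -
  let ?K = "\<lambda>t s. ennreal (pois (\<rho> t) (t - s))"
  have "(\<integral>\<^sup>+s. (\<integral>\<^sup>+t. G t * ?K t s \<partial>circ)\<^sup>2 \<partial>circ) =
    (\<integral>\<^sup>+s. (\<integral>\<^sup>+t. (\<integral>\<^sup>+t'. G t * G t' * (?K t s * ?K t' s) \<partial>circ) \<partial>circ) \<partial>circ)"
    unfolding power2_eq_square
    by (intro nn_integral_cong) (simp add: nn_integral_multc[symmetric] nn_integral_cmult[symmetric] mult_ac)
  also have "\<dots> = (\<integral>\<^sup>+t. (\<integral>\<^sup>+s. (\<integral>\<^sup>+t'. G t * G t' * (?K t s * ?K t' s) \<partial>circ) \<partial>circ) \<partial>circ)"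
    by (rule circ2.Fubini') measurable
  also have "\<dots> = (\<integral>\<^sup>+t. (\<integral>\<^sup>+t'. (\<integral>\<^sup>+s. G t * G t' * (?K t s * ?K t' s) \<partial>circ) \<partial>circ) \<partial>circ)"
    by (intro nn_integral_cong circ2.Fubini') measurable
  also have "\<dots> = (\<integral>\<^sup>+t. (\<integral>\<^sup>+t'. G t * G t' * ennreal (pois (\<rho> t * \<rho> t') (t - t')) \<partial>circ) \<partial>circ)"
    by (intro nn_integral_cong) (simp add: nn_integral_cmult pois_semigroup b)
  also have "\<dots> \<le> (\<integral>\<^sup>+t. (\<integral>\<^sup>+t'. 8 * (G t * (?K t t' * G t')) + 8 * (G t' * (?K t' t * G t)) \<partial>circ) \<partial>circ)"
  proof (intro nn_integral_mono)
    fix t t'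
    have "ennreal (pois (\<rho> t * \<rho> t') (t - t')) \<le> ennreal (8 * (pois (\<rho> t) (t - t') + pois (\<rho> t') (t' - t)))"
      using pois_mult_le[of "\<rho> t" "\<rho> t'" "t - t'"] pois_minus[of "\<rho> t'" "t - t'"] b by (intro ennreal_leI) simp
    also have "\<dots> = 8 * (?K t t' + ?K t' t)"
      by (simp add: ennreal_mult ennreal_plus pois_nonneg b)
    finally have "G t * G t' * ennreal (pois (\<rho> t * \<rho> t') (t - t')) \<le> G t * G t' * (8 * (?K t t' + ?K t' t))"
      by (rule mult_left_mono) simp
    then show "G t * G t' * ennreal (pois (\<rho> t * \<rho> t') (t - t')) \<le> 8 * (G t * (?K t t' * G t')) + 8 * (G t' * (?K t' t * G t))"
      by (simp add: algebra_simps)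
  qed
  also have "\<dots> = (\<integral>\<^sup>+t. (\<integral>\<^sup>+t'. 8 * (G t * (?K t t' * G t')) \<partial>circ) \<partial>circ) +
    (\<integral>\<^sup>+t. (\<integral>\<^sup>+t'. 8 * (G t' * (?K t' t * G t)) \<partial>circ) \<partial>circ)"
    by (subst nn_integral_add[symmetric]) (auto intro!: nn_integral_cong nn_integral_add)
  also have "(\<integral>\<^sup>+t. (\<integral>\<^sup>+t'. 8 * (G t' * (?K t' t * G t)) \<partial>circ) \<partial>circ) =
    (\<integral>\<^sup>+t'. (\<integral>\<^sup>+t. 8 * (G t' * (?K t' t * G t)) \<partial>circ) \<partial>circ)"
    by (rule circ2.Fubini') measurable
  also have "(\<integral>\<^sup>+t. (\<integral>\<^sup>+t'. 8 * (G t * (?K t t' * G t')) \<partial>circ) \<partial>circ) = 8 * (\<integral>\<^sup>+t. G t * pois_avg \<rho> G t \<partial>circ)"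
    unfolding pois_avg_def by (simp add: nn_integral_cmult)
  also have "8 * (\<integral>\<^sup>+t. G t * pois_avg \<rho> G t \<partial>circ) + 8 * (\<integral>\<^sup>+t. G t * pois_avg \<rho> G t \<partial>circ) =
      (8 + 8) * (\<integral>\<^sup>+t. G t * pois_avg \<rho> G t \<partial>circ)"
    by (rule distrib_right[symmetric])
  finally show ?thesis by simp
qed

text \<open>\<open>B\<close> bounds the square of the norm of \<open>pois_avg \<rho>\<close> on \<open>L\<^sup>2\<close>.\<close>

definition avg_bound :: "(real \<Rightarrow> real) \<Rightarrow> real \<Rightarrow> bool" where
  "avg_bound \<rho> B \<longleftrightarrow> B \<ge> 0 \<and> (\<forall>g\<in>borel_measurable borel.
     (\<integral>\<^sup>+t. (pois_avg \<rho> g t)\<^sup>2 \<partial>circ) \<le> ennreal B * (\<integral>\<^sup>+t. (g t)\<^sup>2 \<partial>circ))"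

text \<open>This bound depends on how close \<open>\<rho>\<close> comes to 1. It only guarantees that there is some finite
  bound, which can then be improved.\<close>

lemma avg_bound_crude:
  assumes \<rho> [measurable]: "\<rho> \<in> borel_measurable borel" and b: "\<And>t. 0 \<le> \<rho> t" "\<And>t. \<rho> t \<le> r0" and r0: "r0 < 1"
  shows "avg_bound \<rho> ((1 / (1 - r0)\<^sup>2)\<^sup>2)"
  unfolding avg_bound_def
proof (intro conjI ballI)
  fix g :: "real \<Rightarrow> ennreal" assume [measurable]: "g \<in> borel_measurable borel"
  define k where "k = 1 / (1 - r0)\<^sup>2"
  have "pois_avg \<rho> g t \<le> ennreal k * (\<integral>\<^sup>+s. g s \<partial>circ)" for t
  proof -
    have "pois_avg \<rho> g t \<le> (\<integral>\<^sup>+s. ennreal k * g s \<partial>circ)"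
      unfolding pois_avg_def k_def
      by (intro nn_integral_mono mult_right_mono ennreal_leI pois_le b r0) simp
    then show ?thesis by (simp add: nn_integral_cmult)
  qed
  then have "(\<integral>\<^sup>+t. (pois_avg \<rho> g t)\<^sup>2 \<partial>circ) \<le> (\<integral>\<^sup>+t. (ennreal k * (\<integral>\<^sup>+s. g s \<partial>circ))\<^sup>2 \<partial>circ)"
    by (intro nn_integral_mono power_mono) auto
  also have "\<dots> = ennreal (k\<^sup>2) * (\<integral>\<^sup>+s. g s \<partial>circ)\<^sup>2"
    by (simp add: power_mult_distrib ennreal_power k_def)
  also have "(\<integral>\<^sup>+s. g s \<partial>circ)\<^sup>2 \<le> (\<integral>\<^sup>+t. (g t)\<^sup>2 \<partial>circ)"
    using Cauchy_Schwarz_nn_integral[of g circ "\<lambda>_. 1"] by simp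
  finally show "(\<integral>\<^sup>+t. (pois_avg \<rho> g t)\<^sup>2 \<partial>circ) \<le> ennreal ((1 / (1 - r0)\<^sup>2)\<^sup>2) * (\<integral>\<^sup>+t. (g t)\<^sup>2 \<partial>circ)"
    by (simp add: k_def mult_left_mono)
qed simp

text \<open>With \<open>T = pois_avg \<rho>\<close>, the Cauchy-Schwarz inequality and \<open>pois_avg_TT_star\<close> bound \<open>\<parallel>T g\<parallel>\<^sup>4\<close> by
  \<open>\<parallel>g\<parallel>\<^sup>2 \<parallel>T* T g\<parallel>\<^sup>2 \<le> 16 \<parallel>g\<parallel>\<^sup>2 \<parallel>T g\<parallel> \<parallel>T T g\<parallel>\<close>. By assumption the last factor is at most \<open>sqrt B\<close> times
  \<open>\<parallel>T g\<parallel>\<close>, so that \<open>\<parallel>T g\<parallel>\<^sup>2\<close> cancels.\<close>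

lemma avg_bound_improve:
  assumes \<rho> [measurable]: "\<rho> \<in> borel_measurable borel" and b: "\<And>t. 0 \<le> \<rho> t" "\<And>t. \<rho> t < 1"
    and B: "avg_bound \<rho> B"
  shows "avg_bound \<rho> (16 * sqrt B)"
  unfolding avg_bound_def
proof (intro conjI ballI)
  have B0: "B \<ge> 0" using B by (simp add: avg_bound_def)
  then show "0 \<le> 16 * sqrt B" by simp
  fix g :: "real \<Rightarrow> ennreal" assume g [measurable]: "g \<in> borel_measurable borel"
  define a where "a = (\<integral>\<^sup>+t. (pois_avg \<rho> g t)\<^sup>2 \<partial>circ)"
  define c where "c = (\<integral>\<^sup>+t. (g t)\<^sup>2 \<partial>circ)"
  define h where "h s = (\<integral>\<^sup>+t. pois_avg \<rho> g t * ennreal (pois (\<rho> t) (t - s)) \<partial>circ)" for s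
  have hm [measurable]: "h \<in> borel_measurable borel" unfolding h_def by measurable
  have ac: "a \<le> ennreal B * c" using B g unfolding avg_bound_def a_def c_def by blast
  have "a = (\<integral>\<^sup>+t. (\<integral>\<^sup>+s. pois_avg \<rho> g t * (ennreal (pois (\<rho> t) (t - s)) * g s) \<partial>circ) \<partial>circ)"
    unfolding a_def power2_eq_square
    by (intro nn_integral_cong) (simp add: nn_integral_cmult pois_avg_def[of \<rho> g, symmetric])
  also have "\<dots> = (\<integral>\<^sup>+s. (\<integral>\<^sup>+t. pois_avg \<rho> g t * (ennreal (pois (\<rho> t) (t - s)) * g s) \<partial>circ) \<partial>circ)"
    by (rule circ2.Fubini') measurable
  also have "\<dots> = (\<integral>\<^sup>+s. h s * g s \<partial>circ)"
    unfolding h_def by (intro nn_integral_cong) (simp add: nn_integral_multc mult.assoc[symmetric])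
  finally have "a\<^sup>2 \<le> (\<integral>\<^sup>+s. (h s)\<^sup>2 \<partial>circ) * c"
    using Cauchy_Schwarz_nn_integral[of h circ g] by (simp add: c_def)
  also have "(\<integral>\<^sup>+s. (h s)\<^sup>2 \<partial>circ) \<le> 16 * (\<integral>\<^sup>+t. pois_avg \<rho> g t * pois_avg \<rho> (pois_avg \<rho> g) t \<partial>circ)"
    unfolding h_def by (rule pois_avg_TT_star[OF \<rho> b]) measurable
  finally have a2: "a\<^sup>2 \<le> 16 * (\<integral>\<^sup>+t. pois_avg \<rho> g t * pois_avg \<rho> (pois_avg \<rho> g) t \<partial>circ) * c"
    by (simp add: mult_right_mono)
  define e where "e = (\<integral>\<^sup>+t. pois_avg \<rho> g t * pois_avg \<rho> (pois_avg \<rho> g) t \<partial>circ)"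
  have "e\<^sup>2 \<le> a * (\<integral>\<^sup>+t. (pois_avg \<rho> (pois_avg \<rho> g) t)\<^sup>2 \<partial>circ)"
    unfolding e_def a_def by (rule Cauchy_Schwarz_nn_integral) measurable
  also have "(\<integral>\<^sup>+t. (pois_avg \<rho> (pois_avg \<rho> g) t)\<^sup>2 \<partial>circ) \<le> ennreal B * a"
    using B pois_avg_measurable[OF \<rho> g] unfolding avg_bound_def a_def by blast
  finally have e2: "e\<^sup>2 \<le> a * (ennreal B * a)" by (simp add: mult_left_mono)
  \<comment> \<open>Outside the degenerate cases all quantities are finite, and \<open>a\<close> can be cancelled.\<close>
  show "(\<integral>\<^sup>+t. (pois_avg \<rho> g t)\<^sup>2 \<partial>circ) \<le> ennreal (16 * sqrt B) * (\<integral>\<^sup>+t. (g t)\<^sup>2 \<partial>circ)"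
  proof (cases "c = \<infinity> \<or> a = 0")
    case True
    have "a = 0" if "B = 0" using that ac by simp
    with True show ?thesis using B0 unfolding a_def[symmetric] c_def[symmetric]
      by (cases "B = 0") (auto simp: ennreal_mult_top)
  next
    case False
    then obtain c' where c': "c = ennreal c'" "c' \<ge> 0" by (cases c) auto
    have "a \<noteq> \<infinity>" using ac c' B0 by (auto simp: top_unique simp flip: ennreal_mult)
    then obtain a' where a': "a = ennreal a'" "a' > 0" using False by (cases a) auto
    have "e\<^sup>2 \<noteq> \<infinity>" using e2 a' B0 by (auto simp: top_unique simp flip: ennreal_mult)
    then obtain e' where e': "e = ennreal e'" "e' \<ge> 0" by (cases e) auto
    have 1: "a'\<^sup>2 \<le> 16 * e' * c'"
    proof -
      have "ennreal (a'\<^sup>2) \<le> ennreal (16 * e' * c')"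
        using a2 a' e' c' unfolding e_def[symmetric] by (simp add: ennreal_mult ennreal_power)
      then show ?thesis using e' c' by (subst (asm) ennreal_le_iff) auto
    qed
    have 2: "e'\<^sup>2 \<le> a' * (B * a')"
    proof -
      have "ennreal (e'\<^sup>2) \<le> ennreal (a' * (B * a'))"
        using e2 a' e' B0 by (simp add: ennreal_mult ennreal_power)
      then show ?thesis using a' B0 by (subst (asm) ennreal_le_iff) auto
    qed
    have "e' \<le> sqrt B * a'"
    proof (rule power2_le_imp_le)
      show "e'\<^sup>2 \<le> (sqrt B * a')\<^sup>2" using 2 B0 by (simp add: power2_eq_square mult_ac)
    qed (use a' B0 in auto)
    then have "16 * e' * c' \<le> 16 * (sqrt B * a') * c'" using c' by (intro mult_right_mono) auto
    with 1 have "a' * a' \<le> a' * (16 * sqrt B * c')" by (simp add: power2_eq_square mult_ac)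
    then have "a' \<le> 16 * sqrt B * c'" using a' by simp
    then have "ennreal a' \<le> ennreal (16 * sqrt B * c')" by (rule ennreal_leI)
    then show ?thesis
      unfolding a_def[symmetric] c_def[symmetric] a'(1) c'(1) using c' B0 by (simp add: ennreal_mult)
  qed
qed

text \<open>The least bound \<open>I\<close> satisfies \<open>I \<le> 16 * sqrt I\<close>.\<close>

lemma avg_bound_256:
  assumes \<rho> [measurable]: "\<rho> \<in> borel_measurable borel" and b: "\<And>t. 0 \<le> \<rho> t" "\<And>t. \<rho> t \<le> r0" and r0: "r0 < 1"
  shows "avg_bound \<rho> 256"
proof -
  define S where "S = {B. avg_bound \<rho> B}"
  have ne: "S \<noteq> {}" using avg_bound_crude[OF assms] by (auto simp: S_def)
  have bd: "bdd_below S" by (rule bdd_belowI[of _ 0]) (simp add: S_def avg_bound_def)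
  define I where "I = Inf S"
  have I0: "I \<ge> 0" unfolding I_def by (rule cInf_greatest[OF ne]) (simp add: S_def avg_bound_def)
  have Ile: "I\<^sup>2 / 256 \<le> B" if "B \<in> S" for B
  proof -
    have "16 * sqrt B \<in> S" using that avg_bound_improve[OF \<rho> b(1) _ ] b r0 by (auto simp: S_def intro: le_less_trans)
    then have "I \<le> 16 * sqrt B" unfolding I_def by (rule cInf_lower[OF _ bd])
    then have "I\<^sup>2 \<le> (16 * sqrt B)\<^sup>2" using I0 by (rule power_mono)
    moreover have "B \<ge> 0" using that by (simp add: S_def avg_bound_def)
    ultimately show ?thesis by (simp add: power_mult_distrib)
  qed
  have "I\<^sup>2 / 256 \<le> I" unfolding I_def by (rule cInf_greatest[OF ne]) (use Ile in \<open>simp add: I_def\<close>)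
  then have "I \<le> 256" using I0 by (cases "I = 0") (auto simp: power2_eq_square)
  show ?thesis
    unfolding avg_bound_def
  proof (intro conjI ballI)
    fix g :: "real \<Rightarrow> ennreal" assume g: "g \<in> borel_measurable borel"
    let ?a = "\<integral>\<^sup>+t. (pois_avg \<rho> g t)\<^sup>2 \<partial>circ" and ?c = "\<integral>\<^sup>+t. (g t)\<^sup>2 \<partial>circ"
    have le: "?a \<le> ennreal B * ?c" if "B \<in> S" for B using that g by (auto simp: S_def avg_bound_def)
    show "?a \<le> ennreal 256 * ?c"
    proof (cases "?c = \<infinity>")
      case False
      then obtain c where c: "?c = ennreal c" "c \<ge> 0" by (cases ?c) auto
      \<comment> \<open>The infimum of the bounds is a bound; the excess \<open>e / (c + 1)\<close> costs at most \<open>e\<close> after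
        multiplication by \<open>c\<close>.\<close>
      have "?a \<le> ennreal (256 * c)"
      proof (rule ennreal_le_epsilon)
        fix e :: real assume that: "e > 0"
        have "I < 256 + e / (c + 1)" using \<open>I \<le> 256\<close> that c by (smt (verit) divide_pos_pos)
        then obtain B where "B \<in> S" "B < 256 + e / (c + 1)" using cInf_lessD[OF ne] unfolding I_def by blast
        then have "?a \<le> ennreal B * ennreal c" "B \<le> 256 + e / (c + 1)" using le c by auto
        note this(1)
        also have "ennreal B * ennreal c \<le> ennreal (256 + e / (c + 1)) * ennreal c"
          using \<open>B \<le> 256 + e / (c + 1)\<close> by (intro mult_right_mono ennreal_leI) auto
        also have "\<dots> = ennreal (256 * c + e * (c / (c + 1)))"
        proof -
          have "ennreal (256 + e / (c + 1)) * ennreal c = ennreal ((256 + e / (c + 1)) * c)"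
            using c that by (intro ennreal_mult[symmetric]) auto
          also have "(256 + e / (c + 1)) * c = 256 * c + e * (c / (c + 1))" by (simp add: algebra_simps)
          finally show ?thesis .
        qed
        also have "\<dots> \<le> ennreal (256 * c + e)"
          using c that by (intro ennreal_leI add_left_mono mult_left_le) auto
        finally show "?a \<le> ennreal (256 * c) + ennreal e"
          unfolding ennreal_plus[OF mult_nonneg_nonneg[OF zero_le_numeral c(2)] less_imp_le[OF that]] .
      qed
      then show ?thesis using c by (metis ennreal_mult zero_le_numeral)
    qed (simp add: ennreal_mult_top)
  qed simp
qed

section \<open>Fatou's theorem on radial limits\<close>

lemma dilation:
  assumes f: "f holomorphic_on unit_disc" and R: "0 < R" "R < 1"
  shows "(\<lambda>z. f (of_real R * z)) holomorphic_on ball 0 (1 / R)" "1 / R > 1"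
    and "tc (\<lambda>z. f (of_real R * z)) n = tc f n * of_real R ^ n"
proof -
  show "(\<lambda>z. f (of_real R * z)) holomorphic_on ball 0 (1 / R)"
    by (rule holomorphic_on_compose_gen[OF _ f, unfolded o_def])
       (use R in \<open>auto intro!: holomorphic_intros simp: norm_mult field_simps\<close>)
  show "1 / R > 1" using R by simp
  show "tc (\<lambda>z. f (of_real R * z)) n = tc f n * of_real R ^ n"
  proof (rule taylor_coeff_unique)
    fix z :: complex assume "cmod z < 1"
    moreover have "R * cmod z \<le> 1 * cmod z" using R by (intro mult_right_mono) auto
    ultimately have "cmod (of_real R * z) < 1" using R by (simp add: norm_mult)
    from taylor_sums[OF f this] show "(\<lambda>n. tc f n * of_real R ^ n * z ^ n) sums f (of_real R * z)"
      by (simp add: power_mult_distrib mult.assoc)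
  qed
qed

lemma dilated_Parseval:
  assumes f: "f holomorphic_on unit_disc" and R: "0 < R" "R < 1"
  shows "(\<lambda>n. (cmod (tc f n))\<^sup>2 * (R\<^sup>2) ^ n) sums (LINT s|circ. (cmod (f (of_real R * cis s)))\<^sup>2)"
proof -
  have "(R ^ n)\<^sup>2 = (R\<^sup>2) ^ n" for n
    by (simp add: power_mult[symmetric] mult.commute)
  then have "(cmod (tc (\<lambda>z. f (of_real R * z)) n))\<^sup>2 = (cmod (tc f n))\<^sup>2 * (R\<^sup>2) ^ n" for n
    using R by (simp add: dilation(3)[OF assms] norm_mult norm_power power_mult_distrib)
  then show ?thesis using circle_Parseval[OF dilation(1,2)[OF assms]] by simp
qed

lemma dilated_norm_le:
  assumes f: "f \<in> H2" and R: "0 < R" "R < 1"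
  shows "(LINT s|circ. (cmod (f (of_real R * cis s)))\<^sup>2) \<le> (h2_norm f)\<^sup>2"
  by (rule sums_le[OF _ dilated_Parseval[OF H2_holomorphic[OF f] R] h2_norm_sq_sums[OF f]])
     (use R in \<open>auto intro!: mult_left_le simp: power_le_one\<close>)

text \<open>The dilation \<open>F(z) = f(R z)\<close> with \<open>r0 < R < 1\<close> is holomorphic across the unit circle, so its
  modulus is dominated by the Poisson integral of its boundary modulus.\<close>

lemma linearized_maximal_inequality:
  assumes f: "f \<in> H2" and \<rho> [measurable]: "\<rho> \<in> borel_measurable borel"
    and b: "\<And>t. 0 \<le> \<rho> t" "\<And>t. \<rho> t \<le> r0" and r0: "r0 < 1"
  shows "(\<integral>\<^sup>+t. ennreal ((cmod (f (of_real (\<rho> t) * cis t)))\<^sup>2) \<partial>circ) \<le> 256 * ennreal ((h2_norm f)\<^sup>2)"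
proof -
  obtain R where R: "r0 < R" "R < 1" using dense[OF r0] by blast
  have R0: "0 < R" using b[of 0] R by linarith
  define F where "F z = f (of_real R * z)" for z
  note F = dilation(1,2)[OF H2_holomorphic[OF f] R0 R(2), folded F_def]
  note [measurable] = holomorphic_circle(2)[OF F]
  define \<rho>' where "\<rho>' t = \<rho> t / R" for t
  have [measurable]: "\<rho>' \<in> borel_measurable borel" unfolding \<rho>'_def by measurable
  have b': "0 \<le> \<rho>' t" "\<rho>' t \<le> r0 / R" for t using b R0 by (auto simp: \<rho>'_def divide_right_mono)
  have r0': "r0 / R < 1" using R R0 by simp
  have lt: "\<rho>' t < 1" for t using b'(2)[of t] r0' by linarith
  define g where "g s = ennreal (cmod (F (cis s)))" for s
  have [measurable]: "g \<in> borel_measurable borel" unfolding g_def by measurable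
  obtain B where B: "\<And>s. cmod (F (cis s)) \<le> B" using circle_bounded[OF F] by blast
  have "ennreal (cmod (f (of_real (\<rho> t) * cis t))) \<le> pois_avg \<rho>' g t" for t
  proof -
    have "f (of_real (\<rho> t) * cis t) = F (of_real (\<rho>' t) * cis t)"
      using R0 by (simp add: F_def \<rho>'_def)
    also have "\<dots> = (LINT s|circ. of_real (pois (\<rho>' t) (t - s)) * F (cis s))"
      using Poisson_formula[OF F, of "\<rho>' t" t] b'[of t] lt[of t] by simp
    finally have eq: "f (of_real (\<rho> t) * cis t) = (LINT s|circ. of_real (pois (\<rho>' t) (t - s)) * F (cis s))" .
    have "integrable circ (\<lambda>s. of_real (pois (\<rho>' t) (t - s)) * F (cis s))"
    proof (rule circ_integrable_bounded)
      show "norm (of_real (pois (\<rho>' t) (t - s)) * F (cis s)) \<le> 1 / (1 - r0 / R)\<^sup>2 * B" for s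
        unfolding norm_mult norm_of_real abs_of_nonneg[OF pois_nonneg[OF b'(1) lt]]
        by (intro mult_mono pois_le b' r0' B) auto
    qed measurable
    from integral_norm_bound_ennreal[OF this]
    have "ennreal (cmod (f (of_real (\<rho> t) * cis t))) \<le> (\<integral>\<^sup>+s. ennreal (cmod (of_real (pois (\<rho>' t) (t - s)) * F (cis s))) \<partial>circ)"
      unfolding eq .
    also have "\<dots> = pois_avg \<rho>' g t"
      unfolding pois_avg_def g_def norm_mult norm_of_real abs_of_nonneg[OF pois_nonneg[OF b'(1) lt]]
      by (simp add: ennreal_mult pois_nonneg b' lt)
    finally show ?thesis .
  qed
  then have "(\<integral>\<^sup>+t. ennreal ((cmod (f (of_real (\<rho> t) * cis t)))\<^sup>2) \<partial>circ) \<le> (\<integral>\<^sup>+t. (pois_avg \<rho>' g t)\<^sup>2 \<partial>circ)"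
    by (intro nn_integral_mono) (simp add: ennreal_power[symmetric] power_mono)
  also have "\<dots> \<le> ennreal 256 * (\<integral>\<^sup>+s. (g s)\<^sup>2 \<partial>circ)"
    using avg_bound_256[of \<rho>' "r0 / R"] b' r0' unfolding avg_bound_def by auto
  also have "(\<integral>\<^sup>+s. (g s)\<^sup>2 \<partial>circ) = (\<integral>\<^sup>+s. ennreal ((cmod (F (cis s)))\<^sup>2) \<partial>circ)"
    by (simp add: g_def ennreal_power)
  also have "\<dots> = ennreal (LINT s|circ. (cmod (F (cis s)))\<^sup>2)"
  proof (rule nn_integral_eq_integral)
    show "integrable circ (\<lambda>s. (cmod (F (cis s)))\<^sup>2)"
      by (rule circ_integrable_bounded[where B = "B\<^sup>2"]) (auto intro: power_mono B)
  qed simp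
  also have "\<dots> \<le> ennreal ((h2_norm f)\<^sup>2)"
    unfolding F_def by (intro ennreal_leI dilated_norm_le f R0 R)
  finally show ?thesis by (simp add: mult_left_mono)
qed

lemma H2_borel [measurable]:
  assumes "f \<in> H2" shows "f \<in> borel_measurable borel"
proof -
  have "(\<lambda>x. indicator unit_disc x *\<^sub>R f x) \<in> borel_measurable borel"
    by (rule borel_measurable_continuous_on_indicator)
       (auto intro: holomorphic_on_imp_continuous_on H2_holomorphic assms)
  moreover have "(\<lambda>x. indicator unit_disc x *\<^sub>R f x) = f"
    using H2_outside[OF assms] by (auto simp: fun_eq_iff indicator_def)
  ultimately show ?thesis by simp
qed

text \<open>An enumeration of the rational radii. By continuity they suffice for the radial maximal
  function, which is thereby a countable supremum.\<close>

definition radius :: "nat \<Rightarrow> real" where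
  "radius = from_nat_into (\<rat> \<inter> {0..<1})"

lemma radius: "0 \<le> radius n" "radius n < 1"
  and radius_ex: "x \<in> \<rat> \<Longrightarrow> 0 \<le> x \<Longrightarrow> x < 1 \<Longrightarrow> \<exists>n. x = radius n"
proof -
  have ne: "\<rat> \<inter> {0..<1::real} \<noteq> {}" by (auto intro!: exI[of _ 0])
  have cnt: "countable (\<rat> \<inter> {0..<1::real})" using countable_rat by (rule countable_Int1)
  show "0 \<le> radius n" "radius n < 1" using from_nat_into[OF ne, of n] by (auto simp: radius_def)
  show "\<exists>n. x = radius n" if "x \<in> \<rat>" "0 \<le> x" "x < 1"
    using from_nat_into_surj[OF cnt, of x] that by (auto simp: radius_def)
qed

text \<open>Among the first \<open>n + 1\<close> radii, one at which \<open>f\<close> is largest on the ray of angle \<open>t\<close>.\<close>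

primrec best_radius :: "(complex \<Rightarrow> complex) \<Rightarrow> nat \<Rightarrow> real \<Rightarrow> real" where
  "best_radius f 0 = (\<lambda>t. radius 0)"
| "best_radius f (Suc n) = (\<lambda>t. if cmod (f (of_real (best_radius f n t) * cis t)) < cmod (f (of_real (radius (Suc n)) * cis t))
      then radius (Suc n) else best_radius f n t)"

definition radial_max :: "(complex \<Rightarrow> complex) \<Rightarrow> real \<Rightarrow> ennreal" where
  "radial_max f t = (SUP n. ennreal ((cmod (f (of_real (best_radius f n t) * cis t)))\<^sup>2))"

lemma best_radius_measurable [measurable]:
  assumes [measurable]: "f \<in> H2" shows "best_radius f n \<in> borel_measurable borel"
  by (induction n) (simp_all, measurable)

lemma best_radius_bounds: "0 \<le> best_radius f n t" "best_radius f n t \<le> Max (radius ` {..n})"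
proof -
  show "0 \<le> best_radius f n t" by (induction n) (auto simp: radius)
  have "best_radius f n t \<in> radius ` {..n}"
  proof (induction n)
    case (Suc n)
    then show ?case by (auto simp: atMost_Suc)
  qed simp
  then show "best_radius f n t \<le> Max (radius ` {..n})" by (intro Max_ge) auto
qed

lemma best_radius_best: "cmod (f (of_real (radius n) * cis t)) \<le> cmod (f (of_real (best_radius f n t) * cis t))"
  by (cases n) auto

lemma radial_max_measurable [measurable]:
  assumes [measurable]: "f \<in> H2" shows "radial_max f \<in> borel_measurable borel"
  unfolding radial_max_def by measurable

lemma maximal_inequality:
  assumes f [measurable]: "f \<in> H2"
  shows "(\<integral>\<^sup>+t. radial_max f t \<partial>circ) \<le> 256 * ennreal ((h2_norm f)\<^sup>2)"
proof -
  have "(\<integral>\<^sup>+t. radial_max f t \<partial>circ) = (SUP n. \<integral>\<^sup>+t. ennreal ((cmod (f (of_real (best_radius f n t) * cis t)))\<^sup>2) \<partial>circ)"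
    unfolding radial_max_def
  proof (rule nn_integral_monotone_convergence_SUP)
    show "incseq (\<lambda>n t. ennreal ((cmod (f (of_real (best_radius f n t) * cis t)))\<^sup>2))"
      by (rule incseq_SucI) (auto simp: le_fun_def intro!: ennreal_leI power_mono)
  qed measurable
  also have "\<dots> \<le> 256 * ennreal ((h2_norm f)\<^sup>2)"
  proof (rule SUP_least)
    fix n
    have "Max (radius ` {..n}) < 1" using radius by (subst Max_less_iff) auto
    then show "(\<integral>\<^sup>+t. ennreal ((cmod (f (of_real (best_radius f n t) * cis t)))\<^sup>2) \<partial>circ) \<le> 256 * ennreal ((h2_norm f)\<^sup>2)"
      by (intro linearized_maximal_inequality[OF f _ best_radius_bounds] best_radius_measurable f)
  qed
  finally show ?thesis .
qed

lemma radial_max_ge: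
  assumes f: "f \<in> H2" and r: "0 \<le> r" "r < 1"
  shows "ennreal ((cmod (f (of_real r * cis t)))\<^sup>2) \<le> radial_max f t"
proof (rule ccontr)
  let ?\<phi> = "\<lambda>r. ennreal ((cmod (f (of_real r * cis t)))\<^sup>2)"
  assume "\<not> ?\<phi> r \<le> radial_max f t"
  then have less: "radial_max f t < ?\<phi> r" by simp
  have "continuous_on {-1<..<1} (\<lambda>r. f (of_real r * cis t))"
    by (rule continuous_on_compose2[OF holomorphic_on_imp_continuous_on[OF H2_holomorphic[OF f]]])
       (auto intro!: continuous_intros simp: norm_mult)
  then have "continuous (at r) (\<lambda>r. f (of_real r * cis t))"
    using r by (auto simp: continuous_on_eq_continuous_at)
  then have "(?\<phi> \<longlongrightarrow> ?\<phi> r) (at r)"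
    unfolding continuous_at by (intro tendsto_intros)
  then have "eventually (\<lambda>x. radial_max f t < ?\<phi> x) (at_right r)"
    using order_tendstoD(1)[OF _ less] by (metis filterlim_at_split)
  moreover have "eventually (\<lambda>x. x < 1) (at_right r)"
    using r by (intro eventually_at_rightI[of r 1]) auto
  ultimately have "eventually (\<lambda>x. radial_max f t < ?\<phi> x \<and> x < 1) (at_right r)"
    by (rule eventually_conj)
  then obtain d where d: "r < d" "\<And>x. r < x \<Longrightarrow> x < d \<Longrightarrow> radial_max f t < ?\<phi> x \<and> x < 1"
    by (auto simp: eventually_at_right_field)
  obtain x where x: "x \<in> \<rat>" "r < x" "x < d" using Rats_dense_in_real[OF d(1)] by blast
  then obtain n where n: "x = radius n" using radius_ex[of x] d(2)[of x] r by auto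
  have "?\<phi> x \<le> ennreal ((cmod (f (of_real (best_radius f n t) * cis t)))\<^sup>2)"
    unfolding n by (intro ennreal_leI power_mono best_radius_best) simp
  also have "\<dots> \<le> radial_max f t" unfolding radial_max_def by (rule SUP_upper) simp
  finally show False using d(2)[OF x(2,3)] by (auto dest: leD)
qed

lemma ortho_sum_zpow_apply:
  "cmod z < 1 \<Longrightarrow> ortho_sum zpow c N z = (\<Sum>n<N. c n * z ^ n)"
  by (induction N) (simp_all add: ortho_sum_Suc plus_fun_apply zero_fun_apply cscale_def zpow_def on_disc_def)

text \<open>The remainders \<open>g N\<close> of the Taylor polynomials tend to 0 in norm, so by the maximal inequality
  their radial maximal functions have infimum 0 almost everywhere. On such a ray, \<open>f\<close> is uniformly
  approximated by polynomials, which are continuous up to the circle, and so satisfies the Cauchy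
  criterion.\<close>

theorem radial_limit_exists:
  assumes f: "f \<in> H2"
  shows "AE t in circ. \<exists>l. ((\<lambda>r. f (of_real r * cis t)) \<longlongrightarrow> l) (at_left (1::real))"
proof -
  define g where "g N = f - ortho_sum zpow (tc f) N" for N
  have g [measurable]: "g N \<in> H2" for N by (simp add: g_def H2_diff f ortho_sum_in_H2)
  have "(\<integral>\<^sup>+t. (INF N. radial_max (g N) t) \<partial>circ) \<le> 256 * ennreal ((h2_norm (g N))\<^sup>2)" for N
    by (rule order_trans[OF nn_integral_mono maximal_inequality[OF g]]) (rule INF_lower, simp)
  moreover have "(\<lambda>N. 256 * ennreal ((h2_norm (g N))\<^sup>2)) \<longlonglongrightarrow> 256 * ennreal (0\<^sup>2)"
    unfolding g_def by (intro tendsto_intros ennreal_tendsto_cmult taylor_sum_tendsto f) simp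
  ultimately have "(\<integral>\<^sup>+t. (INF N. radial_max (g N) t) \<partial>circ) \<le> 256 * ennreal (0\<^sup>2)"
    by (intro LIMSEQ_le_const) auto
  then have "(\<integral>\<^sup>+t. (INF N. radial_max (g N) t) \<partial>circ) = 0" by simp
  then have "AE t in circ. (INF N. radial_max (g N) t) = 0"
    by (subst (asm) nn_integral_0_iff_AE) measurable
  then show ?thesis
  proof eventually_elim
    case (elim t)
    let ?f = "\<lambda>r. f (of_real r * cis t)"
    have "cauchy_filter (filtermap ?f (at_left 1))"
      unfolding cauchy_filter_metric_filtermap
    proof (intro allI impI)
      fix e :: real assume e: "e > 0"
      have "(INF N. radial_max (g N) t) < ennreal ((e/4)\<^sup>2)" using e unfolding elim by simp
      then obtain N where N: "radial_max (g N) t < ennreal ((e/4)\<^sup>2)" by (auto simp: INF_less_iff)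
      have small: "cmod (g N (of_real r * cis t)) \<le> e / 4" if "0 \<le> r" "r < 1" for r
      proof (rule power2_le_imp_le)
        have "ennreal ((cmod (g N (of_real r * cis t)))\<^sup>2) < ennreal ((e/4)\<^sup>2)"
          using radial_max_ge[OF g that] N by (rule le_less_trans)
        then show "(cmod (g N (of_real r * cis t)))\<^sup>2 \<le> (e/4)\<^sup>2"
          by (meson ennreal_less_iff less_imp_le zero_le_power2)
      qed (use e in simp)
      define p where "p z = (\<Sum>n<N. tc f n * z ^ n)" for z
      have fp: "?f r = p (of_real r * cis t) + g N (of_real r * cis t)" if "0 \<le> r" "r < 1" for r
        using that ortho_sum_zpow_apply[of "of_real r * cis t" "tc f" N]
        by (simp add: g_def p_def norm_mult)
      have "((\<lambda>r. p (of_real r * cis t)) \<longlongrightarrow> p (of_real 1 * cis t)) (at_left 1)"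
        unfolding p_def by (intro tendsto_intros)
      then have "eventually (\<lambda>r. dist (p (of_real r * cis t)) (p (of_real 1 * cis t)) < e / 4) (at_left 1)"
        using e by (intro tendstoD) auto
      moreover have "eventually (\<lambda>r::real. 0 < r \<and> r < 1) (at_left 1)"
        by (intro eventually_at_leftI[of 0]) auto
      ultimately have ev: "eventually (\<lambda>r. dist (p (of_real r * cis t)) (p (of_real 1 * cis t)) < e / 4 \<and> 0 < r \<and> r < 1) (at_left 1)"
        by (rule eventually_conj)
      have "dist (?f x) (?f y) < e"
        if "dist (p (of_real x * cis t)) (p (of_real 1 * cis t)) < e / 4 \<and> 0 < x \<and> x < 1"
          "dist (p (of_real y * cis t)) (p (of_real 1 * cis t)) < e / 4 \<and> 0 < y \<and> y < 1" for x y
      proof -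
        have "dist (?f x) (p (of_real x * cis t)) \<le> e / 4" "dist (?f y) (p (of_real y * cis t)) \<le> e / 4"
          using small[of x] small[of y] fp[of x] fp[of y] that by (auto simp: dist_norm)
        moreover have "dist (p (of_real x * cis t)) (p (of_real y * cis t)) < e / 2"
          using dist_triangle2[of "p (of_real x * cis t)" "p (of_real y * cis t)" "p (of_real 1 * cis t)"]
            that(1)[THEN conjunct1] that(2)[THEN conjunct1] by linarith
        moreover have "dist (?f x) (?f y) \<le> dist (?f x) (p (of_real x * cis t)) +
          dist (p (of_real x * cis t)) (p (of_real y * cis t)) + dist (?f y) (p (of_real y * cis t))"
          using dist_triangle[of "?f x" "?f y" "p (of_real x * cis t)"]
            dist_triangle[of "p (of_real x * cis t)" "?f y" "p (of_real y * cis t)"]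
            dist_commute[of "p (of_real y * cis t)" "?f y"] by linarith
        ultimately show ?thesis by linarith
      qed
      then show "\<exists>P. eventually P (at_left 1) \<and> (\<forall>x y. P x \<and> P y \<longrightarrow> dist (?f x) (?f y) < e)"
        using ev by blast
    qed
    then have "\<exists>l. filtermap ?f (at_left 1) \<le> nhds l"
      using convergent_filter_iff_cauchy convergent_filter_iff by blast
    then show ?case by (simp add: filterlim_def)
  qed
qed

section \<open>Inner functions are the wandering vectors\<close>

text \<open>The AE quantifier for Lebesgue measure on \<open>{0..2*pi}\<close> is the one for \<open>circ\<close>, since completing a
  measure does not change it.\<close>

lemma inner_function_alt:
  "inner_function \<theta> \<longleftrightarrow> \<theta> holomorphic_on unit_disc \<and> bounded (\<theta> ` unit_disc) \<and>
     (AE t in circ. \<exists>l. ((\<lambda>r. \<theta> (of_real r * cis t)) \<longlongrightarrow> l) (at_left (1::real)) \<and> cmod l = 1)"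
  unfolding inner_function_def AE_circ_iff
  by (simp add: AE_restrict_space_iff AE_completion_iff)

text \<open>A sequence of radii on which to take limits, as dominated convergence is about sequences.\<close>

definition rad :: "nat \<Rightarrow> real" where "rad k = 1 - 1 / real (k + 2)"

lemma rad: "0 < rad k" "rad k < 1"
  by (auto simp: rad_def)

lemma rad_tendsto: "rad \<longlonglongrightarrow> 1"
proof -
  have "(\<lambda>k. 1 - 1 / real (k + 2)) \<longlonglongrightarrow> 1 - 0"
    by (intro tendsto_intros LIMSEQ_ignore_initial_segment[OF lim_inverse_n'])
  then show ?thesis by (simp add: rad_def[abs_def])
qed

lemma rad_at_left: "filterlim rad (at_left 1) sequentially"
  using rad_tendsto rad by (auto simp: filterlim_at intro!: always_eventually less_imp_neq)

lemma on_disc_holomorphic: "f holomorphic_on unit_disc \<Longrightarrow> on_disc f holomorphic_on unit_disc"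
  by (rule holomorphic_transform) (auto simp: on_disc_def)

lemma on_disc_rad: "on_disc f (of_real (rad k) * cis t) = f (of_real (rad k) * cis t)"
  using rad[of k] by (auto simp: on_disc_def norm_mult)

lemma H2_eq_on_disc: "f \<in> H2 \<Longrightarrow> on_disc f = f"
  by (auto simp: on_disc_def fun_eq_iff H2_outside)

lemma bounded_in_H2:
  assumes f: "f holomorphic_on unit_disc" and B: "\<And>z. cmod z < 1 \<Longrightarrow> cmod (f z) \<le> B"
  shows "on_disc f \<in> H2"
proof (rule H2_boundedI(1)[where B = B])
  show "B \<ge> 0" by (rule order_trans[OF norm_ge_zero B[of 0]]) simp
  fix N
  have "(\<lambda>k. \<Sum>n<N. (cmod (tc f n))\<^sup>2 * ((rad k)\<^sup>2) ^ n) \<longlonglongrightarrow> (\<Sum>n<N. (cmod (tc f n))\<^sup>2 * (1\<^sup>2) ^ n)"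
    by (intro tendsto_intros rad_tendsto)
  moreover have "(\<Sum>n<N. (cmod (tc f n))\<^sup>2 * ((rad k)\<^sup>2) ^ n) \<le> B\<^sup>2" for k
  proof -
    note P = dilated_Parseval[OF f rad[of k]]
    have "(\<Sum>n<N. (cmod (tc f n))\<^sup>2 * ((rad k)\<^sup>2) ^ n) \<le> (LINT s|circ. (cmod (f (of_real (rad k) * cis s)))\<^sup>2)"
      using sum_le_suminf[of "\<lambda>n. (cmod (tc f n))\<^sup>2 * ((rad k)\<^sup>2) ^ n" "{..<N}"] P by (simp add: sums_iff)
    also have "\<dots> \<le> (LINT s|circ. B\<^sup>2)"
    proof (rule integral_mono')
      fix s
      show "(cmod (f (of_real (rad k) * cis s)))\<^sup>2 \<le> B\<^sup>2"
        using rad[of k] by (intro power_mono B) (auto simp: norm_mult)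
    qed auto
    finally show ?thesis by simp
  qed
  ultimately show "(\<Sum>n<N. (cmod (tc (on_disc f) n))\<^sup>2) \<le> B\<^sup>2"
    by (intro LIMSEQ_le_const2[where X = "\<lambda>k. \<Sum>n<N. (cmod (tc f n))\<^sup>2 * ((rad k)\<^sup>2) ^ n"]) auto
  show "on_disc f z = 0" if "\<not> cmod z < 1" for z using that by (simp add: on_disc_def)
qed (rule on_disc_holomorphic[OF f])

lemma circle_means_tendsto:
  assumes f: "f \<in> H2"
  shows "(\<lambda>k. LINT s|circ. (cmod (f (of_real (rad k) * cis s)))\<^sup>2) \<longlonglongrightarrow> (h2_norm f)\<^sup>2"
proof -
  let ?a = "\<lambda>n k. (cmod (tc f n))\<^sup>2 * ((rad k)\<^sup>2) ^ n"
  have "((\<lambda>k. \<Sum>n. ?a n k) \<longlongrightarrow> (\<Sum>n. (cmod (tc f n))\<^sup>2)) sequentially"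
  proof (rule tannerys_theorem[THEN conjunct2, THEN conjunct2])
    show "(\<lambda>k. ?a n k) \<longlonglongrightarrow> (cmod (tc f n))\<^sup>2" for n
    proof -
      have "(\<lambda>k. ?a n k) \<longlonglongrightarrow> (cmod (tc f n))\<^sup>2 * (1\<^sup>2) ^ n" by (intro tendsto_intros rad_tendsto)
      then show ?thesis by simp
    qed
    have "norm (?a n k) \<le> (cmod (tc f n))\<^sup>2" for n k
      using rad[of k] by (auto intro!: mult_left_le simp: power_le_one)
    then show "eventually (\<lambda>(n, k). norm (?a n k) \<le> (cmod (tc f n))\<^sup>2) (sequentially \<times>\<^sub>F sequentially)"
      by (intro always_eventually) auto
  qed (auto intro: H2_summable f)
  moreover have "(\<Sum>n. ?a n k) = (LINT s|circ. (cmod (f (of_real (rad k) * cis s)))\<^sup>2)" for k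
    using dilated_Parseval[OF H2_holomorphic[OF f] rad[of k]] by (simp add: sums_iff)
  ultimately show ?thesis using h2_norm_sq_sums[OF f] by (simp add: sums_iff)
qed

text \<open>Dominated convergence in \<open>circle_means_tendsto\<close>.\<close>

lemma h2_norm_boundary:
  assumes f [measurable]: "f \<in> H2" and B: "\<And>z. cmod z < 1 \<Longrightarrow> cmod (f z) \<le> B"
    and L [measurable]: "L \<in> borel_measurable borel"
    and lim: "AE t in circ. (\<lambda>k. cmod (f (of_real (rad k) * cis t))) \<longlonglongrightarrow> L t"
  shows "(h2_norm f)\<^sup>2 = (LINT t|circ. (L t)\<^sup>2)" "integrable circ (\<lambda>t. (L t)\<^sup>2)"
proof -
  have *: "(\<lambda>t. (L t)\<^sup>2) \<in> borel_measurable circ" "(\<lambda>t. (cmod (f (of_real (rad k) * cis t)))\<^sup>2) \<in> borel_measurable circ" for k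
    by measurable
  have lim2: "AE t in circ. (\<lambda>k. (cmod (f (of_real (rad k) * cis t)))\<^sup>2) \<longlonglongrightarrow> (L t)\<^sup>2"
    using lim by eventually_elim (rule tendsto_power)
  have bd: "AE t in circ. norm ((cmod (f (of_real (rad k) * cis t)))\<^sup>2) \<le> B\<^sup>2" for k
  proof (rule AE_I2)
    fix t
    have "cmod (f (of_real (rad k) * cis t)) \<le> B" using rad[of k] by (intro B) (simp add: norm_mult)
    then show "norm ((cmod (f (of_real (rad k) * cis t)))\<^sup>2) \<le> B\<^sup>2" by (simp add: power_mono)
  qed
  show "integrable circ (\<lambda>t. (L t)\<^sup>2)"
    by (rule integrable_dominated_convergence[OF * _ lim2 bd]) simp
  have "(\<lambda>k. LINT t|circ. (cmod (f (of_real (rad k) * cis t)))\<^sup>2) \<longlonglongrightarrow> (LINT t|circ. (L t)\<^sup>2)"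
    by (rule integral_dominated_convergence[OF * _ lim2 bd]) simp
  from LIMSEQ_unique[OF circle_means_tendsto[OF f] this] show "(h2_norm f)\<^sup>2 = (LINT t|circ. (L t)\<^sup>2)" .
qed

text \<open>Multiplication by \<open>\<phi>\<close> does not change the boundary modulus, so \<open>\<phi> p\<close> has the norm of \<open>p\<close> for the
  polynomials \<open>p = 1 + c z\<^sup>n\<close>. Comparing the norms of \<open>\<phi> + c z\<^sup>n \<phi>\<close> and of \<open>1 + c z\<^sup>n\<close> for \<open>c = 1\<close> and \<open>c = \<i>\<close>
  gives the orthogonality of \<open>\<phi>\<close> and \<open>z\<^sup>n \<phi>\<close>.\<close>

lemma inner_imp_wandering:
  assumes "inner_function \<phi>"
  shows "wandering (on_disc \<phi>)"
proof -
  have hol: "\<phi> holomorphic_on unit_disc" and bd: "bounded (\<phi> ` unit_disc)"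
    and ae: "AE t in circ. \<exists>l. ((\<lambda>r. \<phi> (of_real r * cis t)) \<longlongrightarrow> l) (at_left (1::real)) \<and> cmod l = 1"
    using assms by (auto simp: inner_function_alt)
  obtain B where B: "\<And>z. cmod z < 1 \<Longrightarrow> cmod (\<phi> z) \<le> B"
    using bd unfolding bounded_iff by fastforce
  have B0: "B \<ge> 0" by (rule order_trans[OF norm_ge_zero B[of 0]]) simp
  define \<theta> where "\<theta> = on_disc \<phi>"
  have \<theta>: "\<theta> \<in> H2" unfolding \<theta>_def by (rule bounded_in_H2[OF hol B])
  have norm_eq: "h2_norm (\<theta> * (zpow 0 + cscale c (zpow n))) = h2_norm (zpow 0 + cscale c (zpow n))" for c n
  proof -
    define p where "p = zpow 0 + cscale c (zpow n)"
    have pH: "p \<in> H2" by (simp add: p_def H2_add H2_cscale)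
    define P where "P z = 1 + c * z ^ n" for z :: complex
    have pP: "p z = P z" if "cmod z < 1" for z
      using that by (simp add: p_def P_def zpow_def on_disc_def cscale_def plus_fun_apply)
    have Pb: "cmod (P z) \<le> 1 + cmod c" if "cmod z < 1" for z
    proof -
      have "cmod (P z) \<le> 1 + cmod (c * z ^ n)" unfolding P_def by (metis norm_one norm_triangle_ineq)
      also have "cmod (c * z ^ n) \<le> cmod c"
        using that by (simp add: norm_mult norm_power mult_left_le power_le_one)
      finally show ?thesis by simp
    qed
    have Pl: "(\<lambda>k. P (of_real (rad k) * cis t)) \<longlonglongrightarrow> P (cis t)" for t
    proof -
      have "(\<lambda>k. P (of_real (rad k) * cis t)) \<longlonglongrightarrow> P (of_real 1 * cis t)"
        unfolding P_def by (intro tendsto_intros rad_tendsto)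
      then show ?thesis by simp
    qed
    have pr: "p (of_real (rad k) * cis t) = P (of_real (rad k) * cis t)" for k t
      using rad[of k] by (intro pP) (simp add: norm_mult)
    have [measurable]: "(\<lambda>t. cmod (P (cis t))) \<in> borel_measurable borel"
      unfolding P_def by measurable
    have 1: "(h2_norm p)\<^sup>2 = (LINT t|circ. (cmod (P (cis t)))\<^sup>2)"
    proof (rule h2_norm_boundary(1)[OF pH])
      show "cmod (p z) \<le> 1 + cmod c" if "cmod z < 1" for z using Pb[OF that] pP[OF that] by simp
      show "AE t in circ. (\<lambda>k. cmod (p (of_real (rad k) * cis t))) \<longlonglongrightarrow> cmod (P (cis t))"
        unfolding pr by (intro AE_I2 tendsto_norm Pl)
    qed measurable
    have fb: "cmod (\<phi> z * P z) \<le> B * (1 + cmod c)" if "cmod z < 1" for z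
      unfolding norm_mult using B[OF that] Pb[OF that] B0 by (intro mult_mono) auto
    have eq: "\<theta> * p = on_disc (\<lambda>z. \<phi> z * P z)"
      by (auto simp: fun_eq_iff \<theta>_def on_disc_def times_fun_apply pP)
    have fH: "\<theta> * p \<in> H2"
      unfolding eq by (rule bounded_in_H2[OF _ fb]) (auto intro!: holomorphic_intros hol simp: P_def)
    have 2: "(h2_norm (\<theta> * p))\<^sup>2 = (LINT t|circ. (cmod (P (cis t)))\<^sup>2)"
    proof (rule h2_norm_boundary(1)[OF fH])
      show "cmod ((\<theta> * p) z) \<le> B * (1 + cmod c)" if "cmod z < 1" for z
        using fb[OF that] that by (simp add: eq on_disc_def)
      show "AE t in circ. (\<lambda>k. cmod ((\<theta> * p) (of_real (rad k) * cis t))) \<longlonglongrightarrow> cmod (P (cis t))"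
        using ae
      proof eventually_elim
        case (elim t)
        then obtain l where l: "((\<lambda>r. \<phi> (of_real r * cis t)) \<longlongrightarrow> l) (at_left (1::real))" "cmod l = 1" by blast
        have "(\<lambda>k. \<phi> (of_real (rad k) * cis t)) \<longlonglongrightarrow> l"
          using filterlim_compose[OF l(1) rad_at_left] .
        then have "(\<lambda>k. cmod (\<phi> (of_real (rad k) * cis t) * P (of_real (rad k) * cis t))) \<longlonglongrightarrow> cmod (l * P (cis t))"
          by (intro tendsto_intros Pl)
        then show ?case unfolding eq on_disc_rad by (simp add: norm_mult l)
      qed
    qed measurable
    from 1 2 have "(h2_norm (\<theta> * p))\<^sup>2 = (h2_norm p)\<^sup>2" by simp
    then show ?thesis unfolding p_def[symmetric] by (subst (asm) power2_eq_iff_nonneg) auto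
  qed
  have norm1: "h2_norm \<theta> = 1"
  proof -
    have "zpow 0 + cscale 0 (zpow n) = zpow 0" for n
      by (simp add: fun_eq_iff cscale_def plus_fun_apply)
    then show ?thesis using norm_eq[of 0 0] \<theta> h2_norm_zpow[of 0] by (simp add: mult.commute[of \<theta>])
  qed
  have "h2_inner (zpow n * \<theta>) \<theta> = 0" if n: "n \<ge> 1" for n
  proof -
    have "Re (h2_inner \<theta> (cscale c (zpow n * \<theta>))) = 0" for c
    proof -
      have "\<theta> * (zpow 0 + cscale c (zpow n)) = \<theta> + cscale c (zpow n * \<theta>)"
        using \<theta> by (simp add: distrib_left cscale_mult_left mult.commute[of \<theta>])
      then have "(h2_norm (\<theta> + cscale c (zpow n * \<theta>)))\<^sup>2 = (h2_norm (zpow 0 + cscale c (zpow n)))\<^sup>2"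
        using norm_eq[of c n] by simp
      moreover have "h2_inner (zpow 0) (zpow n) = 0" using orthonormal_zpow n by (simp add: orthonormal_def)
      ultimately show ?thesis
        using \<theta> by (simp add: h2_norm_add_sq H2_cscale h2_norm_cscale h2_norm_shift h2_norm_zpow norm1 h2_inner_cscale_right)
    qed
    from this[of 1] this[of \<i>] have "h2_inner \<theta> (zpow n * \<theta>) = 0"
      using \<theta> by (simp add: h2_inner_cscale_right complex_eq_iff)
    then show ?thesis using h2_inner_commute[of "zpow n * \<theta>" \<theta>] \<theta> by simp
  qed
  with \<theta> norm1 show ?thesis by (simp add: wandering_def \<theta>_def)
qed

lemma point_evaluation:
  assumes f: "f \<in> H2" and z: "cmod z < 1"
  shows "cmod (f z) \<le> h2_norm f * (1 / (1 - cmod z))"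
proof -
  have le: "cmod (tc f n * z ^ n) \<le> h2_norm f * cmod z ^ n" for n
    using taylor_coeff_le_norm[OF f, of n] by (simp add: norm_mult norm_power mult_right_mono)
  have g: "(\<lambda>n. h2_norm f * cmod z ^ n) sums (h2_norm f * (1 / (1 - cmod z)))"
    using z by (intro sums_mult geometric_sums) simp
  have "cmod (\<Sum>n. tc f n * z ^ n) \<le> (\<Sum>n. h2_norm f * cmod z ^ n)"
    by (rule norm_suminf_le[OF le sums_summable[OF g]])
  then show ?thesis using g taylor_sums[OF H2_holomorphic[OF f] z] by (simp add: sums_iff)
qed

text \<open>All powers of \<open>\<theta>\<close> have norm 1, so their values at \<open>z\<close> stay bounded.\<close>

lemma wandering_bounded:
  assumes \<theta>: "wandering \<theta>" and z: "cmod z < 1"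
  shows "cmod (\<theta> z) \<le> 1"
proof (rule ccontr)
  assume "\<not> cmod (\<theta> z) \<le> 1"
  then obtain n where n: "1 / (1 - cmod z) < cmod (\<theta> z) ^ n"
    using real_arch_pow[of "cmod (\<theta> z)"] by force
  define p where "p n = ((\<lambda>h. \<theta> * h) ^^ n) (zpow 0)" for n
  have p: "p n \<in> H2 \<and> h2_norm (p n) = h2_norm (zpow 0) \<and> p n z = \<theta> z ^ n" for n
  proof (induction n)
    case 0
    have "zpow 0 z = 1" using z by (simp add: zpow_def on_disc_def)
    then show ?case by (simp add: p_def)
  next
    case (Suc n)
    have "p (Suc n) = \<theta> * p n" by (simp add: p_def)
    moreover have "(\<theta> * p n) z = \<theta> z * p n z" by (rule times_fun_apply)
    ultimately show ?case
      using Suc wandering_mult_bounded(1)[OF \<theta>] h2_norm_wandering_mult[OF \<theta>] by simp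
  qed
  have "cmod (\<theta> z) ^ n \<le> 1 / (1 - cmod z)"
    using point_evaluation[of "p n" z] p[of n] z h2_norm_zpow[of 0] by (simp add: norm_power)
  with n show False by simp
qed

text \<open>The radial limits exist by Fatou's theorem. The function \<open>1 - (L t)\<^sup>2\<close> of the boundary modulus \<open>L\<close>
  is nonnegative and has integral \<open>1 - \<parallel>\<theta>\<parallel>\<^sup>2 = 0\<close>.\<close>

lemma wandering_imp_inner:
  assumes \<theta>: "wandering \<theta>"
  shows "inner_function \<theta>"
proof -
  have \<theta>H [measurable]: "\<theta> \<in> H2" and norm1: "h2_norm \<theta> = 1" using \<theta> by (auto simp: wandering_def)
  note bd = wandering_bounded[OF \<theta>]
  have ex: "AE t in circ. \<exists>l. ((\<lambda>r. \<theta> (of_real r * cis t)) \<longlongrightarrow> l) (at_left (1::real))"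
    by (rule radial_limit_exists[OF \<theta>H])
  define L where "L t = lim (\<lambda>k. cmod (\<theta> (of_real (rad k) * cis t)))" for t
  have Lm [measurable]: "L \<in> borel_measurable borel" unfolding L_def by measurable
  have L: "(\<lambda>k. cmod (\<theta> (of_real (rad k) * cis t))) \<longlonglongrightarrow> L t \<and> L t = cmod l"
    if "((\<lambda>r. \<theta> (of_real r * cis t)) \<longlongrightarrow> l) (at_left (1::real))" for t l
  proof -
    have "(\<lambda>k. cmod (\<theta> (of_real (rad k) * cis t))) \<longlonglongrightarrow> cmod l"
      using filterlim_compose[OF that rad_at_left] by (intro tendsto_norm)
    moreover from this have "L t = cmod l" unfolding L_def by (rule limI)
    ultimately show ?thesis by simp
  qed
  have lim: "AE t in circ. (\<lambda>k. cmod (\<theta> (of_real (rad k) * cis t))) \<longlonglongrightarrow> L t"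
    using ex by eventually_elim (use L in blast)
  have le: "AE t in circ. 0 \<le> 1 - (L t)\<^sup>2"
    using lim
  proof eventually_elim
    case (elim t)
    have "L t \<le> 1" by (rule LIMSEQ_le_const2[OF elim]) (use rad in \<open>auto intro!: bd simp: norm_mult less_imp_le\<close>)
    moreover have "0 \<le> L t" by (rule LIMSEQ_le_const[OF elim]) auto
    ultimately show ?case by (simp add: power_le_one)
  qed
  note bdry = h2_norm_boundary[OF \<theta>H bd Lm lim]
  have int: "integrable circ (\<lambda>t. 1 - (L t)\<^sup>2)" by (intro Bochner_Integration.integrable_diff bdry) simp
  have "(LINT t|circ. 1 - (L t)\<^sup>2) = 0"
    using bdry norm1 by (subst Bochner_Integration.integral_diff) auto
  then have "AE t in circ. 1 - (L t)\<^sup>2 = 0"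
    using integral_nonneg_eq_0_iff_AE[OF int le] by simp
  with ex have "AE t in circ. \<exists>l. ((\<lambda>r. \<theta> (of_real r * cis t)) \<longlongrightarrow> l) (at_left (1::real)) \<and> cmod l = 1"
  proof eventually_elim
    case (elim t)
    then obtain l where l: "((\<lambda>r. \<theta> (of_real r * cis t)) \<longlongrightarrow> l) (at_left (1::real))" by blast
    from elim L[OF l] have "(cmod l)\<^sup>2 = 1" by simp
    then have "cmod l = 1" using norm_ge_zero[of l] by (simp add: power2_eq_1_iff)
    with l show ?case by blast
  qed
  then show ?thesis
    using bd H2_holomorphic[OF \<theta>H] by (auto simp: inner_function_alt bounded_iff intro!: exI[of _ 1])
qed

section \<open>Ranges of inner functions\<close>

lemma z2_theta_H2_alt: "z2_theta_H2 \<theta> = {zpow 2 * on_disc \<theta> * f | f. f \<in> H2}"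
proof -
  have "(\<lambda>z. z\<^sup>2 * \<theta> z * f z) = zpow 2 * on_disc \<theta> * f" if "f \<in> H2" for f
    using H2_outside[OF that] by (auto simp: fun_eq_iff times_fun_apply zpow_def on_disc_def)
  then show ?thesis unfolding z2_theta_H2_def by (metis (no_types, lifting))
qed

lemma wandering_shift_iff: "\<theta> \<in> H2 \<Longrightarrow> wandering (zpow k * \<theta>) \<longleftrightarrow> wandering \<theta>"
proof -
  assume \<theta>: "\<theta> \<in> H2"
  have "h2_inner (zpow n * (zpow k * \<theta>)) (zpow k * \<theta>) = h2_inner (zpow n * \<theta>) \<theta>" for n
    using h2_inner_shift[of "zpow n * \<theta>" \<theta> k] \<theta> by (simp add: mult.left_commute)
  then show ?thesis using \<theta> by (simp add: wandering_def h2_norm_shift)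
qed

text \<open>Up to a factor, \<open>\<theta>\<close> is the only vector of its range \<open>\<theta> H2\<close> that is orthogonal to \<open>z \<theta> H2\<close>, and \<open>\<phi>\<close>
  is another such vector if the ranges agree.\<close>

lemma wandering_unique:
  assumes \<theta>: "wandering \<theta>" and \<phi>: "wandering \<phi>"
    and eq: "{\<theta> * h | h. h \<in> H2} = {\<phi> * h | h. h \<in> H2}"
  obtains c where "cmod c = 1" "\<phi> = cscale c \<theta>"
proof -
  have H: "\<theta> \<in> H2" "\<phi> \<in> H2" "h2_norm \<theta> = 1" "h2_norm \<phi> = 1" using \<theta> \<phi> by (auto simp: wandering_def)
  have one: "f = f * zpow 0" if "f \<in> H2" for f using that by (simp add: mult.commute[of f])
  have "\<phi> \<in> {\<phi> * h | h. h \<in> H2}" using one[OF H(2)] zpow_in_H2 by blast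
  then obtain h where h: "h \<in> H2" "\<phi> = \<theta> * h" unfolding eq[symmetric] by blast
  have "\<theta> \<in> {\<theta> * h | h. h \<in> H2}" using one[OF H(1)] zpow_in_H2 by blast
  then obtain k where k: "k \<in> H2" "\<theta> = \<phi> * k" unfolding eq by blast
  have "tc h n = 0" if "n \<ge> 1" for n
  proof -
    have "tc h n = h2_inner (\<theta> * h) (\<theta> * zpow n)"
      by (simp add: h2_inner_wandering_mult[OF \<theta>] h h2_inner_zpow)
    also have "\<dots> = h2_inner (\<phi> * zpow 0) (\<phi> * (zpow n * k))"
      using one[OF H(2)] h(2) k(2) by (metis mult.assoc mult.commute)
    also have "\<dots> = h2_inner (zpow 0) (zpow n * k)"
      by (simp add: h2_inner_wandering_mult[OF \<phi>] k)
    also have "\<dots> = cnj (tc (zpow n * k) 0)"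
      using h2_inner_commute[of "zpow 0" "zpow n * k"] k by (simp add: h2_inner_zpow)
    also have "\<dots> = 0" using that k by (simp add: taylor_coeff_shift)
    finally show ?thesis .
  qed
  then have "h = cscale (tc h 0) (zpow 0)"
    by (intro H2_eqI h H2_cscale) (auto simp: taylor_coeff_cscale)
  then have \<phi>eq: "\<phi> = cscale (tc h 0) \<theta>"
    using h(2) one[OF H(1)] by (metis cscale_mult_left(2))
  then have "cmod (tc h 0) = 1" using H h2_norm_cscale[OF H(1), of "tc h 0"] by simp
  with \<phi>eq that show thesis by blast
qed

section \<open>The compressed shift\<close>

lemma h2_proj_ortho:
  assumes e: "e \<in> H2" "h2_norm e = 1" and f: "f \<in> H2"
  shows "h2_proj (ortho {e}) f = f - cscale (h2_inner f e) e"
  unfolding h2_proj_def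
proof (rule the_equality)
  let ?g = "f - cscale (h2_inner f e) e"
  have g: "?g \<in> ortho {e}"
    using assms by (simp add: ortho_def H2_diff H2_cscale h2_inner_diff_left h2_inner_cscale_left h2_inner_self)
  have fg: "f - ?g = cscale (h2_inner f e) e" by simp
  have orth: "h2_inner (f - ?g) h = 0" if "h \<in> ortho {e}" for h
    unfolding fg using that e h2_inner_commute[of e h] by (simp add: h2_inner_cscale_left ortho_def)
  with g show "?g \<in> ortho {e} \<and> (\<forall>h\<in>ortho {e}. h2_inner (f - ?g) h = 0)" by blast
  fix g' assume g': "g' \<in> ortho {e} \<and> (\<forall>h\<in>ortho {e}. h2_inner (f - g') h = 0)"
  have H: "?g \<in> H2" "g' \<in> H2" using g g' by (auto simp: ortho_def)
  have d: "g' - ?g \<in> ortho {e}" using g g' cfun.subspace_diff[OF subspace_ortho[of "{e}"]] e by blast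
  have "g' - ?g = (f - ?g) - (f - g')" by simp
  then have "h2_inner (g' - ?g) (g' - ?g) = h2_inner (f - ?g) (g' - ?g) - h2_inner (f - g') (g' - ?g)"
    using h2_inner_diff_left[of "f - ?g" "f - g'" "g' - ?g"] H f by (simp only: H2_diff)
  also have "\<dots> = 0" using orth[OF d] g' d by simp
  finally have "g' - ?g = 0" using h2_inner_self_eq_0_iff[of "g' - ?g"] H by (simp only: H2_diff)
  then show "g' = ?g" by (simp only: right_minus_eq)
qed

text \<open>The unit vector that is orthogonal to \<open>H2ab \<alpha> \<beta>\<close> in \<open>H2\<close>, namely \<open>cnj \<beta> - cnj \<alpha> * z\<close>.\<close>

definition defect :: "complex \<Rightarrow> complex \<Rightarrow> complex \<Rightarrow> complex" where
  "defect \<alpha> \<beta> = cscale (cnj \<beta>) (zpow 0) - cscale (cnj \<alpha>) (zpow 1)"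

lemma defect_in_H2 [simp]: "defect \<alpha> \<beta> \<in> H2"
  by (simp add: defect_def H2_diff H2_cscale)

lemma h2_inner_defect: "f \<in> H2 \<Longrightarrow> h2_inner f (defect \<alpha> \<beta>) = \<beta> * tc f 0 - \<alpha> * tc f 1"
  by (simp add: defect_def h2_inner_diff_right h2_inner_cscale_right H2_cscale h2_inner_zpow del: One_nat_def)

lemma taylor_coeff_defect: "tc (defect \<alpha> \<beta>) n = (if n = 0 then cnj \<beta> else if n = 1 then - cnj \<alpha> else 0)"
  by (simp add: defect_def taylor_coeff_diff taylor_coeff_cscale H2_cscale)

lemma h2_norm_defect: 
  assumes "(cmod \<alpha>)\<^sup>2 + (cmod \<beta>)\<^sup>2 = 1" shows "h2_norm (defect \<alpha> \<beta>) = 1"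
proof -
  have "complex_of_real ((h2_norm (defect \<alpha> \<beta>))\<^sup>2) = \<beta> * cnj \<beta> + \<alpha> * cnj \<alpha>"
    by (simp add: h2_inner_self[symmetric] h2_inner_defect taylor_coeff_defect del: of_real_power)
  also have "\<dots> = of_real ((cmod \<alpha>)\<^sup>2 + (cmod \<beta>)\<^sup>2)" unfolding of_real_add complex_norm_square by simp
  finally have "(h2_norm (defect \<alpha> \<beta>))\<^sup>2 = 1" unfolding of_real_eq_iff assms .
  then show ?thesis using h2_norm_nonneg[of "defect \<alpha> \<beta>"] by (simp add: power2_eq_1_iff)
qed

lemma H2ab_eq_ortho:
  assumes "\<alpha> \<noteq> 0"
  shows "H2ab \<alpha> \<beta> = ortho {defect \<alpha> \<beta>}"
proof -
  define u where "u = on_disc (\<lambda>z. \<alpha> + \<beta> * z)"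
  define G where "G = {u} \<union> {on_disc (\<lambda>z. z ^ n) | n. n \<ge> 2}"
  have u: "u = cscale \<alpha> (zpow 0) + cscale \<beta> (zpow 1)"
    by (auto simp: u_def fun_eq_iff plus_fun_apply cscale_def zpow_def on_disc_def)
  have "zpow n \<in> ortho {defect \<alpha> \<beta>}" if "n \<ge> 2" for n
    using that by (simp add: ortho_def h2_inner_defect)
  moreover have "u \<in> ortho {defect \<alpha> \<beta>}"
    by (simp add: u ortho_def h2_inner_defect H2_add H2_cscale taylor_coeff_add taylor_coeff_cscale)
  ultimately have "G \<subseteq> ortho {defect \<alpha> \<beta>}" by (auto simp: G_def zpow_def)
  then have sp: "cfun.span G \<subseteq> ortho {defect \<alpha> \<beta>}"
    by (rule cfun.span_minimal) (simp add: subspace_ortho)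
  then have "h2.mtopology closure_of cfun.span G \<subseteq> ortho {defect \<alpha> \<beta>}"
    by (rule closure_of_minimal) (simp add: closed_ortho)
  moreover have "ortho {defect \<alpha> \<beta>} \<subseteq> h2.mtopology closure_of cfun.span G"
  proof
    fix f assume f: "f \<in> ortho {defect \<alpha> \<beta>}"
    then have fH: "f \<in> H2" and rel: "\<beta> * tc f 0 = \<alpha> * tc f 1"
      by (auto simp: ortho_def h2_inner_defect)
    have trunc: "ortho_sum zpow (tc f) (N + 2) \<in> cfun.span G" for N
    proof (induction N)
      case 0
      have "ortho_sum zpow (tc f) (0 + 2) = cscale (tc f 0 / \<alpha>) u"
        by (rule H2_eqI) (use assms rel in \<open>auto simp: ortho_sum_in_H2 taylor_coeff_ortho_sum_zpow u taylor_coeff_cscale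
            taylor_coeff_add H2_add H2_cscale less_Suc_eq field_simps\<close>)
      moreover have "u \<in> G" by (simp add: G_def)
      ultimately show ?case using cfun.span_scale[OF cfun.span_base] by simp
    next
      case (Suc N)
      have "zpow (N + 2) \<in> G" unfolding G_def zpow_def using le_add2[of 2 N] by blast
      then have "ortho_sum zpow (tc f) (N + 2) + cscale (tc f (N + 2)) (zpow (N + 2)) \<in> cfun.span G"
        by (intro cfun.span_add Suc cfun.span_scale cfun.span_base)
      then show ?case using ortho_sum_Suc[of zpow "tc f" "N + 2"] by simp
    qed
    have sub: "cfun.span G \<subseteq> topspace h2.mtopology"
      using sp by (auto simp: ortho_def)
    show "f \<in> h2.mtopology closure_of cfun.span G"
    proof (rule h2_closedD[OF closedin_closure_of _ fH])
      show "ortho_sum zpow (tc f) (N + 2) \<in> h2.mtopology closure_of cfun.span G" for N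
        using trunc closure_of_subset[OF sub] by blast
      have "h2_norm (ortho_sum zpow (tc f) (N + 2) - f) = h2_norm (f - ortho_sum zpow (tc f) (N + 2))" for N
        by (intro h2_norm_minus_commute fH ortho_sum_in_H2) simp
      then show "(\<lambda>N. h2_norm (ortho_sum zpow (tc f) (N + 2) - f)) \<longlonglongrightarrow> 0"
        using LIMSEQ_ignore_initial_segment[OF taylor_sum_tendsto[OF fH], of 2] by simp
    qed
  qed
  ultimately show ?thesis unfolding H2ab_def G_def u_def by blast
qed

lemma Sab_eq:
  assumes "\<alpha> \<noteq> 0" "(cmod \<alpha>)\<^sup>2 + (cmod \<beta>)\<^sup>2 = 1" and f: "f \<in> H2"
  shows "Sab \<alpha> \<beta> f = zpow 1 * f + cscale (\<alpha> * tc f 0) (defect \<alpha> \<beta>)"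
proof -
  have "Mz f = zpow 1 * f" using zpow_mult_eq[OF f, of 1] by (simp add: Mz_def)
  moreover have "h2_inner (zpow 1 * f) (defect \<alpha> \<beta>) = - (\<alpha> * tc f 0)"
    using f by (simp add: h2_inner_defect taylor_coeff_shift)
  ultimately have "Sab \<alpha> \<beta> f = zpow 1 * f - cscale (- (\<alpha> * tc f 0)) (defect \<alpha> \<beta>)"
    unfolding Sab_def H2ab_eq_ortho[OF assms(1)] using f by (simp add: h2_proj_ortho h2_norm_defect assms del: One_nat_def cfun.scale_minus_left)
  then show ?thesis by simp
qed

text \<open>The left-hand side is \<open>Sab \<alpha> \<beta> f\<close>. Comparing values at 0, \<open>\<alpha> * cnj \<beta>\<close> is the only possible
  eigenvalue for an \<open>f\<close> with \<open>f(0) \<noteq> 0\<close>. At the point \<open>w = \<alpha> * cnj \<beta>\<close> of the disc, \<open>z f\<close> and \<open>w f\<close> agree,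
  so an eigenvector would force \<open>defect \<alpha> \<beta>\<close> to vanish at \<open>w\<close>; but its value there is
  \<open>cnj \<beta> * (cmod \<beta>)\<^sup>2\<close>.\<close>

lemma no_eigenvector:
  assumes "\<alpha> \<noteq> 0" "\<beta> \<noteq> 0" and nrm: "(cmod \<alpha>)\<^sup>2 + (cmod \<beta>)\<^sup>2 = 1" and f: "f \<in> H2" "tc f 0 \<noteq> 0"
  shows "zpow 1 * f + cscale (\<alpha> * tc f 0) (defect \<alpha> \<beta>) \<noteq> cscale (\<alpha> * cnj \<beta>) f"
proof
  assume eq: "zpow 1 * f + cscale (\<alpha> * tc f 0) (defect \<alpha> \<beta>) = cscale (\<alpha> * cnj \<beta>) f"
  define w where "w = \<alpha> * cnj \<beta>"
  have "2 * cmod w \<le> 1"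
    using sum_squares_bound[of "cmod \<alpha>" "cmod \<beta>"] nrm by (simp add: w_def norm_mult mult.assoc)
  then have w: "cmod w < 1" by linarith
  have "w * f w + \<alpha> * tc f 0 * (cnj \<beta> - cnj \<alpha> * w) = w * f w"
    using fun_cong[OF eq, of w] w
    by (simp add: plus_fun_apply times_fun_apply cscale_def defect_def zpow_def on_disc_def flip: w_def)
  then have "cnj \<beta> - cnj \<alpha> * w = 0" using assms by simp
  moreover have "cnj \<beta> - cnj \<alpha> * w = cnj \<beta> * (1 - \<alpha> * cnj \<alpha>)" by (simp add: w_def algebra_simps)
  moreover have "1 - \<alpha> * cnj \<alpha> = of_real ((cmod \<beta>)\<^sup>2)"
  proof -
    have "(cmod \<beta>)\<^sup>2 = 1 - (cmod \<alpha>)\<^sup>2" using nrm by linarith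
    then show ?thesis by (simp only: complex_norm_square[symmetric] of_real_diff of_real_1)
  qed
  ultimately show False using assms by simp
qed

section \<open>Invariant subspaces of the compressed shift\<close>

text \<open>Two nonzero orthogonal vectors would be linearly independent.\<close>

lemma one_dim_orthogonal:
  assumes dim: "cfun.dim V = 1" and V: "V \<subseteq> H2" and uv: "u \<in> V" "v \<in> V" "h2_inner u v = 0" and "v \<noteq> 0"
  shows "u = 0"
proof -
  obtain B where B: "B \<subseteq> V" "V \<subseteq> cfun.span B" "card B = cfun.dim V"
    using cfun.basis_exists[of V] by metis
  then obtain b where b: "B = {b}" using dim by (metis card_1_singletonE)
  obtain c where c: "u = cscale c b" using B uv b by (auto simp: cfun.span_singleton)
  obtain d where d: "v = cscale d b" using B uv b by (auto simp: cfun.span_singleton)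
  have bH: "b \<in> H2" "b \<noteq> 0" "d \<noteq> 0" using B b V d \<open>v \<noteq> 0\<close> by auto
  have "c * (cnj d * h2_inner b b) = 0"
    using uv(3) bH unfolding c d by (simp add: h2_inner_cscale_left h2_inner_cscale_right H2_cscale)
  then have "c = 0" using bH by (simp add: h2_inner_self_eq_0_iff)
  then show ?thesis by (simp add: c)
qed

lemma wandering_z2:
  assumes "wandering (on_disc \<phi>)"
  shows "wandering (zpow 2 * on_disc \<phi>)"
  using assms wandering_shift_iff[of "on_disc \<phi>" 2] by (simp add: wandering_def)

lemma taylor_coeff_z2_theta:
  assumes "wandering (on_disc \<phi>)" "g \<in> z2_theta_H2 \<phi>"
  shows "tc g 0 = 0"
proof -
  obtain h where h: "h \<in> H2" "g = zpow 2 * (on_disc \<phi> * h)"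
    using assms(2) unfolding z2_theta_H2_alt by (auto simp: mult.assoc)
  then show ?thesis using wandering_mult_bounded(1)[OF assms(1) h(1)] by (simp add: taylor_coeff_shift)
qed

text \<open>On functions vanishing at 0 the compressed shift is multiplication by \<open>z\<close>, so the elements of
  \<open>M\<close> vanishing at 0 form a shift-invariant subspace, to which Beurling's theorem applies: it is
  nonzero since otherwise \<open>M\<close> would be spanned by one eigenvector. As \<open>M\<close> lies in the closed span of
  \<open>\<alpha> + \<beta> z\<close> and \<open>z\<^sup>2 H2\<close>, its elements vanishing at 0 vanish there to second order, whence the
  factor \<open>z\<^sup>2\<close>.\<close>

lemma vanishing_part_eq_z2_theta:
  fixes \<alpha> \<beta> :: complex
  assumes ab: "\<alpha> \<noteq> 0" "\<beta> \<noteq> 0" "(cmod \<alpha>)\<^sup>2 + (cmod \<beta>)\<^sup>2 = 1"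
    and MK: "M \<subseteq> H2ab \<alpha> \<beta>" and Msub: "cfun.subspace M" and Mcl: "closedin h2.mtopology M"
    and ne: "M \<noteq> {0}" and inv: "Sab \<alpha> \<beta> ` M \<subseteq> M"
  obtains \<theta> where "inner_function \<theta>" "z2_theta_H2 \<theta> = {f \<in> M. tc f 0 = 0}"
proof -
  have MH: "M \<subseteq> H2" using MK unfolding H2ab_eq_ortho[OF ab(1)] by (auto simp: ortho_def)
  have rel: "\<beta> * tc f 0 = \<alpha> * tc f 1" if "f \<in> M" for f
  proof -
    have "f \<in> ortho {defect \<alpha> \<beta>}" using that MK unfolding H2ab_eq_ortho[OF ab(1)] by blast
    then show ?thesis by (auto simp: ortho_def h2_inner_defect)
  qed
  have S: "zpow 1 * f + cscale (\<alpha> * tc f 0) (defect \<alpha> \<beta>) \<in> M" if "f \<in> M" for f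
  proof -
    have "Sab \<alpha> \<beta> f \<in> M" using that inv by blast
    moreover have "f \<in> H2" using that MH by blast
    ultimately show ?thesis using Sab_eq[OF ab(1,3)] by simp
  qed
  define N where "N = M \<inter> ortho {zpow 0}"
  have N_iff: "f \<in> N \<longleftrightarrow> f \<in> M \<and> tc f 0 = 0" for f
    using MH by (auto simp: N_def ortho_def h2_inner_zpow subset_iff)
  have NI: "f \<in> N" if "f \<in> M" "tc f 0 = 0" for f using that by (simp add: N_iff)
  have NH: "N \<subseteq> H2" using MH by (auto simp: N_def)
  have Nsub: "cfun.subspace N" unfolding N_def by (intro cfun.subspace_inter Msub subspace_ortho) simp
  have Ncl: "closedin h2.mtopology N" unfolding N_def by (intro closedin_Int Mcl closed_ortho) simp
  have Ninv: "zpow 1 * f \<in> N" if "f \<in> N" for f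
    using S[of f] that NH by (auto simp: N_iff taylor_coeff_shift subset_iff)
  have Nne: "N \<noteq> {0}"
  proof
    assume N0: "N = {0}"
    obtain f where f: "f \<in> M" "f \<noteq> 0" using ne cfun.subspace_0[OF Msub] by blast
    have fH: "f \<in> H2" using f MH by blast
    have f0: "tc f 0 \<noteq> 0" using N0 NI f by blast
    define Sf where "Sf = zpow 1 * f + cscale (\<alpha> * tc f 0) (defect \<alpha> \<beta>)"
    have SfM: "Sf \<in> M" using S[OF f(1)] by (simp only: Sf_def)
    have "Sf - cscale (\<alpha> * cnj \<beta>) f \<in> M"
      by (intro cfun.subspace_diff[OF Msub] cfun.subspace_scale[OF Msub] f SfM)
    moreover have "tc (Sf - cscale (\<alpha> * cnj \<beta>) f) 0 = 0"
      using fH unfolding Sf_def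
      by (simp add: taylor_coeff_diff taylor_coeff_add taylor_coeff_cscale taylor_coeff_shift H2_add H2_cscale taylor_coeff_defect)
    ultimately have "Sf - cscale (\<alpha> * cnj \<beta>) f = 0" using NI N0 by blast
    then have "Sf = cscale (\<alpha> * cnj \<beta>) f" by (simp only: right_minus_eq)
    then show False using no_eigenvector[OF ab fH f0] by (simp only: Sf_def)
  qed
  obtain \<psi> where \<psi>: "wandering \<psi>" "N = {\<psi> * h | h. h \<in> H2}"
    by (rule Beurling[OF Nsub Ncl Nne Ninv])
  have \<psi>H: "\<psi> \<in> H2" using \<psi>(1) by (simp add: wandering_def)
  have "\<psi> * zpow 0 \<in> N" unfolding \<psi>(2) using zpow_in_H2 by blast
  then have \<psi>N: "\<psi> \<in> N" using \<psi>H by (simp add: mult.commute[of \<psi>])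
  have low: "tc \<psi> 0 = 0" "tc \<psi> 1 = 0" using \<psi>N rel[of \<psi>] ab by (auto simp: N_iff)
  define \<theta> where "\<theta> = h2_of (\<lambda>n. tc \<psi> (n + 2))"
  have "summable (\<lambda>n. (cmod (tc \<psi> (n + 2)))\<^sup>2)"
    using summable_iff_shift[of "\<lambda>n. (cmod (tc \<psi> n))\<^sup>2" 2] H2_summable[OF \<psi>H] by blast
  from h2_of[OF this] have \<theta>: "\<theta> \<in> H2" "\<And>n. tc \<theta> n = tc \<psi> (n + 2)" by (simp_all add: \<theta>_def)
  have \<psi>\<theta>: "\<psi> = zpow 2 * \<theta>"
  proof (rule H2_eqI[OF \<psi>H shift_in_H2[OF \<theta>(1)]])
    fix n
    show "tc \<psi> n = tc (zpow 2 * \<theta>) n"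
      unfolding taylor_coeff_shift[OF \<theta>(1)] \<theta>(2)
      using low by (cases "n < 2") (auto simp: less_2_cases_iff simp del: add_2_eq_Suc')
  qed
  have "inner_function \<theta>"
    using wandering_imp_inner wandering_shift_iff[OF \<theta>(1)] \<psi>(1) unfolding \<psi>\<theta> by blast
  moreover have "z2_theta_H2 \<theta> = N"
    unfolding z2_theta_H2_alt H2_eq_on_disc[OF \<theta>(1)] \<psi>(2) \<psi>\<theta> ..
  ultimately show thesis using that[of \<theta>] N_iff by auto
qed

text \<open>Subtracting from \<open>f\<close> its projection onto the subspace of functions vanishing at 0 does not
  change its value at 0.\<close>

lemma orthogonal_excess:
  assumes Msub: "cfun.subspace M" and MH: "M \<subseteq> H2"
    and \<psi>: "wandering \<psi>" and N: "{\<psi> * h | h. h \<in> H2} = {f \<in> M. tc f 0 = 0}"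
    and f: "f \<in> M" "tc f 0 \<noteq> 0"
  obtains f1 where "f1 \<in> M \<ominus>\<^sub>H {f \<in> M. tc f 0 = 0}" "tc f1 0 \<noteq> 0"
proof -
  have fH: "f \<in> H2" using f MH by blast
  obtain h where h: "h \<in> H2" "\<And>k. k \<in> H2 \<Longrightarrow> h2_inner (f - \<psi> * h) (\<psi> * k) = 0"
    by (rule wandering_range_projection[OF \<psi> fH]) blast
  have hN: "\<psi> * h \<in> M" "tc (\<psi> * h) 0 = 0" using N h by blast+
  have "f - \<psi> * h \<in> M" by (rule cfun.subspace_diff[OF Msub f(1) hN(1)])
  moreover have "h2_inner (f - \<psi> * h) g = 0" if "g \<in> {f \<in> M. tc f 0 = 0}" for g
    using that h(2) unfolding N[symmetric] by blast
  moreover have "tc (f - \<psi> * h) 0 \<noteq> 0"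
    using hN f MH fH by (simp add: taylor_coeff_diff subset_iff)
  ultimately show thesis using that[of "f - \<psi> * h"] unfolding h2_ominus_def by blast
qed

text \<open>Two elements of the complement have proportional values at 0, so a linear combination of them
  lies in the subspace of functions vanishing at 0, to which it is also orthogonal.\<close>

lemma dim_excess:
  assumes Msub: "cfun.subspace M" and MH: "M \<subseteq> H2"
    and f1: "f1 \<in> M \<ominus>\<^sub>H {f \<in> M. tc f 0 = 0}" "tc f1 0 \<noteq> 0"
  shows "cfun.dim (M \<ominus>\<^sub>H {f \<in> M. tc f 0 = 0}) = 1"
proof -
  define N where "N = {f \<in> M. tc f 0 = 0}"
  have f1M: "f1 \<in> M" and f1N: "\<And>g. g \<in> N \<Longrightarrow> h2_inner f1 g = 0"
    using f1 by (auto simp: h2_ominus_def N_def)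
  have f1H: "f1 \<in> H2" using f1M MH by blast
  have "f1 \<noteq> 0" using f1(2) h2_inner_zpow[OF zero_in_H2, of 0] by auto
  have "cfun.dim (M \<ominus>\<^sub>H N) = 1"
  proof (rule cfun.dim_unique[of "{f1}"])
    show "M \<ominus>\<^sub>H N \<subseteq> cfun.span {f1}"
    proof
      fix g assume "g \<in> M \<ominus>\<^sub>H N"
      then have g: "g \<in> M" "\<And>k. k \<in> N \<Longrightarrow> h2_inner g k = 0" by (auto simp: h2_ominus_def)
      have gH: "g \<in> H2" using g MH by blast
      define c where "c = tc g 0 / tc f1 0"
      define d where "d = g - cscale c f1"
      have dN: "d \<in> N"
        using g(1) f1M f1(2) gH f1H by (auto simp: N_def d_def c_def taylor_coeff_diff taylor_coeff_cscale H2_cscale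
            intro!: cfun.subspace_diff[OF Msub] cfun.subspace_scale[OF Msub])
      have dH: "d \<in> H2" using dN MH by (auto simp: N_def)
      have "h2_inner d d = h2_inner g d - c * h2_inner f1 d"
        using h2_inner_diff_left[OF gH H2_cscale[OF f1H] dH, of c] h2_inner_cscale_left[OF f1H dH, of c]
        unfolding d_def[symmetric] by simp
      also have "\<dots> = 0" using g(2)[OF dN] f1N[OF dN] by simp
      finally have "d = 0" using h2_inner_self_eq_0_iff[OF dH] by blast
      then have "g = cscale c f1" unfolding d_def by (simp only: right_minus_eq)
      then show "g \<in> cfun.span {f1}" by (auto simp: cfun.span_singleton)
    qed
  qed (use f1(1) \<open>f1 \<noteq> 0\<close> in \<open>auto simp: N_def\<close>)
  then show ?thesis by (simp add: N_def)
qed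

text \<open>This is what makes \<open>\<theta>\<close> unique: \<open>z\<^sup>2 \<theta> H2\<close> can be read off from \<open>M\<close>. In the one-dimensional case,
  \<open>M \<ominus> z\<^sup>2 \<phi> H2\<close> contains a nonzero vector orthogonal to all \<open>f \<in> M\<close> with \<open>f(0) = 0\<close>. Such an \<open>f\<close>
  orthogonal to \<open>z\<^sup>2 \<phi> H2\<close> would be a second, orthogonal direction, so it is 0.\<close>

lemma inner_rep_range:
  assumes Msub: "cfun.subspace M" and MH: "M \<subseteq> H2"
    and \<theta>: "inner_function \<theta>" "z2_theta_H2 \<theta> = {f \<in> M. tc f 0 = 0}"
    and rep: "inner_rep M \<phi>"
  shows "z2_theta_H2 \<phi> = {f \<in> M. tc f 0 = 0}"
proof -
  have w\<phi>: "wandering (on_disc \<phi>)" using rep by (intro inner_imp_wandering) (simp add: inner_rep_def)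
  note V0 = taylor_coeff_z2_theta[OF w\<phi>]
  define N where "N = {f \<in> M. tc f 0 = 0}"
  show ?thesis
  proof (cases "M = z2_theta_H2 \<phi>")
    case True
    then show ?thesis using V0 by blast
  next
    case False
    then have no: "\<nexists>\<phi>. inner_function \<phi> \<and> M = z2_theta_H2 \<phi>" and VM: "z2_theta_H2 \<phi> \<subseteq> M"
      and dim: "cfun.dim (M \<ominus>\<^sub>H z2_theta_H2 \<phi>) = 1" using rep by (auto simp: inner_rep_def)
    define \<xi> where "\<xi> = zpow 2 * on_disc \<phi>"
    have \<xi>: "wandering \<xi>" unfolding \<xi>_def by (rule wandering_z2[OF w\<phi>])
    have V: "z2_theta_H2 \<phi> = {\<xi> * h | h. h \<in> H2}" by (simp only: z2_theta_H2_alt \<xi>_def)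
    have VN: "z2_theta_H2 \<phi> \<subseteq> N" using VM V0 by (auto simp: N_def)
    have "M \<noteq> {f \<in> M. tc f 0 = 0}" using no \<theta> by metis
    then obtain f where f: "f \<in> M" "tc f 0 \<noteq> 0" by blast
    have w\<theta>: "wandering (zpow 2 * on_disc \<theta>)" by (intro wandering_z2 inner_imp_wandering \<theta>)
    obtain f1 where f1: "f1 \<in> M \<ominus>\<^sub>H N" "tc f1 0 \<noteq> 0"
      by (rule orthogonal_excess[OF Msub MH w\<theta> \<theta>(2)[unfolded z2_theta_H2_alt] f]) (simp add: N_def)
    have f1V: "f1 \<in> M \<ominus>\<^sub>H z2_theta_H2 \<phi>" using f1(1) VN by (auto simp: h2_ominus_def)
    have f1H: "f1 \<in> H2" using f1 MH by (auto simp: h2_ominus_def)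
    have "f1 \<noteq> 0" using f1(2) h2_inner_zpow[OF zero_in_H2, of 0] by auto
    have NM: "N \<subseteq> M" by (auto simp: N_def)
    have "N \<subseteq> z2_theta_H2 \<phi>"
    proof
      fix u assume u: "u \<in> N"
      then have uH: "u \<in> H2" using NM MH by blast
      obtain h where h: "h \<in> H2" "\<And>k. k \<in> H2 \<Longrightarrow> h2_inner (u - \<xi> * h) (\<xi> * k) = 0"
        by (rule wandering_range_projection[OF \<xi> uH]) blast
      have hV: "\<xi> * h \<in> z2_theta_H2 \<phi>" using V h by blast
      have hN: "\<xi> * h \<in> N" using hV VN by blast
      then have hH: "\<xi> * h \<in> H2" using NM MH by blast
      have wN: "u - \<xi> * h \<in> N"
        using u hN uH hH cfun.subspace_diff[OF Msub] by (simp add: N_def taylor_coeff_diff)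
      have wV: "u - \<xi> * h \<in> M \<ominus>\<^sub>H z2_theta_H2 \<phi>"
        using wN h(2) NM unfolding V h2_ominus_def by blast
      have "h2_inner f1 (u - \<xi> * h) = 0" using f1(1) wN by (simp add: h2_ominus_def)
      then have "h2_inner (u - \<xi> * h) f1 = 0"
        using h2_inner_commute[OF H2_diff[OF uH hH] f1H] by simp
      then have "u - \<xi> * h = 0"
        using one_dim_orthogonal[OF dim _ wV f1V _ \<open>f1 \<noteq> 0\<close>] MH by (auto simp: h2_ominus_def)
      then have "u = \<xi> * h" by (simp only: right_minus_eq)
      then show "u \<in> z2_theta_H2 \<phi>" using hV by simp
    qed
    with VN show ?thesis by (auto simp: N_def)
  qed
qed

text \<open>By uniqueness of the wandering vector; the factor \<open>z\<^sup>2\<close> is cancelled by comparing Taylor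
  coefficients.\<close>

lemma z2_theta_H2_inj:
  assumes "inner_function \<theta>" "inner_function \<phi>" "z2_theta_H2 \<theta> = z2_theta_H2 \<phi>"
  shows "\<exists>c. cmod c = 1 \<and> (\<forall>z\<in>unit_disc. \<phi> z = c * \<theta> z)"
proof -
  have w: "wandering (on_disc \<theta>)" "wandering (on_disc \<phi>)" using assms inner_imp_wandering by blast+
  then have H: "on_disc \<theta> \<in> H2" "on_disc \<phi> \<in> H2" by (auto simp: wandering_def)
  obtain c where c: "cmod c = 1" "zpow 2 * on_disc \<phi> = cscale c (zpow 2 * on_disc \<theta>)"
    by (rule wandering_unique[OF wandering_z2[OF w(1)] wandering_z2[OF w(2)] assms(3)[unfolded z2_theta_H2_alt]])
  have eq: "on_disc \<phi> = cscale c (on_disc \<theta>)"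
  proof (rule H2_eqI[OF H(2) H2_cscale[OF H(1)]])
    fix n
    have "tc (zpow 2 * on_disc \<phi>) (n + 2) = tc (cscale c (zpow 2 * on_disc \<theta>)) (n + 2)" by (simp only: c)
    then show "tc (on_disc \<phi>) n = tc (cscale c (on_disc \<theta>)) n"
      using H taylor_coeff_shift[OF H(1), of 2] taylor_coeff_shift[OF H(2), of 2]
        taylor_coeff_cscale[OF shift_in_H2[OF H(1)]] taylor_coeff_cscale[OF H(1)] by simp
  qed
  have "\<phi> z = c * \<theta> z" if "z \<in> unit_disc" for z
    using fun_cong[OF eq, of z] that by (simp add: on_disc_def cscale_def)
  with c(1) show ?thesis by blast
qed

theorem theorem3p3:
  fixes \<alpha> \<beta> :: complex and M :: "(complex \<Rightarrow> complex) set"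
  assumes "\<alpha> \<noteq> 0" and "\<beta> \<noteq> 0" and "(cmod \<alpha>)\<^sup>2 + (cmod \<beta>)\<^sup>2 = 1"
    and "M \<subseteq> H2ab \<alpha> \<beta>" and "cfun.subspace M" and "closedin h2.mtopology M" and "M \<noteq> {0}"
    and "Sab \<alpha> \<beta> ` M \<subseteq> M"
  shows "\<exists>\<theta>. inner_rep M \<theta> \<and>
           (\<forall>\<phi>. inner_rep M \<phi> \<longrightarrow> (\<exists>c. cmod c = 1 \<and> (\<forall>z\<in>unit_disc. \<phi> z = c * \<theta> z)))"
proof -
  have MH: "M \<subseteq> H2" using closedin_subset[OF assms(6)] by simp
  obtain \<theta>0 where \<theta>0: "inner_function \<theta>0" "z2_theta_H2 \<theta>0 = {f \<in> M. tc f 0 = 0}"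
    by (rule vanishing_part_eq_z2_theta[OF assms])
  have "\<exists>\<theta>. inner_rep M \<theta>"
  proof (cases "\<exists>\<phi>. inner_function \<phi> \<and> M = z2_theta_H2 \<phi>")
    case True
    then show ?thesis by (auto simp: inner_rep_def)
  next
    case False
    then have "M \<noteq> {f \<in> M. tc f 0 = 0}" using \<theta>0 by metis
    then obtain f where f: "f \<in> M" "tc f 0 \<noteq> 0" by blast
    have w: "wandering (zpow 2 * on_disc \<theta>0)" by (intro wandering_z2 inner_imp_wandering \<theta>0)
    obtain f1 where "f1 \<in> M \<ominus>\<^sub>H {f \<in> M. tc f 0 = 0}" "tc f1 0 \<noteq> 0"
      by (rule orthogonal_excess[OF assms(5) MH w \<theta>0(2)[unfolded z2_theta_H2_alt] f])
    then have "cfun.dim (M \<ominus>\<^sub>H {f \<in> M. tc f 0 = 0}) = 1" by (rule dim_excess[OF assms(5) MH])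
    then have "inner_rep M \<theta>0" unfolding inner_rep_def \<theta>0(2) using False \<theta>0 by auto
    then show ?thesis by blast
  qed
  then obtain \<theta> where \<theta>: "inner_rep M \<theta>" by blast
  have "\<exists>c. cmod c = 1 \<and> (\<forall>z\<in>unit_disc. \<phi> z = c * \<theta> z)" if "inner_rep M \<phi>" for \<phi>
  proof (rule z2_theta_H2_inj)
    show "inner_function \<theta>" "inner_function \<phi>" using \<theta> that by (auto simp: inner_rep_def)
    show "z2_theta_H2 \<theta> = z2_theta_H2 \<phi>" using inner_rep_range[OF assms(5) MH \<theta>0] \<theta> that by metis
  qed
  with \<theta> show ?thesis by blast
qed

end
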